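(* Let $\frac12<p<1$ and let $E\subset[0,1]^2$ be the random fractal percolation set with parameter $p$. Conditioned on non-extinction (that is, on $E\neq\emptyset$), almost surely \[ \dim_{\mathrm H} V_\ell(E)=\dim_{\mathrm B} V_\ell(E)=1 \] for all lines $\ell$ not meeting $E$ (simultaneously). Moreover, for any sequence $\{a_k\}$ such that $\frac{a_k}{k}\to\infty$, one has almost surely that, simultaneously for all lines $\ell$ not meeting $E$, \[ N_k(V_\ell(E))\le a_k 2^k\quad\text{for all } k\ge K, \] where $K$ depends on $E$, $\ell$ and the sequence $\{a_k\}$.
   Context: Fractal percolation: let $0<p<1$ and $Q_0=[0,1]\times[0,1]$. Divide $Q_0$ into four closed subsquares of equal size; each is chosen with probability $p$ and dropped with probability $1-p$, independently of each other. Let $\mathcal C_1$ be the collection of chosen subsquares. Each $Q\in\mathcal C_1$ is again divided into four subsquares of equal size, each chosen with probability $p$ independently; the collection of all chosen squares at the second level is $\mathcal C_2$. Continue inductively to define $\mathcal C_n$ (consisting of squares of side length $2^{-n}$), and set $E=\bigcap_{n=1}^\infty\bigcup\{Q: Q\in\mathcal C_n\}$. The probability measure induced on the space of constructions is $\mathbf P$. Visible part: for compact $E\subset\mathbb R^2$ and an affine line $\ell$ with $\ell\cap E=\emptyset$, $V_\ell(E)=\{a\in E: [a,\Pi_\ell(a)]\cap E=\{a\}\}$, where $\Pi_\ell$ is the orthogonal projection onto $\ell$ and $[a,b]$ is the closed line segment from $a$ to $b$. $N_k(A)$ is the number of (closed) dyadic squares of side length $2^{-k}$ that intersect a set $A\subset\mathbb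 R^2$. The upper and lower box dimensions of a bounded set $A$ are the $\limsup$ and $\liminf$ of $\log N_k(A)/\log 2^k$ as $k\to\infty$; $\dim_{\mathrm B}A$ denotes their common value when they coincide. $\dim_{\mathrm H}$ is Hausdorff dimension. *)

theory Defs
  imports "HOL-Probability.Probability"
begin

section \<open>Dyadic squares\<close>

definition dyadic_square :: "nat \<Rightarrow> int \<times> int \<Rightarrow> (real \<times> real) set" where
  "dyadic_square k = (\<lambda>(i, j).
     {of_int i / 2 ^ k .. of_int (i + 1) / 2 ^ k} \<times> {of_int j / 2 ^ k .. of_int (j + 1) / 2 ^ k})"

section \<open>Fractal percolation\<close>

text \<open>
  A construction assigns a coin to every pair of a level and a dyadic index; the coin for
  \<open>(n, (i, j))\<close> decides whether \<open>dyadic_square n (i, j)\<close> is retained once its parent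
  has been retained. Coins of level 0, and of squares outside the unit square, are never used.
\<close>

type_synonym construction = "nat \<times> int \<times> int \<Rightarrow> bool"

definition percolation_measure :: "real \<Rightarrow> construction measure" where
  "percolation_measure p = PiM UNIV (\<lambda>_. measure_pmf (bernoulli_pmf p))"

text \<open>
  The indices of the chosen squares of level \<open>n\<close>. The four quarters of
  \<open>dyadic_square n (i, j)\<close> are the squares of level \<open>n + 1\<close> whose indices reduce to
  \<open>(i, j)\<close> under \<open>div 2\<close>.
\<close>

primrec chosen :: "construction \<Rightarrow> nat \<Rightarrow> (int \<times> int) set" where
  "chosen \<omega> 0 = {(0, 0)}"
| "chosen \<omega> (Suc n) = {(i, j). (i div 2, j div 2) \<in> chosen \<omega> n \<and> \<omega> (Suc n, i, j)}"

definition percolation_set :: "construction \<Rightarrow> (real \<times> real) set" where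
  "percolation_set \<omega> = (\<Inter>n\<in>{1..}. \<Union>q\<in>chosen \<omega> n. dyadic_square n q)"

lemma sets_percolation_chosen:
  "{\<omega>. q \<in> chosen \<omega> n} \<in> sets (percolation_measure p)"
proof (induction n arbitrary: q)
  case 0
  have "{\<omega>. q \<in> chosen \<omega> 0} = (if q = (0, 0) then space (percolation_measure p) else {})"
    by (auto simp: percolation_measure_def space_PiM)
  then show ?case by simp
next
  case (Suc n)
  obtain i j where q: "q = (i, j)" by fastforce
  have "(\<lambda>\<omega>. \<omega> (Suc n, i, j)) -` {True} \<inter> space (percolation_measure p)
          \<in> sets (percolation_measure p)"
    unfolding percolation_measure_def
    by (rule measurable_sets[OF measurable_component_singleton]) auto
  then have "{\<omega>. \<omega> (Suc n, i, j)} \<in> sets (percolation_measure p)"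
    by (simp add: percolation_measure_def space_PiM vimage_def)
  with Suc have "{\<omega>. (i div 2, j div 2) \<in> chosen \<omega> n} \<inter> {\<omega>. \<omega> (Suc n, i, j)}
          \<in> sets (percolation_measure p)"
    by blast
  moreover have "{\<omega>. q \<in> chosen \<omega> (Suc n)}
      = {\<omega>. (i div 2, j div 2) \<in> chosen \<omega> n} \<inter> {\<omega>. \<omega> (Suc n, i, j)}"
    by (auto simp: q)
  ultimately show ?case by simp
qed

lemma finite_chosen: "finite (chosen \<omega> n)"
proof (induction n)
  case (Suc n)
  have "chosen \<omega> (Suc n) \<subseteq>
      (\<Union>(i, j)\<in>chosen \<omega> n. {2 * i .. 2 * i + 1} \<times> {2 * j .. 2 * j + 1})"
  proof
    fix q assume q: "q \<in> chosen \<omega> (Suc n)"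
    obtain i j where ij: "q = (i, j)" by fastforce
    have "(i div 2, j div 2) \<in> chosen \<omega> n" using q ij by simp
    moreover have "i \<in> {2 * (i div 2) .. 2 * (i div 2) + 1}" "j \<in> {2 * (j div 2) .. 2 * (j div 2) + 1}"
      by (simp_all, linarith+)
    ultimately show "q \<in> (\<Union>(i, j)\<in>chosen \<omega> n. {2 * i .. 2 * i + 1} \<times> {2 * j .. 2 * j + 1})"
      unfolding ij by blast
  qed
  then show ?case by (rule finite_subset) (use Suc in auto)
qed simp

lemma dyadic_square_Suc_subset:
  "dyadic_square (Suc n) (i, j) \<subseteq> dyadic_square n (i div 2, j div 2)"
proof -
  have *: "{of_int i / 2 ^ Suc n .. of_int (i + 1) / 2 ^ Suc n}
      \<subseteq> {real_of_int (i div 2) / 2 ^ n .. of_int (i div 2 + 1) / 2 ^ n}" for i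
  proof -
    have "2 * (i div 2) \<le> i" "i + 1 \<le> 2 * (i div 2 + 1)"
      by presburger+
    then have "real_of_int (2 * (i div 2)) \<le> of_int i"
        "real_of_int (i + 1) \<le> of_int (2 * (i div 2 + 1))"
      by (simp_all only: of_int_le_iff)
    then have "real_of_int (i div 2) \<le> of_int i / 2" "of_int (i + 1) / 2 \<le> real_of_int (i div 2 + 1)"
      by simp_all
    then have "real_of_int (i div 2) / 2 ^ n \<le> of_int i / 2 / 2 ^ n"
        "of_int (i + 1) / 2 / 2 ^ n \<le> real_of_int (i div 2 + 1) / 2 ^ n"
      by (intro divide_right_mono; simp)+
    then have "real_of_int (i div 2) / 2 ^ n \<le> of_int i / 2 ^ Suc n"
        "of_int (i + 1) / 2 ^ Suc n \<le> real_of_int (i div 2 + 1) / 2 ^ n"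
      by (simp_all only: power_Suc divide_divide_eq_left)
    then show ?thesis by (meson atLeastatMost_subset_iff)
  qed
  show ?thesis unfolding dyadic_square_def using *[of i] *[of j] by auto
qed

lemma percolation_set_nonempty_iff:
  "percolation_set \<omega> \<noteq> {} \<longleftrightarrow> (\<forall>n. chosen \<omega> n \<noteq> {})"
proof -
  define F where "F n = (\<Union>q\<in>chosen \<omega> n. dyadic_square n q)" for n
  have comp: "compact (F n)" for n
    unfolding F_def
    by (rule compact_UN[OF finite_chosen]) (auto simp: dyadic_square_def intro: compact_Times)
  have step: "F (Suc n) \<subseteq> F n" for n
  proof
    fix x assume "x \<in> F (Suc n)"
    then obtain i j where ij: "(i, j) \<in> chosen \<omega> (Suc n)" "x \<in> dyadic_square (Suc n) (i, j)"
      by (auto simp only: F_def)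
    then have "(i div 2, j div 2) \<in> chosen \<omega> n" "x \<in> dyadic_square n (i div 2, j div 2)"
      using dyadic_square_Suc_subset by auto
    then show "x \<in> F n" unfolding F_def by blast
  qed
  have dec: "F n \<subseteq> F m" if "m \<le> n" for m n
    using lift_Suc_antimono_le[of F, OF step that] .
  have ne: "F n \<noteq> {} \<longleftrightarrow> chosen \<omega> n \<noteq> {}" for n
  proof -
    have "dyadic_square n q \<noteq> {}" for q
      by (cases q) (simp add: dyadic_square_def divide_right_mono)
    then show ?thesis by (auto simp only: F_def UN_iff SUP_bot_conv)
  qed
  have "percolation_set \<omega> = (\<Inter>n. F n)"
  proof -
    have "(\<Inter>n\<in>{1..}. F n) \<subseteq> F n" for n
      using step[of n] by (cases n) auto
    then show ?thesis unfolding percolation_set_def F_def[symmetric] by blast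
  qed
  moreover have "(\<Inter>n. F n) \<noteq> {}" if "\<forall>n. F n \<noteq> {}"
    by (rule compact_nest) (use comp dec that in simp_all)
  ultimately have "percolation_set \<omega> \<noteq> {} \<longleftrightarrow> (\<forall>n. F n \<noteq> {})"
    by auto
  then show ?thesis by (simp add: ne)
qed

text \<open>Hence conditioning on non-extinction by \<open>uniform_measure\<close> is meaningful.\<close>

lemma sets_nonextinction:
  "{\<omega>. percolation_set \<omega> \<noteq> {}} \<in> sets (percolation_measure p)"
proof -
  have "{\<omega>. percolation_set \<omega> \<noteq> {}} = (\<Inter>n. \<Union>q. {\<omega>. q \<in> chosen \<omega> n})"
    by (auto simp: percolation_set_nonempty_iff)
  also have "\<dots> \<in> sets (percolation_measure p)"
  proof (rule sets.countable_INT)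
    have "(\<Union>q. {\<omega>. q \<in> chosen \<omega> n}) \<in> sets (percolation_measure p)" for n
      by (rule sets.countable_UN''[OF _ sets_percolation_chosen]) simp
    then show "range (\<lambda>n. \<Union>q. {\<omega>. q \<in> chosen \<omega> n}) \<subseteq> sets (percolation_measure p)"
      by blast
  qed simp
  finally show ?thesis .
qed

section \<open>Visible part\<close>

definition is_line :: "'a::euclidean_space set \<Rightarrow> bool" where
  "is_line l \<longleftrightarrow> affine l \<and> aff_dim l = 1"

definition orth_proj :: "'a::euclidean_space set \<Rightarrow> 'a \<Rightarrow> 'a" where
  "orth_proj l a = (THE b. b \<in> l \<and> (\<forall>c\<in>l. orthogonal (a - b) (c - b)))"

lemma orth_proj_eqI:
  assumes "b \<in> l" "\<And>c. c \<in> l \<Longrightarrow> orthogonal (a - b) (c - b)"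
  shows "orth_proj l a = b"
  unfolding orth_proj_def
proof (rule the_equality)
  fix b' assume b': "b' \<in> l \<and> (\<forall>c\<in>l. orthogonal (a - b') (c - b'))"
  have "(a - b) \<bullet> (b' - b) = 0" "(a - b') \<bullet> (b - b') = 0"
    using assms b' by (auto simp: orthogonal_def)
  then have "(b' - b) \<bullet> (b' - b) = 0"
    by (simp add: inner_diff_left inner_diff_right inner_commute)
  then show "b' = b" by simp
qed (use assms in auto)

lemma orth_proj_props:
  fixes l :: "'a::euclidean_space set"
  assumes "affine l" "l \<noteq> {}"
  shows "orth_proj l a \<in> l" "c \<in> l \<Longrightarrow> orthogonal (a - orth_proj l a) (c - orth_proj l a)"
proof -
  obtain x where x: "x \<in> l" using assms by blast
  define S where "S = (\<lambda>y. y - x) ` l"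
  have S: "subspace S"
    using affine_diffs_subspace_subtract[OF assms(1) x] by (simp add: S_def)
  obtain y z where yz: "y \<in> span S" "\<And>w. w \<in> span S \<Longrightarrow> orthogonal z w" "a - x = y + z"
    using orthogonal_subspace_decomp_exists[of S "a - x"] by metis
  have sp: "span S = S" using S by simp
  then have yS: "y \<in> S" using yz(1) by metis
  then have 1: "x + y \<in> l" by (auto simp: S_def)
  have 2: "orthogonal (a - (x + y)) (c - (x + y))" if "c \<in> l" for c
  proof -
    have "c - x \<in> S" using that by (auto simp: S_def)
    then have "(c - x) - y \<in> S" using S yS by (simp add: subspace_diff)
    moreover have "a - (x + y) = z" using yz(3) by (simp add: algebra_simps)
    ultimately show ?thesis using yz(2) sp by (simp add: algebra_simps)
  qed
  have "orth_proj l a = x + y" using 1 2 by (rule orth_proj_eqI)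
  with 1 2 show "orth_proj l a \<in> l" "c \<in> l \<Longrightarrow> orthogonal (a - orth_proj l a) (c - orth_proj l a)"
    by auto
qed

definition visible_part :: "'a::euclidean_space set \<Rightarrow> 'a set \<Rightarrow> 'a set" where
  "visible_part l E = {a \<in> E. closed_segment a (orth_proj l a) \<inter> E = {a}}"

section \<open>Box dimension\<close>

definition box_count :: "nat \<Rightarrow> (real \<times> real) set \<Rightarrow> nat" where
  "box_count k A = card {Q \<in> range (dyadic_square k). Q \<inter> A \<noteq> {}}"

text \<open>The box dimensions are meant for nonempty bounded sets.\<close>

definition upper_box_dim :: "(real \<times> real) set \<Rightarrow> ereal" where
  "upper_box_dim A = limsup (\<lambda>k. ereal (ln (real (box_count k A)) / ln (2 ^ k)))"

definition lower_box_dim :: "(real \<times> real) set \<Rightarrow> ereal" where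
  "lower_box_dim A = liminf (\<lambda>k. ereal (ln (real (box_count k A)) / ln (2 ^ k)))"

definition has_box_dim :: "(real \<times> real) set \<Rightarrow> ereal \<Rightarrow> bool" where
  "has_box_dim A d \<longleftrightarrow> lower_box_dim A = d \<and> upper_box_dim A = d"

section \<open>Hausdorff dimension\<close>

text \<open>
  The covering sets have to be bounded because \<open>diameter\<close> is unspecified on unbounded
  sets. These definitions are meant for \<open>s > 0\<close>: at \<open>s = 0\<close>, \<open>0 powr 0 = 0\<close>
  would give points weight zero. Restricting to \<open>s > 0\<close> does not affect the dimension.
\<close>

definition hausdorff_content :: "real \<Rightarrow> real \<Rightarrow> 'a::metric_space set \<Rightarrow> ennreal" where
  "hausdorff_content s \<delta> A =
     (INF U \<in> {U :: nat \<Rightarrow> 'a set. A \<subseteq> (\<Union>i. U i) \<and> (\<forall>i. bounded (U i) \<and> diameter (U i) \<le> \<delta>)}.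
        \<Sum>i. ennreal (diameter (U i) powr s))"

definition hausdorff_measure :: "real \<Rightarrow> 'a::metric_space set \<Rightarrow> ennreal" where
  "hausdorff_measure s A = (SUP \<delta>\<in>{0<..}. hausdorff_content s \<delta> A)"

definition hausdorff_dim :: "'a::metric_space set \<Rightarrow> ereal" where
  "hausdorff_dim A = (INF s\<in>{s. 0 < s \<and> hausdorff_measure s A = 0}. ereal s)"

end

theory Submission
  imports Defs
begin

text \<open>
  Call a set of lines hit if the percolation set meets all of its members. For lines in a compact set
  of non-axial directions that cut a chord of length bounded below out of the unit square, and for
  all lines parallel to one axis, this happens with positive probability: given the chosen
  squares of level \<open>n\<close>, the total length of the chords in the chosen squares of level
  \<open>n + 1\<close> is at least \<open>r' > 1 / 2\<close> times the old one, except with a probability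
  that by Hoeffding's inequality is doubly exponentially small in \<open>n\<close>, and only
  exponentially many lines have to be controlled at level \<open>n\<close>.

  Upper bound. Group the lines orthogonal to \<open>l\<close> into strips of width comparable to
  \<open>2 ^ - k\<close>. The parts of the percolation inside the squares of level \<open>k\<close> are
  independent, and each blocks a strip running centrally through its square with probability bounded
  below. So almost surely, for large \<open>k\<close> and all of the exponentially many strips, fewer than
  \<open>D * k\<close> chosen squares lie on a strip before the first blocking one. Visible squares that are
  crossed near a corner are charged to their last ancestor that is crossed centrally. This gives
  at most a constant times \<open>k * 2 ^ k\<close> visible squares.

  Lower bound. Conditioned on survival, some chosen square hits its lines almost surely, so the projection
  of the percolation set onto every line \<open>l\<close> contains an interval, and the visible part
  has the same projection.
\<close>

section \<open>Independence of coins\<close>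

text \<open>The hypothesis p > 1/2 enters through one comparison: the expected total chord length of
  a line decays like p ^ n, a single chord of level n has length at most 2 ^ -n, so about (2 * p) ^
  n independent coins act on every line. Hoeffding exponents then grow geometrically and beat
  exponentially fine nets. A line clipping a corner has an arbitrarily short chord, so blocking has
  no uniform positive probability there. This forces the restriction to central crossings, and
  charging the others needs slopes bounded away from 0 and infinity. Axis-parallel lines clip no
  corners and are treated separately; countably many slope ranges exhaust the rest. The position of
  \<open>l\<close> along its normal is one more uncountable parameter. It is removed by asking for a
  blocking square in every window between two positions of a strip; the number of windows is
  exponential in k. As \<open>l\<close> may run between parts of the set, its two sides are counted
  separately. Passing from positive probability to almost every surviving construction uses that the
  offspring generating function has at most one fixed point below 1.\<close>

definition depends_on :: "'i set \<Rightarrow> ('i \<Rightarrow> 'a) set \<Rightarrow> bool" where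
  "depends_on K H \<longleftrightarrow> (\<forall>\<omega> \<omega>'. (\<forall>c\<in>K. \<omega> c = \<omega>' c) \<longrightarrow> \<omega> \<in> H \<longrightarrow> \<omega>' \<in> H)"

lemma depends_onD: "depends_on K H \<Longrightarrow> (\<And>c. c \<in> K \<Longrightarrow> \<omega> c = \<omega>' c) \<Longrightarrow> \<omega> \<in> H \<longleftrightarrow> \<omega>' \<in> H"
  unfolding depends_on_def by metis

lemma depends_on_mono: "depends_on K H \<Longrightarrow> K \<subseteq> K' \<Longrightarrow> depends_on K' H"
  unfolding depends_on_def by blast

lemma depends_on_Int: "depends_on K H \<Longrightarrow> depends_on K H' \<Longrightarrow> depends_on K (H \<inter> H')"
  unfolding depends_on_def by blast

lemma depends_on_Un: "depends_on K H \<Longrightarrow> depends_on K H' \<Longrightarrow> depends_on K (H \<union> H')"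
  unfolding depends_on_def by blast

lemma depends_on_INT: "(\<And>i. i \<in> I \<Longrightarrow> depends_on K (H i)) \<Longrightarrow> depends_on K (\<Inter>i\<in>I. H i)"
  unfolding depends_on_def by blast

lemma depends_on_Compl: "depends_on K H \<Longrightarrow> depends_on K (- H)"
  unfolding depends_on_def by (metis ComplD ComplI)

lemma indep_vars_PiM_coordinates:
  fixes M :: "'a measure"
  assumes "prob_space M"
  shows "prob_space.indep_vars (PiM UNIV (\<lambda>_. M)) (\<lambda>_. M) (\<lambda>i \<omega>. \<omega> i) (UNIV :: 'i set)"
proof -
  interpret P: prob_space "PiM (UNIV :: 'i set) (\<lambda>_. M)"
    by (intro prob_space_PiM assms)
  show ?thesis
    by (subst P.indep_vars_iff_distr_eq_PiM)
      (simp_all add: distr_PiM_component[OF assms] restrict_UNIV distr_id2 cong: PiM_cong)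
qed

text \<open>An event of the full product that depends only on \<open>K j\<close> is the preimage,
  under restriction to \<open>K j\<close>, of an event of the partial product; restrictions to
  disjoint index sets are independent.\<close>

lemma prob_INT_depends_on:
  fixes M :: "'a measure" and H :: "'j \<Rightarrow> ('i \<Rightarrow> 'a) set"
  defines "P \<equiv> PiM UNIV (\<lambda>_. M)"
  assumes M: "prob_space M" "space M = UNIV"
    and J: "finite J" and disj: "disjoint_family_on K J"
    and H: "\<And>j. j \<in> J \<Longrightarrow> H j \<in> sets P" "\<And>j. j \<in> J \<Longrightarrow> depends_on (K j) (H j)"
  shows "measure P (\<Inter>j\<in>J. H j) = (\<Prod>j\<in>J. measure P (H j))"
proof (cases "J = {}")
  case True
  interpret P: prob_space P
    unfolding P_def by (intro prob_space_PiM M)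
  have "space P = UNIV" by (simp add: P_def space_PiM M)
  then show ?thesis using True P.prob_space by simp
next
  case False
  interpret P: prob_space P
    unfolding P_def by (intro prob_space_PiM M)
  have sp: "space P = UNIV" by (simp add: P_def space_PiM M)
  \<comment> \<open>Partial families are extended by the arbitrary value \<open>undefined\<close>,
    which \<open>H j\<close> cannot see. Pulling \<open>H j\<close> back along this map gives a
    measurable set in the partial product.\<close>
  define ext :: "'j \<Rightarrow> ('i \<Rightarrow> 'a) \<Rightarrow> 'i \<Rightarrow> 'a" where "ext j x = (\<lambda>i. if i \<in> K j then x i else undefined)" for j x
  have ext: "ext j \<in> measurable (PiM (K j) (\<lambda>_. M)) P" for j
    unfolding P_def
  proof (rule measurable_PiM_single')
    show "(\<lambda>x. ext j x i) \<in> measurable (PiM (K j) (\<lambda>_. M)) M" if "i \<in> UNIV" for i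
      by (cases "i \<in> K j") (simp_all add: ext_def M)
  qed (auto simp: space_PiM M)
  have ind: "P.indep_vars (\<lambda>j. PiM (K j) (\<lambda>_. M)) (\<lambda>j \<omega>. restrict \<omega> (K j)) J"
    using P.indep_vars_restrict[OF indep_vars_PiM_coordinates[OF M(1), where 'i = 'i, folded P_def] _ disj]
    by (simp add: P_def)
  define A where "A j = ext j -` H j \<inter> space (PiM (K j) (\<lambda>_. M))" for j
  have A: "A j \<in> sets (PiM (K j) (\<lambda>_. M))" if "j \<in> J" for j
    unfolding A_def using measurable_sets[OF ext H(1)[OF that]] .
  have *: "(\<lambda>\<omega>. restrict \<omega> (K j)) -` A j \<inter> space P = H j" if "j \<in> J" for j
  proof -
    have "ext j (restrict \<omega> (K j)) \<in> H j \<longleftrightarrow> \<omega> \<in> H j" for \<omega>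
      using H(2)[OF that] by (rule depends_onD) (simp add: ext_def)
    then show ?thesis by (auto simp: A_def sp space_PiM M)
  qed
  have "measure P (\<Inter>j\<in>J. (\<lambda>\<omega>. restrict \<omega> (K j)) -` A j \<inter> space P)
      = (\<Prod>j\<in>J. measure P ((\<lambda>\<omega>. restrict \<omega> (K j)) -` A j \<inter> space P))"
    by (rule P.indep_varsD[OF ind False J subset_refl A])
  then show ?thesis by (simp add: * cong: INF_cong prod.cong)
qed

lemma prob_Int_depends_on:
  fixes M :: "'a measure" and H :: "('i \<Rightarrow> 'a) set"
  defines "P \<equiv> PiM UNIV (\<lambda>_. M)"
  assumes M: "prob_space M" "space M = UNIV"
    and disj: "K \<inter> K' = {}"
    and H: "H \<in> sets P" "depends_on K H" "H' \<in> sets P" "depends_on K' H'"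
  shows "measure P (H \<inter> H') = measure P H * measure P H'"
proof -
  have "measure P (\<Inter>b\<in>{True, False}. if b then H else H') = (\<Prod>b\<in>{True, False}. measure P (if b then H else H'))"
    unfolding P_def
    by (rule prob_INT_depends_on[where K = "\<lambda>b. if b then K else K'"])
      (use assms in \<open>auto simp: disjoint_family_on_def\<close>)
  then show ?thesis by (simp add: Int_commute)
qed

section \<open>The percolation measure\<close>

lemma prob_space_percolation_measure: "prob_space (percolation_measure p)"
  unfolding percolation_measure_def by (intro prob_space_PiM measure_pmf.prob_space_axioms)

lemma space_percolation_measure [simp]: "space (percolation_measure p) = UNIV"
  by (simp add: percolation_measure_def space_PiM)

lemma percolation_prob_INT:
  assumes "finite J" "disjoint_family_on K J"
    and "\<And>j. j \<in> J \<Longrightarrow> H j \<in> sets (percolation_measure p)" "\<And>j. j \<in> J \<Longrightarrow> depends_on (K j) (H j)"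
  shows "measure (percolation_measure p) (\<Inter>j\<in>J. H j) = (\<Prod>j\<in>J. measure (percolation_measure p) (H j))"
  using assms unfolding percolation_measure_def
  by (intro prob_INT_depends_on) (auto intro: measure_pmf.prob_space_axioms)

lemma percolation_prob_Int:
  assumes "K \<inter> K' = {}"
    and "H \<in> sets (percolation_measure p)" "depends_on K H"
      "H' \<in> sets (percolation_measure p)" "depends_on K' H'"
  shows "measure (percolation_measure p) (H \<inter> H')
    = measure (percolation_measure p) H * measure (percolation_measure p) H'"
  using assms unfolding percolation_measure_def
  by (intro prob_Int_depends_on) (auto intro: measure_pmf.prob_space_axioms)

lemma sets_coin: "{\<omega>. \<omega> c} \<in> sets (percolation_measure p)"
proof -
  have "(\<lambda>\<omega>. \<omega> c) -` {True} \<inter> space (percolation_measure p) \<in> sets (percolation_measure p)"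
    unfolding percolation_measure_def
    by (rule measurable_sets[OF measurable_component_singleton]) auto
  then show ?thesis by (simp add: vimage_def)
qed

lemma prob_coin:
  assumes "0 \<le> p" "p \<le> 1"
  shows "measure (percolation_measure p) {\<omega>. \<omega> c} = p"
proof -
  have "measure (percolation_measure p) {\<omega>. \<omega> c}
      = measure (distr (percolation_measure p) (measure_pmf (bernoulli_pmf p)) (\<lambda>\<omega>. \<omega> c)) {True}"
    by (subst measure_distr) (auto simp: percolation_measure_def vimage_def space_PiM)
  also have "\<dots> = p"
    unfolding percolation_measure_def
    by (subst distr_PiM_component) (use assms in \<open>auto simp: measure_pmf_single intro: measure_pmf.prob_space_axioms\<close>)
  finally show ?thesis .
qed

lemma depends_on_coin: "depends_on {c} {\<omega>. \<omega> c}"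
  by (auto simp: depends_on_def)

text \<open>The part of a construction below the square \<open>q\<close> of level \<open>k\<close>, rescaled to the unit square.\<close>

definition shift :: "nat \<Rightarrow> int \<times> int \<Rightarrow> construction \<Rightarrow> construction" where
  "shift k q \<omega> = (\<lambda>(n, i, j). \<omega> (k + n, 2 ^ n * fst q + i, 2 ^ n * snd q + j))"

text \<open>\<open>shift\<close> only renames coins along an injection of the index set, and all
  coins have the same distribution.\<close>

lemma shift_measurable: "shift k q \<in> measurable (percolation_measure p) (percolation_measure p)"
  and distr_shift: "distr (percolation_measure p) (percolation_measure p) (shift k q) = percolation_measure p"
proof -
  define f where "f = (\<lambda>(n :: nat, i :: int, j :: int). (k + n, 2 ^ n * fst q + i, 2 ^ n * snd q + j))"
  have inj: "inj f"
    by (auto simp: inj_def f_def)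
  have sh: "shift k q \<omega> = (\<lambda>c\<in>UNIV. \<omega> (f c))" for \<omega>
    by (auto simp: shift_def f_def fun_eq_iff)
  show "shift k q \<in> measurable (percolation_measure p) (percolation_measure p)"
    unfolding percolation_measure_def
    by (rule measurable_PiM_single') (auto simp: sh intro!: measurable_component_singleton)
  show "distr (percolation_measure p) (percolation_measure p) (shift k q) = percolation_measure p"
    using distr_PiM_reindex[of UNIV "\<lambda>_. measure_pmf (bernoulli_pmf p)" f UNIV] inj
    by (simp add: percolation_measure_def measure_pmf.prob_space_axioms flip: sh)
qed

lemma sets_shift:
  assumes "H \<in> sets (percolation_measure p)"
  shows "{\<omega>. shift k q \<omega> \<in> H} \<in> sets (percolation_measure p)"
  using measurable_sets[OF shift_measurable assms, of k q] by (simp add: vimage_def)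

lemma prob_shift:
  assumes "H \<in> sets (percolation_measure p)"
  shows "measure (percolation_measure p) {\<omega>. shift k q \<omega> \<in> H} = measure (percolation_measure p) H"
proof -
  have "measure (percolation_measure p) H
      = measure (distr (percolation_measure p) (percolation_measure p) (shift k q)) H"
    by (simp add: distr_shift)
  also have "\<dots> = measure (percolation_measure p) {\<omega>. shift k q \<omega> \<in> H}"
    by (subst measure_distr[OF shift_measurable assms]) (simp add: vimage_def)
  finally show ?thesis by simp
qed

section \<open>Self-similarity of the chosen squares, and the coins they depend on\<close>

definition grid :: "nat \<Rightarrow> (int \<times> int) set" where
  "grid k = {0..<2 ^ k} \<times> {0..<2 ^ k}"

lemma finite_grid [simp]: "finite (grid k)"
  by (simp add: grid_def)

lemma card_grid: "card (grid k) = 4 ^ k"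
  by (simp add: grid_def nat_power_eq card_cartesian_product flip: power_mult_distrib)

lemma div2_in_range: "i div 2 \<in> {0..<2 ^ k} \<longleftrightarrow> i \<in> {0..<2 ^ Suc k}" for i :: int
  by auto

lemma grid_Suc_iff: "(i, j) \<in> grid (Suc k) \<longleftrightarrow> (i div 2, j div 2) \<in> grid k"
  unfolding grid_def mem_Sigma_iff div2_in_range ..

lemma chosen_subset_grid: "chosen \<omega> k \<subseteq> grid k"
proof (induction k)
  case (Suc k)
  then show ?case using grid_Suc_iff by auto
qed (simp add: grid_def)

text \<open>Self-similarity: the coins on the path from \<open>q\<close> down to a descendant are
  exactly those that \<open>shift k q \<omega>\<close> reads. The coin of \<open>q\<close> itself
  gets relative level 0 and is never read by the shifted construction, so
  \<open>q \<in> chosen \<omega> k\<close> has to be stated separately.\<close>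

lemma chosen_add_iff:
  assumes "(i, j) \<in> grid n"
  shows "(2 ^ n * fst q + i, 2 ^ n * snd q + j) \<in> chosen \<omega> (k + n)
    \<longleftrightarrow> q \<in> chosen \<omega> k \<and> (i, j) \<in> chosen (shift k q \<omega>) n"
  using assms
proof (induction n arbitrary: i j)
  case 0
  then have "i = 0" "j = 0" by (auto simp: grid_def)
  then show ?case by simp
next
  case (Suc n)
  have d: "(2 ^ Suc n * a + i) div 2 = 2 ^ n * a + i div 2" for a i :: int
    by simp
  have "(i div 2, j div 2) \<in> grid n" using Suc.prems grid_Suc_iff by blast
  note IH = Suc.IH[OF this]
  have "(2 ^ Suc n * fst q + i, 2 ^ Suc n * snd q + j) \<in> chosen \<omega> (k + Suc n)
    \<longleftrightarrow> (2 ^ n * fst q + i div 2, 2 ^ n * snd q + j div 2) \<in> chosen \<omega> (k + n)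
      \<and> \<omega> (k + Suc n, 2 ^ Suc n * fst q + i, 2 ^ Suc n * snd q + j)"
    unfolding add_Suc_right chosen.simps mem_Collect_eq case_prod_conv d ..
  also have "\<dots> \<longleftrightarrow> q \<in> chosen \<omega> k \<and> (i, j) \<in> chosen (shift k q \<omega>) (Suc n)"
    unfolding IH by (auto simp: shift_def)
  finally show ?case .
qed

text \<open>The strict inequality leaves out the coin of \<open>q\<close> itself, so what happens
  below \<open>q\<close> is independent of whether \<open>q\<close> is chosen. For
  \<open>k = 0\<close> and \<open>q = (0, 0)\<close> these are all coins that can influence
  \<open>chosen\<close>.\<close>

definition coins_below :: "nat \<Rightarrow> int \<times> int \<Rightarrow> (nat \<times> int \<times> int) set" where
  "coins_below k q = {(n, i, j). k < n \<and> i div 2 ^ (n - k) = fst q \<and> j div 2 ^ (n - k) = snd q}"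

definition coins_upto :: "nat \<Rightarrow> (nat \<times> int \<times> int) set" where
  "coins_upto k = {(n, i, j). n \<le> k}"

lemma coins_below_disjoint: "q \<noteq> q' \<Longrightarrow> coins_below k q \<inter> coins_below k q' = {}"
  by (auto simp: coins_below_def prod_eq_iff)

lemma coins_below_upto_disjoint: "coins_below k q \<inter> coins_upto k = {}"
  by (auto simp: coins_below_def coins_upto_def)

lemma chosen_cong:
  assumes "\<And>c. c \<in> coins_upto n \<inter> coins_below 0 (0, 0) \<Longrightarrow> \<omega> c = \<omega>' c"
  shows "chosen \<omega> n = chosen \<omega>' n"
  using assms
proof (induction n)
  case (Suc n)
  have IH: "chosen \<omega> n = chosen \<omega>' n"
    by (rule Suc.IH) (rule Suc.prems, auto simp: coins_upto_def)
  have "(i, j) \<in> chosen \<omega> (Suc n) \<longleftrightarrow> (i, j) \<in> chosen \<omega>' (Suc n)" for i j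
  proof (cases "(i, j) \<in> grid (Suc n)")
    case True
    then have "(Suc n, i, j) \<in> coins_upto (Suc n) \<inter> coins_below 0 (0, 0)"
      by (auto simp: coins_upto_def coins_below_def grid_def)
    then have "\<omega> (Suc n, i, j) = \<omega>' (Suc n, i, j)" by (rule Suc.prems)
    then show ?thesis using IH by simp
  qed (use chosen_subset_grid in blast)
  then show ?case by auto
qed simp

lemma depends_on_chosen_upto: "depends_on (coins_upto n) {\<omega>. P (chosen \<omega> n)}"
proof -
  have "chosen \<omega> n = chosen \<omega>' n" if "\<forall>c\<in>coins_upto n. \<omega> c = \<omega>' c" for \<omega> \<omega>'
    by (rule chosen_cong) (use that in auto)
  then show ?thesis unfolding depends_on_def by (metis mem_Collect_eq)
qed

lemma depends_on_chosen: "depends_on (coins_below 0 (0, 0)) {\<omega>. P (chosen \<omega>)}"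
proof -
  have "chosen \<omega> = chosen \<omega>'" if "\<forall>c\<in>coins_below 0 (0, 0). \<omega> c = \<omega>' c" for \<omega> \<omega>'
    by (rule ext, rule chosen_cong) (use that in auto)
  then show ?thesis unfolding depends_on_def by (metis mem_Collect_eq)
qed

lemma depends_on_shift:
  assumes "depends_on (coins_below 0 (0, 0)) H"
  shows "depends_on (coins_below k q) {\<omega>. shift k q \<omega> \<in> H}"
proof -
  have *: "shift k q \<omega> c = shift k q \<omega>' c"
    if eq: "\<forall>c\<in>coins_below k q. \<omega> c = \<omega>' c" and c: "c \<in> coins_below 0 (0, 0)" for \<omega> \<omega>' c
  proof -
    obtain m i j where m: "c = (m, i, j)" by (cases c) auto
    have "(k + m, 2 ^ m * fst q + i, 2 ^ m * snd q + j) \<in> coins_below k q"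
      using c by (auto simp: coins_below_def m)
    then show ?thesis using eq by (auto simp: shift_def m)
  qed
  have "shift k q \<omega> \<in> H \<longleftrightarrow> shift k q \<omega>' \<in> H" if "\<forall>c\<in>coins_below k q. \<omega> c = \<omega>' c" for \<omega> \<omega>'
    by (rule depends_onD[OF assms]) (rule *[OF that])
  then show ?thesis unfolding depends_on_def by blast
qed

lemma coins_below_subset: "q \<in> grid k \<Longrightarrow> coins_below k q \<subseteq> coins_below 0 (0, 0)"
proof
  fix c assume q: "q \<in> grid k" and c: "c \<in> coins_below k q"
  obtain n i j where nij: "c = (n, i, j)" by (cases c) auto
  have n: "k < n" and ij: "q = (i div 2 ^ (n - k), j div 2 ^ (n - k))"
    using c by (auto simp: coins_below_def nij prod_eq_iff)
  have eq: "2 ^ n = 2 ^ (n - k) * (2 ^ k :: int)" using n by (simp flip: power_add)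
  have *: "a div 2 ^ n = 0" if "a div 2 ^ (n - k) \<in> {0..<2 ^ k}" for a :: int
  proof -
    have "a div 2 ^ n = a div 2 ^ (n - k) div 2 ^ k"
      unfolding eq by (rule zdiv_zmult2_eq) simp
    also have "\<dots> = 0" using that by (intro div_pos_pos_trivial) auto
    finally show ?thesis .
  qed
  show "c \<in> coins_below 0 (0, 0)" using q n * by (auto simp: grid_def coins_below_def nij ij)
qed

lemma sets_chosen_eq: "{\<omega>. chosen \<omega> n = A} \<in> sets (percolation_measure p)"
proof -
  have eq: "{\<omega>. chosen \<omega> n = A} = (\<Inter>q. if q \<in> A then {\<omega>. q \<in> chosen \<omega> n} else - {\<omega>. q \<in> chosen \<omega> n})"
    by (auto split: if_splits)
  have "(if q \<in> A then {\<omega>. q \<in> chosen \<omega> n} else - {\<omega>. q \<in> chosen \<omega> n}) \<in> sets (percolation_measure p)" for q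
    using sets_percolation_chosen[of q n p] sets.compl_sets[OF sets_percolation_chosen[of q n p]]
    by (simp add: Compl_eq_Diff_UNIV)
  then show ?thesis unfolding eq using sets.top[of "percolation_measure p"]
    by (intro sets.countable_INT'') (auto simp only: space_percolation_measure)
qed

lemma sets_chosen: "{\<omega>. P (chosen \<omega> n)} \<in> sets (percolation_measure p)"
proof -
  have "{\<omega>. P (chosen \<omega> n)} = (\<Union>A\<in>{A\<in>Pow (grid n). P A}. {\<omega>. chosen \<omega> n = A})"
    using chosen_subset_grid by auto
  then show ?thesis using sets_chosen_eq by (auto intro!: sets.finite_UN)
qed

text \<open>A substitute for conditional probability: \<open>chosen \<omega> k\<close> takes
  finitely many values \<open>A\<close>, and for each of them the past event \<open>F\<close> with
  \<open>chosen \<omega> k = A\<close> is independent of the future event \<open>H A\<close>. The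
  predicate \<open>P\<close> selects the configurations for which a bound on \<open>H A\<close> is
  available.\<close>

lemma prob_conditional_le:
  assumes F: "F \<in> sets (percolation_measure p)" "depends_on (coins_upto k) F"
    and H: "\<And>A. A \<subseteq> grid k \<Longrightarrow> P A \<Longrightarrow> H A \<in> sets (percolation_measure p)"
      "\<And>A. A \<subseteq> grid k \<Longrightarrow> P A \<Longrightarrow> depends_on (- coins_upto k) (H A)"
      "\<And>A. A \<subseteq> grid k \<Longrightarrow> P A \<Longrightarrow> measure (percolation_measure p) (H A) \<le> \<epsilon>"
    and "0 \<le> \<epsilon>"
  shows "{\<omega>\<in>F. P (chosen \<omega> k) \<and> \<omega> \<in> H (chosen \<omega> k)} \<in> sets (percolation_measure p)" (is "?S \<in> _")
    and "measure (percolation_measure p) {\<omega>\<in>F. P (chosen \<omega> k) \<and> \<omega> \<in> H (chosen \<omega> k)}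
      \<le> \<epsilon> * measure (percolation_measure p) F"
proof -
  let ?\<mu> = "percolation_measure p"
  interpret prob_space ?\<mu> by (rule prob_space_percolation_measure)
  define \<A> where "\<A> = {A\<in>Pow (grid k). P A}"
  have fin: "finite \<A>" by (simp add: \<A>_def)
  define D where "D A = F \<inter> {\<omega>. chosen \<omega> k = A}" for A
  have D: "D A \<in> sets ?\<mu>" "depends_on (coins_upto k) (D A)" for A
    using F sets_chosen_eq depends_on_chosen_upto by (auto simp: D_def intro!: depends_on_Int)
  have eq: "?S = (\<Union>A\<in>\<A>. D A \<inter> H A)"
    using chosen_subset_grid by (auto simp: \<A>_def D_def)
  have DH: "D A \<inter> H A \<in> sets ?\<mu>" if "A \<in> \<A>" for A
    using that D H by (auto simp: \<A>_def)
  show "?S \<in> sets ?\<mu>" unfolding eq using DH fin by auto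
  have disj: "disjoint_family_on D \<A>" by (auto simp: disjoint_family_on_def D_def)
  have "measure ?\<mu> ?S \<le> (\<Sum>A\<in>\<A>. measure ?\<mu> (D A \<inter> H A))"
    unfolding eq by (rule finite_measure_subadditive_finite[OF fin]) (use DH in auto)
  also have "\<dots> \<le> (\<Sum>A\<in>\<A>. \<epsilon> * measure ?\<mu> (D A))"
  proof (rule sum_mono)
    fix A assume A: "A \<in> \<A>"
    have "measure ?\<mu> (D A \<inter> H A) = measure ?\<mu> (D A) * measure ?\<mu> (H A)"
      by (rule percolation_prob_Int[where K = "coins_upto k" and K' = "- coins_upto k"])
        (use A D H in \<open>auto simp: \<A>_def\<close>)
    also have "\<dots> \<le> measure ?\<mu> (D A) * \<epsilon>"
      using A H by (intro mult_left_mono) (auto simp: \<A>_def)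
    finally show "measure ?\<mu> (D A \<inter> H A) \<le> \<epsilon> * measure ?\<mu> (D A)" by (simp add: mult.commute)
  qed
  also have "\<dots> = \<epsilon> * measure ?\<mu> (\<Union>A\<in>\<A>. D A)"
    using D by (subst finite_measure_finite_Union[OF fin _ disj]) (auto simp: sum_distrib_left)
  also have "\<dots> \<le> \<epsilon> * measure ?\<mu> F"
    using \<open>0 \<le> \<epsilon>\<close> by (intro mult_left_mono finite_measure_mono F) (auto simp: D_def)
  finally show "measure ?\<mu> ?S \<le> \<epsilon> * measure ?\<mu> F" .
qed

section \<open>Hitting all lines of a family\<close>

definition children :: "(int \<times> int) set \<Rightarrow> (int \<times> int) set" where
  "children A = {(i, j). (i div 2, j div 2) \<in> A}"

lemma children_single:
  "children {(i, j)} = {(2 * i, 2 * j), (2 * i + 1, 2 * j), (2 * i, 2 * j + 1), (2 * i + 1, 2 * j + 1)}"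
proof -
  have "a div 2 = b \<longleftrightarrow> a = 2 * b \<or> a = 2 * b + 1" for a b :: int by presburger
  then show ?thesis unfolding children_def by blast
qed

lemma finite_children: "finite A \<Longrightarrow> finite (children A)"
proof -
  assume "finite A"
  moreover have "children A = (\<Union>q\<in>A. children {q})" by (auto simp: children_def)
  moreover have "finite (children {q})" for q by (cases q) (simp add: children_single)
  ultimately show ?thesis by simp
qed

lemma sum_children:
  assumes "finite A"
  shows "sum f (children A) = (\<Sum>q\<in>A. sum f (children {q}))"
proof -
  have "children A = (\<Union>q\<in>A. children {q})" by (auto simp: children_def)
  then show ?thesis
    using assms finite_children[of "{q}" for q]
    by (simp only:) (subst sum.UNION_disjoint, auto simp: children_def)
qed

lemma children_grid: "children (grid n) = grid (Suc n)"
  unfolding children_def using grid_Suc_iff by auto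

lemma chosen_Suc: "chosen \<omega> (Suc n) = children (chosen \<omega> n) \<inter> {q. \<omega> (Suc n, q)}"
  by (auto simp: children_def)

lemma chosen_grid_downwards:
  assumes "chosen \<omega> n = grid n" "m \<le> n"
  shows "chosen \<omega> m = grid m"
  using assms
proof (induction n)
  case (Suc n)
  have "chosen \<omega> n = grid n"
  proof
    show "grid n \<subseteq> chosen \<omega> n"
    proof
      fix q assume "q \<in> grid n"
      then have "(2 * fst q, 2 * snd q) \<in> grid (Suc n)"
        using grid_Suc_iff[of "2 * fst q" "2 * snd q" n] by simp
      then have "(2 * fst q, 2 * snd q) \<in> chosen \<omega> (Suc n)" using Suc.prems by simp
      then show "q \<in> chosen \<omega> n" by simp
    qed
  qed (rule chosen_subset_grid)
  then show ?case using Suc.IH Suc.prems le_Suc_eq by metis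
qed simp

section \<open>Measurability and concentration for the coins of one level\<close>

lemma sets_coin_family:
  assumes "finite I"
  shows "{\<omega>. P (I \<inter> {q. \<omega> (n, q)})} \<in> sets (percolation_measure p)"
proof -
  let ?\<mu> = "percolation_measure p"
  have eq: "{\<omega>. I \<inter> {q. \<omega> (n, q)} = B}
    = (\<Inter>q\<in>I. if q \<in> B then {\<omega>. \<omega> (n, q)} else - {\<omega>. \<omega> (n, q)})" if "B \<subseteq> I" for B
    using that by (auto split: if_splits)
  have "(if q \<in> B then {\<omega>. \<omega> (n, q)} else - {\<omega>. \<omega> (n, q)}) \<in> sets ?\<mu>" for q B
    using sets_coin[of "(n, q)" p] sets.compl_sets[OF sets_coin[of "(n, q)" p]]
    by (simp add: Compl_eq_Diff_UNIV)
  then have "{\<omega>. I \<inter> {q. \<omega> (n, q)} = B} \<in> sets ?\<mu>" if "B \<subseteq> I" for B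
    unfolding eq[OF that] using sets.top[of ?\<mu>] assms
    by (cases "I = {}") (auto simp only: space_percolation_measure INF_empty intro!: sets.finite_INT)
  moreover have "{\<omega>. P (I \<inter> {q. \<omega> (n, q)})}
    = (\<Union>B\<in>{B\<in>Pow I. P B}. {\<omega>. I \<inter> {q. \<omega> (n, q)} = B})" by auto
  ultimately show ?thesis using assms by (auto intro!: sets.finite_UN)
qed

lemma depends_on_coin_family: "depends_on (- coins_upto n) {\<omega>. P (I \<inter> {q. \<omega> (Suc n, q)})}"
proof -
  have "(Suc n, q) \<in> - coins_upto n" for q by (auto simp: coins_upto_def)
  then have "I \<inter> {q. \<omega> (Suc n, q)} = I \<inter> {q. \<omega>' (Suc n, q)}"
    if "\<forall>c\<in>- coins_upto n. \<omega> c = \<omega>' c" for \<omega> \<omega>'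
    using that by auto
  then show ?thesis unfolding depends_on_def by (metis (mono_tags, lifting) mem_Collect_eq)
qed

text \<open>Hoeffding's inequality for the variables with values 0 and \<open>g q\<close>. As
  \<open>g q \<le> b\<close>, the sum of squared ranges is at most \<open>b * sum g I\<close>. With
  \<open>b\<close> the side length of the squares and \<open>sum g I\<close> the total chord length,
  this denominator is small, which is what makes the bound strong.\<close>

lemma coin_sum_lower_tail:
  fixes g :: "int \<times> int \<Rightarrow> real"
  assumes p: "0 \<le> p" "p \<le> 1" and I: "finite I"
    and g: "\<And>q. q \<in> I \<Longrightarrow> 0 \<le> g q" "\<And>q. q \<in> I \<Longrightarrow> g q \<le> b"
    and S: "0 < sum g I" and \<epsilon>: "0 \<le> \<epsilon>"
  shows "measure (percolation_measure p) {\<omega>. sum g (I \<inter> {q. \<omega> (n, q)}) \<le> p * sum g I - \<epsilon>}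
    \<le> exp (- (2 * \<epsilon>\<^sup>2) / (b * sum g I))"
proof -
  let ?\<mu> = "percolation_measure p"
  interpret prob_space ?\<mu> by (rule prob_space_percolation_measure)
  define J where "J = Pair n ` I"
  define X :: "nat \<times> int \<times> int \<Rightarrow> construction \<Rightarrow> real" where "X c \<omega> = (if \<omega> c then g (snd c) else 0)" for c \<omega>
  have "indep_vars (\<lambda>_. measure_pmf (bernoulli_pmf p)) (\<lambda>c \<omega>. \<omega> c) UNIV"
    unfolding percolation_measure_def by (rule indep_vars_PiM_coordinates) (rule measure_pmf.prob_space_axioms)
  then have "indep_vars (\<lambda>_. borel) (\<lambda>c \<omega>. (\<lambda>b. if b then g (snd c) else 0) (\<omega> c)) UNIV"
    by (rule indep_vars_compose2) simp
  then have ind: "indep_vars (\<lambda>_. borel) X J"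
    unfolding X_def by (rule indep_vars_subset) simp
  interpret H: Hoeffding_ineq ?\<mu> J X "\<lambda>_. 0" "\<lambda>c. g (snd c)" "\<Sum>c\<in>J. expectation (X c)"
    by unfold_locales (use ind I g in \<open>auto simp: J_def X_def intro!: AE_I2\<close>)
  have EX: "expectation (X c) = p * g (snd c)" for c
  proof -
    have "X c = (\<lambda>\<omega>. g (snd c) * indicator {\<omega>. \<omega> c} \<omega>)" by (auto simp: X_def fun_eq_iff)
    then show ?thesis using prob_coin[OF p, of c] by simp
  qed
  have inj: "inj_on (Pair n) I" by (auto simp: inj_on_def)
  have \<mu>: "(\<Sum>c\<in>J. expectation (X c)) = p * sum g I"
    by (simp add: EX J_def sum.reindex[OF inj] sum_distrib_left)
  have sq: "(\<Sum>c\<in>J. (g (snd c) - 0)\<^sup>2) = (\<Sum>q\<in>I. (g q)\<^sup>2)"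
    by (simp add: J_def sum.reindex[OF inj])
  obtain q where q: "q \<in> I" "g q \<noteq> 0" using S by (metis less_irrefl sum.neutral)
  have pos: "0 < (\<Sum>q\<in>I. (g q)\<^sup>2)"
    by (rule sum_pos2[OF I q(1)]) (use q in auto)
  have le: "(\<Sum>q\<in>I. (g q)\<^sup>2) \<le> b * sum g I"
    unfolding sum_distrib_left power2_eq_square using g by (intro sum_mono mult_right_mono) auto
  have "(\<Sum>c\<in>J. X c \<omega>) = sum g (I \<inter> {q. \<omega> (n, q)})" for \<omega>
    using I by (simp add: J_def sum.reindex[OF inj] X_def sum.If_cases)
  then have "measure ?\<mu> {\<omega>. sum g (I \<inter> {q. \<omega> (n, q)}) \<le> p * sum g I - \<epsilon>}
    \<le> exp (-2 * \<epsilon>\<^sup>2 / (\<Sum>q\<in>I. (g q)\<^sup>2))"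
    using H.Hoeffding_ineq_le[OF \<epsilon>] pos unfolding sq \<mu> by simp
  also have "\<dots> \<le> exp (- (2 * \<epsilon>\<^sup>2) / (b * sum g I))"
    using frac_le[OF _ order_refl pos le, of "2 * \<epsilon>\<^sup>2"] by simp
  finally show ?thesis .
qed

text \<open>Take \<open>m\<close> with \<open>2 * B < \<rho> ^ m\<close>. The estimate
  \<open>exp (- x) \<le> fact m / x ^ m\<close> at \<open>x = \<kappa> * \<rho> ^ n\<close> then
  leaves a geometric series of ratio at most 1 / 2.\<close>

lemma summable_power_exp_exp:
  fixes B \<kappa> \<rho> :: real
  assumes "0 \<le> B" "0 < \<kappa>" "1 < \<rho>"
  shows "summable (\<lambda>n. B ^ n * exp (- (\<kappa> * \<rho> ^ n)))"
proof -
  obtain m where m: "2 * B < \<rho> ^ m" using real_arch_pow[OF assms(3)] by blast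
  have "norm (B ^ n * exp (- (\<kappa> * \<rho> ^ n))) \<le> fact m / \<kappa> ^ m * (1 / 2) ^ n" for n
  proof -
    define x where "x = \<kappa> * \<rho> ^ n"
    have x: "x > 0" using assms by (simp add: x_def)
    have "x ^ m / fact m \<le> exp x"
    proof -
      have "(\<Sum>i\<in>{m}. x ^ i /\<^sub>R fact i) \<le> exp x"
        unfolding exp_def using summable_exp_generic[of x] x by (intro sum_le_suminf) auto
      then show ?thesis by (simp add: divide_inverse mult.commute)
    qed
    then have "exp (- x) \<le> fact m / x ^ m"
      using le_imp_inverse_le[of "x ^ m / fact m" "exp x"] x by (simp add: exp_minus)
    then have "B ^ n * exp (- x) \<le> B ^ n * (fact m / x ^ m)"
      using assms by (intro mult_left_mono) auto
    also have "\<dots> = fact m / \<kappa> ^ m * (B / \<rho> ^ m) ^ n"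
    proof -
      have "(\<rho> ^ n) ^ m = (\<rho> ^ m) ^ n" by (simp only: power_mult[symmetric] mult.commute)
      then show ?thesis by (simp add: x_def power_mult_distrib power_divide)
    qed
    also have "\<dots> \<le> fact m / \<kappa> ^ m * (1 / 2) ^ n"
      using assms m by (intro mult_left_mono power_mono) (auto simp: field_simps)
    finally show ?thesis using assms by (simp add: x_def)
  qed
  moreover have "summable (\<lambda>n. fact m / \<kappa> ^ m * (1 / 2 :: real) ^ n)"
    by (intro summable_mult summable_geometric) simp
  ultimately show ?thesis by (rule summable_comparison_test'[rotated])
qed

text \<open>
  \<open>g l n q\<close> plays the role of the length of the chord that the line \<open>l\<close> cuts out of the square
  \<open>q\<close> of level \<open>n\<close>, and \<open>T n\<close> is a net in the space of lines, fine enough for the level \<open>n\<close>.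
\<close>

locale chord_family =
  fixes p :: real and \<Lambda> :: "'l set" and g :: "'l \<Rightarrow> nat \<Rightarrow> int \<times> int \<Rightarrow> real"
    and T :: "nat \<Rightarrow> 'l set" and g0 C B :: real
  assumes p: "1 / 2 < p" "p < 1"
    and g_nonneg: "0 \<le> g l n q"
    and g_le: "g l n q \<le> 1 / 2 ^ n"
    and g_children: "g l n q \<le> sum (g l (Suc n)) (children {q})"
    and g0: "0 < g0" "l \<in> \<Lambda> \<Longrightarrow> g0 \<le> g l 0 (0, 0)"
    and net: "finite (T n)" "real (card (T n)) \<le> C * B ^ n" "0 \<le> B"
    and approx: "l \<in> \<Lambda> \<Longrightarrow> \<exists>l'\<in>T n. \<forall>m\<le>n. \<forall>q\<in>grid m. \<bar>g l m q - g l' m q\<bar> \<le> 1 / 16 ^ n"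
begin

lemma sum_le_sum_children:
  assumes "finite A"
  shows "sum (g l n) A \<le> sum (g l (Suc n)) (children A)"
  unfolding sum_children[OF assms] by (intro sum_mono g_children)

lemma sum_grid_ge: "g l 0 (0, 0) \<le> sum (g l n) (grid n)"
proof (induction n)
  case 0
  have "grid 0 = {(0, 0)}" by (auto simp: grid_def)
  then show ?case by simp
next
  case (Suc n)
  then show ?case
    using sum_le_sum_children[of "grid n" l n] by (simp add: children_grid)
qed

text \<open>Only lines of mass at least \<open>s\<close> are controlled, since concentration says
  little about short total chords. The net is that of level \<open>Suc n\<close> because it has to
  approximate on both levels that are compared.\<close>

definition bad :: "real \<Rightarrow> real \<Rightarrow> nat \<Rightarrow> (int \<times> int) set \<Rightarrow> construction set" where
  "bad r s n A = {\<omega>. \<exists>l\<in>T (Suc n). s \<le> sum (g l n) A \<and>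
     sum (g l (Suc n)) (children A \<inter> {q. \<omega> (Suc n, q)}) < r * sum (g l n) A}"

lemma prob_bad_le:
  assumes A: "finite A" and s: "0 < s" and r: "0 \<le> r" "r \<le> p"
  shows "measure (percolation_measure p) (bad r s n A)
    \<le> C * B ^ Suc n * exp (- (2 * (p - r)\<^sup>2 * s * 2 ^ Suc n))"
proof -
  let ?\<mu> = "percolation_measure p"
  interpret prob_space ?\<mu> by (rule prob_space_percolation_measure)
  define W where "W l = {\<omega>. s \<le> sum (g l n) A \<and>
     sum (g l (Suc n)) (children A \<inter> {q. \<omega> (Suc n, q)}) < r * sum (g l n) A}" for l
  have W: "W l \<in> sets ?\<mu>" for l
    unfolding W_def by (rule sets_coin_family[OF finite_children[OF A]])
  have "measure ?\<mu> (W l) \<le> exp (- (2 * (p - r)\<^sup>2 * s * 2 ^ Suc n))" for l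
  proof (cases "s \<le> sum (g l n) A")
    case True
    define S where "S = sum (g l (Suc n)) (children A)"
    define f where "f = sum (g l n) A"
    have f: "s \<le> f" "f \<le> S" using True sum_le_sum_children[OF A] by (auto simp: f_def S_def)
    \<comment> \<open>Since \<open>f \<le> S\<close>, falling below \<open>r * f\<close> is a
      deviation of at least \<open>(p - r) * S\<close> from the mean \<open>p * S\<close>, so the
      deficit can be measured against the mass \<open>S\<close> of all children.\<close>
    define \<epsilon> where "\<epsilon> = p * S - r * f"
    have "r * f \<le> r * S" using f r by (intro mult_left_mono) auto
    then have \<epsilon>: "(p - r) * S \<le> \<epsilon>" by (simp add: \<epsilon>_def left_diff_distrib)
    have S0: "0 < S" using f s by simp
    have \<epsilon>0: "0 \<le> (p - r) * S" using r S0 by simp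
    have "measure ?\<mu> (W l) \<le> measure ?\<mu> {\<omega>. sum (g l (Suc n)) (children A \<inter> {q. \<omega> (Suc n, q)}) \<le> p * S - \<epsilon>}"
      by (intro finite_measure_mono sets_coin_family finite_children A) (auto simp: W_def \<epsilon>_def f_def)
    also have "\<dots> \<le> exp (- (2 * \<epsilon>\<^sup>2) / ((1 / 2 ^ Suc n) * S))"
      unfolding S_def
      by (rule coin_sum_lower_tail) (use p A S0 \<epsilon> \<epsilon>0 g_nonneg g_le[of _ "Suc n"] in \<open>auto simp: S_def finite_children\<close>)
    also have "\<dots> \<le> exp (- (2 * (p - r)\<^sup>2 * s * 2 ^ Suc n))"
    proof -
      have "((p - r) * S)\<^sup>2 \<le> \<epsilon>\<^sup>2" using \<epsilon> \<epsilon>0 by (intro power_mono) auto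
      then have "2 * ((p - r) * S)\<^sup>2 / ((1 / 2 ^ Suc n) * S) \<le> 2 * \<epsilon>\<^sup>2 / ((1 / 2 ^ Suc n) * S)"
        using S0 by (intro divide_right_mono) auto
      moreover have "2 * ((p - r) * S)\<^sup>2 / ((1 / 2 ^ Suc n) * S) = 2 * (p - r)\<^sup>2 * S * 2 ^ Suc n"
        using S0 by (simp add: field_simps power2_eq_square)
      moreover have "2 * (p - r)\<^sup>2 * s * 2 ^ Suc n \<le> 2 * (p - r)\<^sup>2 * S * 2 ^ Suc n"
        using f by (intro mult_right_mono mult_left_mono) auto
      ultimately show ?thesis by simp
    qed
    finally show ?thesis .
  qed (simp add: W_def)
  note le = this
  have "bad r s n A = (\<Union>l\<in>T (Suc n). W l)" by (auto simp: bad_def W_def)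
  then have "measure ?\<mu> (bad r s n A) \<le> (\<Sum>l\<in>T (Suc n). measure ?\<mu> (W l))"
    using W net by (simp only:) (intro finite_measure_subadditive_finite, auto)
  also have "\<dots> \<le> card (T (Suc n)) * exp (- (2 * (p - r)\<^sup>2 * s * 2 ^ Suc n))"
    by (intro sum_bounded_above le)
  also have "\<dots> \<le> C * B ^ Suc n * exp (- (2 * (p - r)\<^sup>2 * s * 2 ^ Suc n))"
    by (intro mult_right_mono net(2)) simp
  finally show ?thesis .
qed

text \<open>Level \<open>m\<close> has at most \<open>4 ^ m\<close> squares. This explains the 16 in
  \<open>approx\<close>: errors of size 16 ^ -n add up to at most 4 ^ -n for
  \<open>m \<le> n\<close>, far below the mass of order \<open>r ^ n\<close>, with
  \<open>r > 1 / 2\<close>, that is to be preserved.\<close>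

lemma sum_approx:
  assumes "A \<subseteq> grid m" "\<And>q. q \<in> grid m \<Longrightarrow> \<bar>g l m q - g l' m q\<bar> \<le> d" "0 \<le> d"
  shows "\<bar>sum (g l m) A - sum (g l' m) A\<bar> \<le> 4 ^ m * d"
proof -
  have "\<bar>sum (g l m) A - sum (g l' m) A\<bar> \<le> (\<Sum>q\<in>A. \<bar>g l m q - g l' m q\<bar>)"
    unfolding sum_subtractf[symmetric] by (rule sum_abs)
  also have "\<dots> \<le> card A * d" using assms by (intro sum_bounded_above) auto
  also have "\<dots> \<le> 4 ^ m * d"
    using card_mono[OF finite_grid assms(1)] assms(3)
    by (intro mult_right_mono) (auto simp: card_grid dest: of_nat_mono[where 'a = real])
  finally show ?thesis .
qed

text \<open>A line of \<open>\<Lambda>\<close> is compared with a net line of level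
  \<open>Suc n\<close>, which keeps the fraction \<open>r'\<close> of its mass. The first condition
  on \<open>n0\<close> fits the discretisation errors into the gap between \<open>r'\<close> and
  \<open>r\<close>; the second makes the net line heavy enough for the threshold in
  \<open>bad\<close>.\<close>

lemma sum_chosen_ge:
  assumes r: "0 < r" "r < r'" "r' \<le> 1"
    and n0: "\<And>n. n \<ge> n0 \<Longrightarrow> 1 / 4 ^ n \<le> (r' - r) * g0 * r ^ n" "\<And>n. n \<ge> n0 \<Longrightarrow> 1 / 4 ^ n \<le> g0 / 2 * r ^ n"
    and full: "chosen \<omega> n0 = grid n0"
    and good: "\<And>n. n \<ge> n0 \<Longrightarrow> \<omega> \<notin> bad r' (g0 / 2 * r ^ n) n (chosen \<omega> n)"
    and l: "l \<in> \<Lambda>" and n: "n \<ge> n0"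
  shows "g0 * r ^ n \<le> sum (g l n) (chosen \<omega> n)"
  using n
proof (induction n rule: dec_induct)
  case base
  have "g0 * r ^ n0 \<le> g0 * 1" using g0 r by (intro mult_left_mono power_le_one) auto
  also have "\<dots> \<le> sum (g l n0) (grid n0)" using g0(2)[OF l] sum_grid_ge[of l n0] by simp
  finally show ?case by (simp add: full)
next
  case (step n)
  define e :: real where "e = 1 / 16 ^ Suc n"
  obtain l' where l': "l' \<in> T (Suc n)" "\<And>m q. m \<le> Suc n \<Longrightarrow> q \<in> grid m \<Longrightarrow> \<bar>g l m q - g l' m q\<bar> \<le> e"
    using approx[OF l, of "Suc n"] unfolding e_def by blast
  have 1: "\<bar>sum (g l n) (chosen \<omega> n) - sum (g l' n) (chosen \<omega> n)\<bar> \<le> 4 ^ n * e"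
    by (rule sum_approx[OF chosen_subset_grid l'(2)]) (auto simp: e_def)
  have 2: "\<bar>sum (g l (Suc n)) (chosen \<omega> (Suc n)) - sum (g l' (Suc n)) (chosen \<omega> (Suc n))\<bar> \<le> 4 ^ Suc n * e"
    by (rule sum_approx[OF chosen_subset_grid l'(2)]) (auto simp: e_def)
  define d :: real where "d = 1 / 4 ^ n"
  have e: "4 ^ Suc n * e = d / 4" "4 ^ n * e = d / 16"
    using power_mult_distrib[of "4::real" 4 n] by (simp_all add: e_def d_def)
  have pos: "0 < d" by (simp add: d_def)
  define u where "u = (r' - r) * g0 * r ^ n"
  have n0: "d \<le> u" "d \<le> g0 / 2 * r ^ n"
    using n0[of n] step.hyps by (simp_all add: d_def u_def)
  have ge: "g0 / 2 * r ^ n \<le> sum (g l' n) (chosen \<omega> n)"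
    using 1 step.IH n0(2) pos unfolding e by linarith
  have "\<omega> \<notin> bad r' (g0 / 2 * r ^ n) n (chosen \<omega> n)" using good step.hyps by simp
  then have 3: "r' * sum (g l' n) (chosen \<omega> n) \<le> sum (g l' (Suc n)) (chosen \<omega> (Suc n))"
    using l'(1) ge unfolding bad_def chosen_Suc by (force simp: not_less)
  have "r' * (g0 * r ^ n - d / 16) \<le> r' * sum (g l' n) (chosen \<omega> n)"
    using 1 step.IH r unfolding e by (intro mult_left_mono) linarith+
  moreover have "r' * (d / 16) \<le> 1 * (d / 16)"
    using r pos by (intro mult_right_mono) auto
  moreover have "g0 * r ^ Suc n = r' * (g0 * r ^ n) - u" by (simp add: algebra_simps u_def)
  ultimately show ?case
    using 2 3 pos n0(1) unfolding e right_diff_distrib by linarith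
qed

text \<open>All squares up to a late level \<open>n0\<close> are chosen with positive probability,
  and conditionally on this the bad events of all later levels together have probability at most 1 /
  2.\<close>

lemma prob_hit_pos:
  "0 < measure (percolation_measure p) {\<omega>. \<forall>n. \<forall>l\<in>\<Lambda>. \<exists>q\<in>chosen \<omega> n. 0 < g l n q}"
    (is "0 < measure ?\<mu> ?G")
proof -
  interpret prob_space ?\<mu> by (rule prob_space_percolation_measure)
  \<comment> \<open>The rates satisfy \<open>1 / 2 < r < r' < p\<close>: the gap between
    \<open>r\<close> and \<open>r'\<close> absorbs the net error, the gap between \<open>r'\<close>
    and \<open>p\<close> feeds Hoeffding's inequality, and \<open>2 * r > 1\<close> makes its bound
    doubly exponential.\<close>
  define r where "r = (1 / 2 + p) / 2"
  define r' where "r' = (r + p) / 2"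
  have r: "1 / 2 < r" "r < r'" "r' < p" using p by (auto simp: r_def r'_def)
  define \<kappa> where "\<kappa> = 2 * (p - r')\<^sup>2 * g0"
  have \<kappa>: "0 < \<kappa>" using r g0 by (simp add: \<kappa>_def)
  define \<epsilon> where "\<epsilon> n = C * B ^ Suc n * exp (- (\<kappa> * (2 * r) ^ n))" for n
  have C: "0 \<le> C" using net(2)[of 0] by simp
  have \<epsilon>0: "0 \<le> \<epsilon> n" for n using C net(3) by (simp add: \<epsilon>_def)
  have sm: "summable \<epsilon>"
    using summable_mult[OF summable_power_exp_exp[OF net(3) \<kappa>, of "2 * r"], of "C * B"] r
    unfolding \<epsilon>_def by (simp add: mult_ac)
  obtain N1 where N1: "\<And>n. n \<ge> N1 \<Longrightarrow> norm (\<Sum>i. \<epsilon> (i + n)) < 1 / 2"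
    using suminf_exist_split[OF _ sm, of "1 / 2"] by auto
  have "(\<lambda>n. (1 / (4 * r)) ^ n) \<longlonglongrightarrow> 0" using r by (intro LIMSEQ_realpow_zero) (auto simp: field_simps)
  then have "eventually (\<lambda>n. (1 / (4 * r)) ^ n < (r' - r) * g0) sequentially"
      "eventually (\<lambda>n. (1 / (4 * r)) ^ n < g0 / 2) sequentially"
    using r g0 by (auto intro!: order_tendstoD(2))
  then obtain N2 where N2: "\<And>n. n \<ge> N2 \<Longrightarrow> (1 / (4 * r)) ^ n < (r' - r) * g0"
      "\<And>n. n \<ge> N2 \<Longrightarrow> (1 / (4 * r)) ^ n < g0 / 2"
    unfolding eventually_sequentially by (metis linorder_linear order_trans)
  define n0 where "n0 = max N1 N2"
  have eq: "1 / 4 ^ n = (1 / (4 * r)) ^ n * r ^ n" for n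
    using r by (simp add: power_divide power_mult_distrib)
  have n0: "1 / 4 ^ n \<le> (r' - r) * g0 * r ^ n" "1 / 4 ^ n \<le> g0 / 2 * r ^ n" if "n \<ge> n0" for n
    unfolding eq using that N2[of n] r by (auto simp: n0_def intro!: mult_right_mono)
  define F where "F = {\<omega>. chosen \<omega> n0 = grid n0}"
  have F: "F \<in> sets ?\<mu>" "\<And>n. n \<ge> n0 \<Longrightarrow> depends_on (coins_upto n) F"
  proof -
    show "F \<in> sets ?\<mu>" unfolding F_def by (rule sets_chosen_eq)
    have "depends_on (coins_upto n0) F" unfolding F_def by (rule depends_on_chosen_upto)
    then show "depends_on (coins_upto n) F" if "n \<ge> n0" for n
      by (rule depends_on_mono) (use that in \<open>auto simp: coins_upto_def\<close>)
  qed
  have Fpos: "0 < measure ?\<mu> F"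
  proof -
    define J where "J = (SIGMA m:{..n0}. grid m)"
    have J: "finite J" unfolding J_def by auto
    have "measure ?\<mu> (\<Inter>c\<in>J. {\<omega>. \<omega> c}) = (\<Prod>c\<in>J. measure ?\<mu> {\<omega>. \<omega> c})"
      by (rule percolation_prob_INT[where K = "\<lambda>c. {c}"])
        (use J sets_coin depends_on_coin in \<open>auto simp: disjoint_family_on_def\<close>)
    also have "\<dots> > 0" using p prob_coin[of p] by (intro prod_pos) auto
    also have "measure ?\<mu> (\<Inter>c\<in>J. {\<omega>. \<omega> c}) \<le> measure ?\<mu> F"
    proof (rule finite_measure_mono[OF _ F(1)], rule subsetI)
      fix \<omega> assume "\<omega> \<in> (\<Inter>c\<in>J. {\<omega>. \<omega> c})"
      then have *: "\<omega> (m, q)" if "m \<le> n0" "q \<in> grid m" for m q using that by (auto simp: J_def)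
      have "chosen \<omega> m = grid m" if "m \<le> n0" for m
        using that
      proof (induction m)
        case (Suc m)
        then show ?case unfolding chosen_Suc using *[of "Suc m"] by (auto simp: children_grid)
      qed (auto simp: grid_def)
      then show "\<omega> \<in> F" by (simp add: F_def)
    qed
    finally show ?thesis .
  qed
  define S where "S i = {\<omega>\<in>F. True \<and> \<omega> \<in> bad r' (g0 / 2 * r ^ (i + n0)) (i + n0) (chosen \<omega> (i + n0))}" for i
  have S: "S i \<in> sets ?\<mu>" "measure ?\<mu> (S i) \<le> \<epsilon> (i + n0) * measure ?\<mu> F" for i
  proof -
    let ?n = "i + n0"
    have fin: "finite A" if "A \<subseteq> grid ?n" for A using finite_subset[OF that] by simp
    have sets: "bad r' (g0 / 2 * r ^ ?n) ?n A \<in> sets ?\<mu>" if "A \<subseteq> grid ?n" for A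
      unfolding bad_def by (rule sets_coin_family) (rule finite_children[OF fin[OF that]])
    have dep: "depends_on (- coins_upto ?n) (bad r' (g0 / 2 * r ^ ?n) ?n A)" for A
      unfolding bad_def by (rule depends_on_coin_family)
    have le: "measure ?\<mu> (bad r' (g0 / 2 * r ^ ?n) ?n A) \<le> \<epsilon> ?n" if "A \<subseteq> grid ?n" for A
    proof -
      have "measure ?\<mu> (bad r' (g0 / 2 * r ^ ?n) ?n A)
        \<le> C * B ^ Suc ?n * exp (- (2 * (p - r')\<^sup>2 * (g0 / 2 * r ^ ?n) * 2 ^ Suc ?n))"
        using r g0 by (intro prob_bad_le fin that) auto
      also have "2 * (p - r')\<^sup>2 * (g0 / 2 * r ^ ?n) * 2 ^ Suc ?n = \<kappa> * (2 * r) ^ ?n"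
        by (simp add: \<kappa>_def power_mult_distrib)
      finally show ?thesis by (simp only: \<epsilon>_def)
    qed
    note * = prob_conditional_le[where P = "\<lambda>_. True", OF F(1) F(2)[of ?n] sets dep le \<epsilon>0]
    show "S i \<in> sets ?\<mu>" "measure ?\<mu> (S i) \<le> \<epsilon> ?n * measure ?\<mu> F"
      unfolding S_def using * by auto
  qed
  have sm': "summable (\<lambda>i. \<epsilon> (i + n0))" using sm by (simp add: summable_iff_shift)
  have smS: "summable (\<lambda>i. measure ?\<mu> (S i))"
    by (rule summable_comparison_test'[OF summable_mult2[OF sm', of "measure ?\<mu> F"], of 0]) (use S in auto)
  have "measure ?\<mu> (\<Union>i. S i) \<le> (\<Sum>i. measure ?\<mu> (S i))"
    by (rule finite_measure_subadditive_countably) (use S smS in auto)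
  also have "\<dots> \<le> (\<Sum>i. \<epsilon> (i + n0) * measure ?\<mu> F)"
    using S smS sm' by (intro suminf_le summable_mult2) auto
  also have "\<dots> = (\<Sum>i. \<epsilon> (i + n0)) * measure ?\<mu> F" using suminf_mult2[OF sm'] by simp
  also have "\<dots> \<le> 1 / 2 * measure ?\<mu> F"
    using N1[of n0] by (intro mult_right_mono) (auto simp: n0_def)
  finally have half: "measure ?\<mu> (\<Union>i. S i) < measure ?\<mu> F" using Fpos by simp
  have UN: "(\<Union>i. S i) \<in> sets ?\<mu>" using S by auto
  have "0 < measure ?\<mu> (F - (\<Union>i. S i))"
    using half F(1) UN by (subst finite_measure_Diff) (auto simp: S_def)
  also have "\<dots> \<le> measure ?\<mu> ?G"
  proof (rule finite_measure_mono)
    have "?G = (\<Inter>n. {\<omega>. \<forall>l\<in>\<Lambda>. \<exists>q\<in>chosen \<omega> n. 0 < g l n q})" by auto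
    then show "?G \<in> sets ?\<mu>" using sets_chosen[where p = p] by (auto intro!: sets.countable_INT'')
    show "F - (\<Union>i. S i) \<subseteq> ?G"
    proof (intro subsetI CollectI allI ballI)
      fix \<omega> n l assume \<omega>: "\<omega> \<in> F - (\<Union>i. S i)" and l: "l \<in> \<Lambda>"
      have full: "chosen \<omega> n0 = grid n0" using \<omega> by (simp add: F_def)
      have good: "\<omega> \<notin> bad r' (g0 / 2 * r ^ m) m (chosen \<omega> m)" if "m \<ge> n0" for m
        using \<omega> that by (auto simp: S_def dest: spec[of _ "m - n0"])
      have "0 < sum (g l n) (chosen \<omega> n)"
      proof (cases "n \<ge> n0")
        case True
        have "g0 * r ^ n \<le> sum (g l n) (chosen \<omega> n)"
          by (rule sum_chosen_ge[OF _ _ _ n0 full good l True]) (use r p in auto)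
        moreover have "0 < g0 * r ^ n" using g0 r by simp
        ultimately show ?thesis by linarith
      next
        case False
        then show ?thesis
          using g0(1) g0(2)[OF l] sum_grid_ge[of l n] chosen_grid_downwards[OF full, of n] by simp
      qed
      then show "\<exists>q\<in>chosen \<omega> n. 0 < g l n q"
        by (meson linorder_not_le sum_nonpos)
    qed
  qed
  finally show ?thesis .
qed

end

section \<open>Self-similarity and survival\<close>

definition level_set :: "construction \<Rightarrow> nat \<Rightarrow> (real \<times> real) set" where
  "level_set \<omega> n = (\<Union>q\<in>chosen \<omega> n. dyadic_square n q)"

lemma compact_dyadic_square: "compact (dyadic_square n q)"
  by (cases q) (auto simp: dyadic_square_def intro: compact_Times)

lemma compact_level_set: "compact (level_set \<omega> n)"
  unfolding level_set_def by (rule compact_UN[OF finite_chosen compact_dyadic_square])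

lemma level_set_Suc_subset: "level_set \<omega> (Suc n) \<subseteq> level_set \<omega> n"
proof
  fix x assume "x \<in> level_set \<omega> (Suc n)"
  then obtain i j where ij: "(i, j) \<in> chosen \<omega> (Suc n)" "x \<in> dyadic_square (Suc n) (i, j)"
    by (auto simp only: level_set_def)
  then have "(i div 2, j div 2) \<in> chosen \<omega> n" "x \<in> dyadic_square n (i div 2, j div 2)"
    using dyadic_square_Suc_subset by auto
  then show "x \<in> level_set \<omega> n" unfolding level_set_def by blast
qed

lemma level_set_antimono: "m \<le> n \<Longrightarrow> level_set \<omega> n \<subseteq> level_set \<omega> m"
  by (rule lift_Suc_antimono_le) (rule level_set_Suc_subset)

lemma percolation_set_eq: "percolation_set \<omega> = (\<Inter>n. level_set \<omega> n)"
proof -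
  have "(\<Inter>n\<in>{1..}. level_set \<omega> n) \<subseteq> level_set \<omega> n" for n
    using level_set_Suc_subset[of \<omega> n] by (cases n) auto
  then show ?thesis unfolding percolation_set_def level_set_def[symmetric] by blast
qed

lemma compact_percolation_set: "compact (percolation_set \<omega>)"
proof -
  have "closed (\<Inter>n. level_set \<omega> n)"
    using compact_level_set compact_imp_closed by (intro closed_INT) blast
  from compact_Int_closed[OF compact_level_set[of \<omega> 0] this] show ?thesis
    unfolding percolation_set_eq by (simp add: Int_absorb1 INF_lower)
qed

section \<open>Lines met by the limit set: measurability, zooming into squares, independent
  trials\<close>

definition hits :: "((real \<times> real) \<times> real) set \<Rightarrow> construction set" where
  "hits \<Lambda> = {\<omega>. \<forall>(w, c)\<in>\<Lambda>. \<exists>z\<in>percolation_set \<omega>. z \<bullet> w = c}"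

text \<open>By compactness a line meets the limit set iff it meets every level. Each level condition
  is a property of \<open>chosen \<omega> n\<close>, which has finitely many values, so
  \<open>hits \<Lambda>\<close> is measurable even for uncountable \<open>\<Lambda>\<close>.\<close>

lemma hits_eq:
  "hits \<Lambda> = {\<omega>. \<forall>n. \<forall>(w, c)\<in>\<Lambda>. \<exists>q\<in>chosen \<omega> n. \<exists>z\<in>dyadic_square n q. z \<bullet> w = c}"
proof -
  have "(\<exists>z\<in>percolation_set \<omega>. z \<bullet> w = c) \<longleftrightarrow> (\<forall>n. \<exists>z\<in>level_set \<omega> n. z \<bullet> w = c)" for \<omega> w c
  proof
    assume *: "\<forall>n. \<exists>z\<in>level_set \<omega> n. z \<bullet> w = c"
    define F where "F n = level_set \<omega> n \<inter> {z. z \<bullet> w = c}" for n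
    have cl: "closed {z. z \<bullet> w = c}"
      by (intro closed_Collect_eq continuous_intros)
    have "(\<Inter>n. F n) \<noteq> {}"
    proof (rule compact_nest)
      show "compact (F n)" for n
        unfolding F_def by (rule compact_Int_closed[OF compact_level_set cl])
      show "F n \<noteq> {}" for n using * by (auto simp: F_def)
      show "F n \<subseteq> F m" if "m \<le> n" for m n
        using level_set_antimono[OF that, of \<omega>] by (auto simp only: F_def)
    qed
    then show "\<exists>z\<in>percolation_set \<omega>. z \<bullet> w = c" by (auto simp: F_def percolation_set_eq)
  qed (auto simp: percolation_set_eq)
  then show ?thesis unfolding hits_def level_set_def by fastforce
qed

lemma sets_hits: "hits \<Lambda> \<in> sets (percolation_measure p)"
proof -
  have "hits \<Lambda> = (\<Inter>n. {\<omega>. \<forall>(w, c)\<in>\<Lambda>. \<exists>q\<in>chosen \<omega> n. \<exists>z\<in>dyadic_square n q. z \<bullet> w = c})"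
    unfolding hits_eq by (rule Collect_all_eq)
  then show ?thesis using sets_chosen[where p = p] by (auto intro!: sets.countable_INT'')
qed

definition embed :: "nat \<Rightarrow> int \<times> int \<Rightarrow> real \<times> real \<Rightarrow> real \<times> real" where
  "embed k q z = ((of_int (fst q) + fst z) / 2 ^ k, (of_int (snd q) + snd z) / 2 ^ k)"

lemma embed_dyadic_square:
  assumes "z \<in> dyadic_square n (i, j)"
  shows "embed k q z \<in> dyadic_square (k + n) (2 ^ n * fst q + i, 2 ^ n * snd q + j)"
proof -
  have *: "(of_int a + x) / 2 ^ k \<in> {of_int (2 ^ n * a + i) / 2 ^ (k + n) .. of_int (2 ^ n * a + i + 1) / 2 ^ (k + n)}"
    if "x \<in> {of_int i / 2 ^ n .. of_int (i + 1) / 2 ^ n}" for a i :: int and x :: real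
  proof -
    have "of_int (2 ^ n * a + b) / 2 ^ (k + n) = (of_int a + of_int b / 2 ^ n :: real) / 2 ^ k" for b :: int
      by (simp add: power_add add_divide_distrib)
    from this[of i] this[of "i + 1"] show ?thesis
      using that by (simp add: divide_right_mono add.assoc)
  qed
  show ?thesis
    using assms *[of "fst z" i "fst q"] *[of "snd z" j "snd q"]
    by (auto simp: embed_def dyadic_square_def)
qed

lemma embed_percolation_set:
  assumes q: "q \<in> chosen \<omega> k" and z: "z \<in> percolation_set (shift k q \<omega>)"
  shows "embed k q z \<in> percolation_set \<omega>" "embed k q z \<in> dyadic_square k q"
proof -
  have *: "\<exists>i j. (i, j) \<in> chosen (shift k q \<omega>) n \<and> z \<in> dyadic_square n (i, j)" for n
    using z by (fastforce simp: percolation_set_eq level_set_def)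
  have "embed k q z \<in> level_set \<omega> (k + n)" for n
  proof -
    obtain i j where ij: "(i, j) \<in> chosen (shift k q \<omega>) n" "z \<in> dyadic_square n (i, j)"
      using * by blast
    then have "(2 ^ n * fst q + i, 2 ^ n * snd q + j) \<in> chosen \<omega> (k + n)"
      using q chosen_add_iff chosen_subset_grid by blast
    then show ?thesis unfolding level_set_def using embed_dyadic_square[OF ij(2)] by blast
  qed
  then show "embed k q z \<in> percolation_set \<omega>"
    unfolding percolation_set_eq using level_set_antimono le_add2 by blast
  show "embed k q z \<in> dyadic_square k q"
    using *[of 0] embed_dyadic_square[of z 0 0 0 k q] by auto
qed

text \<open>The offset for which \<open>embed k q\<close> carries the line
  \<open>z \<bullet> w = rescale k q w c\<close> into \<open>z \<bullet> w = c\<close>. Zooming into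
  a square changes only the offset, never \<open>w\<close>.\<close>

definition rescale :: "nat \<Rightarrow> int \<times> int \<Rightarrow> real \<times> real \<Rightarrow> real \<Rightarrow> real" where
  "rescale k q w c = 2 ^ k * c - (of_int (fst q) * fst w + of_int (snd q) * snd w)"

lemma hits_shiftD:
  assumes "q \<in> chosen \<omega> k" "shift k q \<omega> \<in> hits \<Lambda>" "(w, rescale k q w c) \<in> \<Lambda>"
  shows "\<exists>z\<in>percolation_set \<omega> \<inter> dyadic_square k q. z \<bullet> w = c"
proof -
  obtain z where z: "z \<in> percolation_set (shift k q \<omega>)" "z \<bullet> w = rescale k q w c"
    using assms by (auto simp: hits_def)
  have "embed k q z \<bullet> w = (z \<bullet> w + (of_int (fst q) * fst w + of_int (snd q) * snd w)) / 2 ^ k"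
    by (simp add: embed_def inner_prod_def algebra_simps add_divide_distrib)
  then have "embed k q z \<bullet> w = c" by (simp add: z(2) rescale_def)
  then show ?thesis using embed_percolation_set[OF assms(1) z(1)] by blast
qed

lemma depends_on_hits: "depends_on (coins_below 0 (0, 0)) (hits \<Lambda>)"
  unfolding hits_eq by (rule depends_on_chosen)

lemma depends_on_shift_not:
  assumes "depends_on (coins_below 0 (0, 0)) H"
  shows "depends_on (coins_below k q) {\<omega>. shift k q \<omega> \<notin> H}"
  using depends_on_shift[OF depends_on_Compl[OF assms]] by simp

lemma prob_shift_not:
  assumes "H \<in> sets (percolation_measure p)"
  shows "{\<omega>. shift k q \<omega> \<notin> H} \<in> sets (percolation_measure p)"
    and "measure (percolation_measure p) {\<omega>. shift k q \<omega> \<notin> H} = 1 - measure (percolation_measure p) H"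
proof -
  interpret prob_space "percolation_measure p" by (rule prob_space_percolation_measure)
  have H: "- H \<in> sets (percolation_measure p)"
    using sets.compl_sets[OF assms] by (simp add: Compl_eq_Diff_UNIV)
  show "{\<omega>. shift k q \<omega> \<notin> H} \<in> sets (percolation_measure p)"
    using sets_shift[OF H, of k q] by simp
  show "measure (percolation_measure p) {\<omega>. shift k q \<omega> \<notin> H} = 1 - measure (percolation_measure p) H"
    using prob_shift[OF H, of k q] prob_compl[OF assms] by (simp add: Compl_eq_Diff_UNIV)
qed

text \<open>Given the chosen squares of level \<open>k\<close>, the constructions below them are
  independent copies of the whole construction, and each of them fails to hit with probability
  \<open>1 - c\<close>.\<close>

lemma prob_none_hits_le:
  fixes p \<Lambda> defines "c \<equiv> measure (percolation_measure p) (hits \<Lambda>)"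
  shows "{\<omega>. m \<le> card (chosen \<omega> k \<inter> B) \<and> (\<forall>q\<in>chosen \<omega> k \<inter> B. shift k q \<omega> \<notin> hits \<Lambda>)}
      \<in> sets (percolation_measure p)" (is "?S \<in> _")
    and "measure (percolation_measure p)
      {\<omega>. m \<le> card (chosen \<omega> k \<inter> B) \<and> (\<forall>q\<in>chosen \<omega> k \<inter> B. shift k q \<omega> \<notin> hits \<Lambda>)}
      \<le> (1 - c) ^ m"
proof -
  let ?\<mu> = "percolation_measure p"
  interpret prob_space ?\<mu> by (rule prob_space_percolation_measure)
  have c: "0 \<le> c" "c \<le> 1" by (simp_all add: c_def)
  define H where "H A = (\<Inter>q\<in>A \<inter> B. {\<omega>. shift k q \<omega> \<notin> hits \<Lambda>})" for A
  define P where "P A \<longleftrightarrow> m \<le> card (A \<inter> B)" for A :: "(int \<times> int) set"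
  have fin: "finite (A \<inter> B)" if "A \<subseteq> grid k" for A using finite_subset[OF that] by simp
  have H: "H A \<in> sets ?\<mu>" "measure ?\<mu> (H A) \<le> (1 - c) ^ m" if A: "A \<subseteq> grid k" "P A" for A
  proof -
    show "H A \<in> sets ?\<mu>"
    proof (cases "A \<inter> B = {}")
      case True
      then show ?thesis using sets.top[of ?\<mu>] by (simp add: H_def)
    qed (auto simp: H_def intro!: sets.finite_INT fin A prob_shift_not sets_hits)
    have "measure ?\<mu> (H A) = (\<Prod>q\<in>A \<inter> B. measure ?\<mu> {\<omega>. shift k q \<omega> \<notin> hits \<Lambda>})"
      unfolding H_def
      by (rule percolation_prob_INT[where K = "coins_below k"])
        (use fin[OF A(1)] in \<open>auto simp: disjoint_family_on_def coins_below_disjoint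
          intro: prob_shift_not sets_hits depends_on_shift_not depends_on_hits\<close>)
    also have "\<dots> = (1 - c) ^ card (A \<inter> B)"
      by (simp add: prob_shift_not sets_hits c_def)
    also have "\<dots> \<le> (1 - c) ^ m"
      using A(2) c by (intro power_decreasing) (auto simp: P_def)
    finally show "measure ?\<mu> (H A) \<le> (1 - c) ^ m" .
  qed
  have dep: "depends_on (- coins_upto k) (H A)" for A
    unfolding H_def
    by (intro depends_on_INT depends_on_mono[OF depends_on_shift_not] depends_on_hits)
      (use coins_below_upto_disjoint in blast)
  have UN: "UNIV \<in> sets ?\<mu>" "depends_on (coins_upto k) UNIV"
    using sets.top[of ?\<mu>] by (auto simp: depends_on_def)
  have eq: "?S = {\<omega>\<in>UNIV. P (chosen \<omega> k) \<and> \<omega> \<in> H (chosen \<omega> k)}"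
    by (auto simp: P_def H_def)
  have 0: "0 \<le> (1 - c) ^ m" using c by simp
  show "?S \<in> sets ?\<mu>" "measure ?\<mu> ?S \<le> (1 - c) ^ m"
    using prob_conditional_le[OF UN H(1) dep H(2) 0, of P] prob_space unfolding eq by simp_all
qed

text \<open>Borel-Cantelli. With \<open>(1 - c) ^ D < 1 / (2 * R)\<close>, the failure probability
  of \<open>D * k\<close> independent trials beats the number \<open>C * R ^ k\<close> of test sets
  by a factor \<open>2 ^ k\<close>.\<close>

lemma AE_eventually_hits:
  fixes \<B> :: "nat \<Rightarrow> (int \<times> int) set set"
  assumes pos: "0 < measure (percolation_measure p) (hits \<Lambda>)"
    and \<B>: "\<And>k. finite (\<B> k)" "\<And>k. real (card (\<B> k)) \<le> C * R ^ k" and R: "0 < R"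
  shows "\<exists>D. AE \<omega> in percolation_measure p. \<forall>\<^sub>F k in sequentially. \<forall>B\<in>\<B> k.
    D * k \<le> card (chosen \<omega> k \<inter> B) \<longrightarrow> (\<exists>q\<in>chosen \<omega> k \<inter> B. shift k q \<omega> \<in> hits \<Lambda>)"
proof -
  let ?\<mu> = "percolation_measure p"
  interpret prob_space ?\<mu> by (rule prob_space_percolation_measure)
  define c where "c = measure ?\<mu> (hits \<Lambda>)"
  have c: "0 < c" "c \<le> 1" using pos by (simp_all add: c_def)
  obtain D where D: "(1 - c) ^ D < 1 / (2 * R)"
    using real_arch_pow_inv[of "1 / (2 * R)" "1 - c"] R c by auto
  define X where "X k B = {\<omega>. D * k \<le> card (chosen \<omega> k \<inter> B) \<and> (\<forall>q\<in>chosen \<omega> k \<inter> B. shift k q \<omega> \<notin> hits \<Lambda>)}" for k B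
  define Y where "Y k = (\<Union>B\<in>\<B> k. X k B)" for k
  have X: "X k B \<in> sets ?\<mu>" "measure ?\<mu> (X k B) \<le> (1 - c) ^ (D * k)" for k B
    unfolding X_def c_def by (rule prob_none_hits_le)+
  have Y: "Y k \<in> sets ?\<mu>" for k unfolding Y_def using X \<B> by auto
  have "norm (measure ?\<mu> (Y k)) \<le> C * (1 / 2) ^ k" for k
  proof -
    have "measure ?\<mu> (Y k) \<le> (\<Sum>B\<in>\<B> k. measure ?\<mu> (X k B))"
      unfolding Y_def using X \<B> by (intro finite_measure_subadditive_finite) auto
    also have "\<dots> \<le> card (\<B> k) * (1 - c) ^ (D * k)" by (intro sum_bounded_above X)
    also have "\<dots> \<le> (C * R ^ k) * (1 / (2 * R)) ^ k"
      unfolding power_mult using c D \<B>(2)[of k] order_trans[OF of_nat_0_le_iff \<B>(2)[of k]]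
      by (intro mult_mono power_mono) auto
    also have "\<dots> = C * (1 / 2) ^ k" using R by (simp add: power_divide power_mult_distrib)
    finally show ?thesis by simp
  qed
  moreover have "summable (\<lambda>k. C * (1 / 2 :: real) ^ k)" by (intro summable_mult summable_geometric) simp
  ultimately have "summable (\<lambda>k. measure ?\<mu> (Y k))" by (rule summable_comparison_test'[rotated])
  then have "AE \<omega> in ?\<mu>. eventually (\<lambda>k. \<omega> \<in> space ?\<mu> - Y k) sequentially"
    using Y by (intro borel_cantelli_AE1) (auto simp: emeasure_eq_measure)
  then have "AE \<omega> in ?\<mu>. \<forall>\<^sub>F k in sequentially. \<forall>B\<in>\<B> k.
    D * k \<le> card (chosen \<omega> k \<inter> B) \<longrightarrow> (\<exists>q\<in>chosen \<omega> k \<inter> B. shift k q \<omega> \<in> hits \<Lambda>)"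
    by eventually_elim (auto simp: Y_def X_def elim!: eventually_mono)
  then show ?thesis by blast
qed

section \<open>Extinction and the branching fixed point equation\<close>

lemma chosen_empty_mono: "m \<le> n \<Longrightarrow> chosen \<omega> m = {} \<Longrightarrow> chosen \<omega> n = {}"
  by (induction n rule: dec_induct) auto

definition extinct :: "construction set" where
  "extinct = {\<omega>. \<exists>n. chosen \<omega> n = {}}"

lemma children_root_subset_grid: "children {(0, 0)} = grid 1"
proof -
  have "grid 0 = {(0, 0)}" by (auto simp: grid_def)
  then show ?thesis using children_grid[of 0] by simp
qed

lemma decompose_chosen_1:
  assumes "(i, j) \<in> chosen \<omega> (1 + n)"
  shows "\<exists>d\<in>children {(0, 0)}. \<omega> (1, d) \<and> chosen (shift 1 d \<omega>) n \<noteq> {}"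
proof -
  define d where "d = (i div 2 ^ n, j div 2 ^ n)"
  have eq: "2 ^ n * fst d + i mod 2 ^ n = i" "2 ^ n * snd d + j mod 2 ^ n = j" by (simp_all add: d_def)
  have "(i mod 2 ^ n, j mod 2 ^ n) \<in> grid n" by (simp add: grid_def)
  from chosen_add_iff[OF this, of d \<omega> 1] assms
  have "d \<in> chosen \<omega> 1" "chosen (shift 1 d \<omega>) n \<noteq> {}" unfolding eq by auto
  then show ?thesis using chosen_Suc[of \<omega> 0] by auto
qed

text \<open>The four quarters use disjoint sets of coins, and each violates the implication with
  probability \<open>p\<close> times the probability of the complement of \<open>Z\<close>.\<close>

lemma prob_all_children:
  assumes p: "0 \<le> p" "p \<le> 1" and Z: "Z \<in> sets (percolation_measure p)" "depends_on (coins_below 0 (0, 0)) Z"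
  shows "{\<omega>. \<forall>d\<in>children {(0, 0)}. \<omega> (1, d) \<longrightarrow> shift 1 d \<omega> \<in> Z} \<in> sets (percolation_measure p)"
      (is "?S \<in> _")
    and "measure (percolation_measure p) {\<omega>. \<forall>d\<in>children {(0, 0)}. \<omega> (1, d) \<longrightarrow> shift 1 d \<omega> \<in> Z}
      = (1 - p + p * measure (percolation_measure p) Z) ^ 4"
proof -
  let ?\<mu> = "percolation_measure p"
  interpret prob_space ?\<mu> by (rule prob_space_percolation_measure)
  define W where "W d = {\<omega>. \<omega> (1, d)} \<inter> {\<omega>. shift 1 d \<omega> \<notin> Z}" for d
  have W: "W d \<in> sets ?\<mu>" for d
    unfolding W_def by (intro sets.Int sets_coin prob_shift_not Z)
  have "measure ?\<mu> (W d) = p * (1 - measure ?\<mu> Z)" for d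
  proof -
    have "measure ?\<mu> (W d) = measure ?\<mu> {\<omega>. \<omega> (1, d)} * measure ?\<mu> {\<omega>. shift 1 d \<omega> \<notin> Z}"
      unfolding W_def
    proof (rule percolation_prob_Int[where K = "{(1, d)}" and K' = "coins_below 1 d"])
      show "{(1, d)} \<inter> coins_below 1 d = {}" by (auto simp: coins_below_def)
    qed (intro sets_coin prob_shift_not Z depends_on_coin depends_on_shift_not)+
    then show ?thesis using p by (simp add: prob_coin prob_shift_not Z)
  qed
  then have W1: "measure ?\<mu> (- W d) = 1 - p + p * measure ?\<mu> Z" for d
    using prob_compl[OF W, of d] by (simp add: Compl_eq_Diff_UNIV right_diff_distrib)
  have eq: "?S = (\<Inter>d\<in>grid 1. - W d)"
    unfolding children_root_subset_grid by (auto simp: W_def)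
  have W2: "- W d \<in> sets ?\<mu>" for d
    using sets.compl_sets[OF W, of d] by (simp add: Compl_eq_Diff_UNIV)
  show "?S \<in> sets ?\<mu>" unfolding eq
    by (rule sets.finite_INT) (auto simp: W2 grid_def)
  have "measure ?\<mu> ?S = (\<Prod>d\<in>grid 1. measure ?\<mu> (- W d))"
    unfolding eq
  proof (rule percolation_prob_INT[where K = "\<lambda>d. insert (1, d) (coins_below 1 d)"])
    show "disjoint_family_on (\<lambda>d. insert (1, d) (coins_below 1 d)) (grid 1)"
      using coins_below_disjoint by (auto simp: disjoint_family_on_def coins_below_def)
    show "depends_on (insert (1, d) (coins_below 1 d)) (- W d)" for d
      unfolding W_def
      by (intro depends_on_Compl depends_on_Int depends_on_mono[OF depends_on_coin] depends_on_mono[OF depends_on_shift_not] Z) auto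
  qed (auto simp: W2)
  also have "\<dots> = (1 - p + p * measure ?\<mu> Z) ^ 4" by (simp add: W1 card_grid)
  finally show "measure ?\<mu> ?S = (1 - p + p * measure ?\<mu> Z) ^ 4" .
qed

text \<open>
  Below, \<open>e\<close> is the extinction probability and \<open>y\<close> is the probability that the construction
  dies out or contains no good square. By self-similarity both are governed by the generating function
  \<open>(1 - p + p * s) ^ 4\<close> of the number of chosen quarters.
\<close>

lemma offspring_fixed_point_unique:
  fixes e y p :: real
  assumes p: "0 < p" "p \<le> 1" and e: "0 \<le> e" "(1 - p + p * e) ^ 4 \<le> e"
    and y: "e \<le> y" "y < 1" "y \<le> (1 - p + p * y) ^ 4"
  shows "y = e"
proof (rule ccontr)
  assume "y \<noteq> e"
  then have lt: "e < y" using y by simp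
  \<comment> \<open>Dividing the generating function minus the identity by \<open>1 - s\<close>
    removes the fixed point 1 and leaves \<open>h (p * (1 - s))\<close>. Since \<open>h\<close> is
    strictly increasing on the range in question, the difference cannot be nonpositive at
    \<open>e\<close> and nonnegative at a larger \<open>y < 1\<close>.\<close>
  define h where "h v = 1 - 4 * p + p * (6 * v - 4 * v\<^sup>2 + v ^ 3)" for v
  have phi: "(1 - p + p * s) ^ 4 - s = (1 - s) * h (p * (1 - s))" for s
    unfolding h_def by algebra
  define a b where "a = p * (1 - y)" and "b = p * (1 - e)"
  have ab: "0 \<le> a" "a < b" "b \<le> 1"
    using p e y lt mult_mono[of p 1 "1 - e" 1] by (auto simp: a_def b_def)
  have "(1 - e) * h b \<le> 0" "0 \<le> (1 - y) * h a"
    using phi[of e] phi[of y] e y by (simp_all add: a_def b_def)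
  then have "h b \<le> 0" "0 \<le> h a"
    using lt y by (auto simp: mult_le_0_iff zero_le_mult_iff)
  moreover have "h a < h b"
  proof -
    have "h b - h a = p * ((b - a) * (6 - 4 * (a + b) + (a\<^sup>2 + a * b + b\<^sup>2)))"
      unfolding h_def by algebra
    moreover have "6 - 4 * (a + b) + (a\<^sup>2 + a * b + b\<^sup>2) > 0"
    proof -
      have "3 * (a + b)\<^sup>2 / 4 - 4 * (a + b) + 6 > 0"
      proof -
        define t where "t = 2 - (a + b)"
        have t: "0 < t" using ab by (simp add: t_def)
        have "3 * (a + b)\<^sup>2 / 4 - 4 * (a + b) + 6 = 3 * t\<^sup>2 / 4 + t + 1"
          unfolding t_def by (simp add: power2_eq_square field_simps)
        then show ?thesis using t zero_le_power2[of t] by linarith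
      qed
      moreover have "a\<^sup>2 + a * b + b\<^sup>2 = 3 * (a + b)\<^sup>2 / 4 + (a - b)\<^sup>2 / 4"
        by (simp add: power2_eq_square field_simps)
      ultimately show ?thesis using zero_le_power2[of "a - b"] by linarith
    qed
    ultimately have "0 < h b - h a" using ab p by simp
    then show ?thesis by simp
  qed
  ultimately show False by linarith
qed

text \<open>Extinction gives one inequality of the fixed point equation and \<open>Y\<close> the
  other; uniqueness below 1 makes their probabilities equal, so survival without a good square is a
  null event. Positivity of \<open>hits \<Lambda>\<close> keeps the probability of \<open>Y\<close>
  below 1.\<close>

lemma AE_hits_or_extinct:
  assumes p: "0 < p" "p \<le> 1"
    and pos: "0 < measure (percolation_measure p) (hits \<Lambda>)" and ne: "\<Lambda> \<noteq> {}"
  shows "AE \<omega> in percolation_measure p.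
    percolation_set \<omega> \<noteq> {} \<longrightarrow> (\<exists>k. \<exists>q\<in>chosen \<omega> k. shift k q \<omega> \<in> hits \<Lambda>)"
proof -
  let ?\<mu> = "percolation_measure p"
  interpret prob_space ?\<mu> by (rule prob_space_percolation_measure)
  define Y where "Y = extinct \<union> {\<omega>. \<forall>k. \<forall>q\<in>chosen \<omega> k. shift k q \<omega> \<notin> hits \<Lambda>}"
  have ext: "extinct \<in> sets ?\<mu>"
  proof -
    have "extinct = (\<Union>n. {\<omega>. chosen \<omega> n = {}})" by (auto simp: extinct_def)
    also have "\<dots> \<in> sets ?\<mu>" by (intro sets.countable_UN'' sets_chosen_eq) auto
    finally show ?thesis .
  qed
  have Y: "Y \<in> sets ?\<mu>"
  proof -
    have "{\<omega>. \<forall>k. \<forall>q\<in>chosen \<omega> k. shift k q \<omega> \<notin> hits \<Lambda>}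
      = (\<Inter>k. \<Inter>q. - ({\<omega>. q \<in> chosen \<omega> k} \<inter> {\<omega>. shift k q \<omega> \<in> hits \<Lambda>}))" by auto
    also have "\<dots> \<in> sets ?\<mu>"
    proof (intro sets.countable_INT'')
      fix k q
      have "{\<omega>. q \<in> chosen \<omega> k} \<inter> {\<omega>. shift k q \<omega> \<in> hits \<Lambda>} \<in> sets ?\<mu>"
        by (intro sets.Int sets_percolation_chosen sets_shift sets_hits)
      from sets.compl_sets[OF this]
      show "- ({\<omega>. q \<in> chosen \<omega> k} \<inter> {\<omega>. shift k q \<omega> \<in> hits \<Lambda>}) \<in> sets ?\<mu>"
        by (simp add: Compl_eq_Diff_UNIV)
    qed (use sets.top[of ?\<mu>] in auto)
    finally show ?thesis unfolding Y_def using ext by blast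
  qed
  have ext_dep: "depends_on (coins_below 0 (0, 0)) extinct"
    unfolding extinct_def by (rule depends_on_chosen)
  have Y_dep: "depends_on (coins_below 0 (0, 0)) Y"
  proof -
    have "Y = extinct \<union> (\<Inter>k. \<Inter>q\<in>grid k. - ({\<omega>. q \<in> chosen \<omega> k} \<inter> {\<omega>. shift k q \<omega> \<in> hits \<Lambda>}))"
      using chosen_subset_grid unfolding Y_def by blast
    also have "depends_on (coins_below 0 (0, 0)) \<dots>"
      by (intro depends_on_Un ext_dep depends_on_INT depends_on_Compl depends_on_Int depends_on_chosen
          depends_on_mono[OF depends_on_shift[OF depends_on_hits] coins_below_subset])
    finally show ?thesis .
  qed
  have shift_shift: "shift m r (shift k q \<omega>) = shift (k + m) (2 ^ m * fst q + fst r, 2 ^ m * snd q + snd r) \<omega>"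
    for k m q r \<omega>
    by (auto simp: shift_def fun_eq_iff power_add algebra_simps)
  define e y where "e = measure ?\<mu> extinct" and "y = measure ?\<mu> Y"
  have root: "d \<in> chosen \<omega> 1" if "d \<in> children {(0, 0)}" "\<omega> (1, d)" for d \<omega>
    using that chosen_Suc[of \<omega> 0] by simp
  have "(1 - p + p * e) ^ 4 \<le> e"
  proof -
    have "{\<omega>. \<forall>d\<in>children {(0, 0)}. \<omega> (1, d) \<longrightarrow> shift 1 d \<omega> \<in> extinct} \<subseteq> extinct"
    proof
      fix \<omega> assume "\<omega> \<in> {\<omega>. \<forall>d\<in>children {(0, 0)}. \<omega> (1, d) \<longrightarrow> shift 1 d \<omega> \<in> extinct}"
      then have "\<forall>d\<in>children {(0, 0)}. \<exists>n. \<omega> (1, d) \<longrightarrow> chosen (shift 1 d \<omega>) n = {}"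
        by (auto simp: extinct_def)
      then obtain N where N: "\<And>d. d \<in> children {(0, 0)} \<Longrightarrow> \<omega> (1, d) \<Longrightarrow> chosen (shift 1 d \<omega>) (N d) = {}"
        by metis
      \<comment> \<open>The sum is merely a convenient upper bound: a common level at which all
        chosen quarters have died out.\<close>
      define M where "M = (\<Sum>d\<in>children {(0, 0)}. N d)"
      have "N d \<le> M" if "d \<in> children {(0, 0)}" for d
        unfolding M_def by (rule member_le_sum[OF that]) (auto simp: finite_children)
      then have "chosen (shift 1 d \<omega>) M = {}" if "d \<in> children {(0, 0)}" "\<omega> (1, d)" for d
        using N[OF that] chosen_empty_mono that by blast
      then have "chosen \<omega> (1 + M) = {}"
        using decompose_chosen_1[of _ _ \<omega> M] by fast
      then show "\<omega> \<in> extinct" unfolding extinct_def by blast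
    qed
    from finite_measure_mono[OF this ext] show ?thesis
      using prob_all_children(2)[OF _ _ ext ext_dep] p by (simp add: e_def)
  qed
  moreover have "y \<le> (1 - p + p * y) ^ 4"
  proof -
    have "Y \<subseteq> {\<omega>. \<forall>d\<in>children {(0, 0)}. \<omega> (1, d) \<longrightarrow> shift 1 d \<omega> \<in> Y}"
    proof (intro subsetI CollectI ballI impI)
      fix \<omega> d assume \<omega>: "\<omega> \<in> Y" and d: "d \<in> children {(0, 0)}" "\<omega> (1, d)"
      have ch: "(2 ^ n * fst d + fst q, 2 ^ n * snd d + snd q) \<in> chosen \<omega> (1 + n)"
        if "q \<in> chosen (shift 1 d \<omega>) n" for q n
        using chosen_add_iff[of "fst q" "snd q" n d \<omega> 1] chosen_subset_grid that root[of d \<omega>, OF d]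
        by auto
      show "shift 1 d \<omega> \<in> Y"
      proof (cases "\<omega> \<in> extinct")
        case True
        then obtain n where "chosen \<omega> n = {}" by (auto simp: extinct_def)
        then have "chosen \<omega> (1 + n) = {}" by (rule chosen_empty_mono[rotated]) simp
        then have "chosen (shift 1 d \<omega>) n = {}" using ch by blast
        then show ?thesis by (auto simp: Y_def extinct_def)
      next
        case False
        then have "shift k q \<omega> \<notin> hits \<Lambda>" if "q \<in> chosen \<omega> k" for k q
          using \<omega> that by (auto simp: Y_def)
        then show ?thesis using ch unfolding Y_def by (auto simp only: shift_shift)
      qed
    qed
    from finite_measure_mono[OF this prob_all_children(1)[OF _ _ Y Y_dep]] show ?thesis
      using prob_all_children(2)[OF _ _ Y Y_dep] p by (simp add: y_def)
  qed
  moreover have "e \<le> y"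
    unfolding e_def y_def by (rule finite_measure_mono[OF _ Y]) (auto simp: Y_def)
  moreover have "y < 1"
  proof -
    have "\<omega> \<notin> extinct" if \<omega>: "\<omega> \<in> hits \<Lambda>" for \<omega>
    proof -
      have "percolation_set \<omega> \<noteq> {}" using \<omega> ne by (fastforce simp: hits_def)
      then show ?thesis by (auto simp: extinct_def percolation_set_nonempty_iff)
    qed
    \<comment> \<open>The root is a chosen square with trivial shift, so every construction in
      \<open>hits \<Lambda>\<close> has a good square at level 0 and lies outside
      \<open>Y\<close>.\<close>
    moreover have "shift 0 (0, 0) \<omega> = \<omega>" for \<omega> by (auto simp: shift_def fun_eq_iff)
    ultimately have "Y \<inter> hits \<Lambda> = {}"
      by (auto simp: Y_def) (metis chosen.simps(1) singletonI)
    then have "measure ?\<mu> (Y \<union> hits \<Lambda>) = y + measure ?\<mu> (hits \<Lambda>)"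
      unfolding y_def by (intro finite_measure_Union Y sets_hits)
    then show ?thesis using pos prob_le_1[of "Y \<union> hits \<Lambda>"] by linarith
  qed
  ultimately have "y = e" using p by (intro offspring_fixed_point_unique) (auto simp: e_def)
  then have "measure ?\<mu> (Y - extinct) = 0"
    using finite_measure_Diff[OF Y ext] by (auto simp: e_def y_def Y_def)
  then have "AE \<omega> in ?\<mu>. \<omega> \<notin> Y - extinct"
    using Y ext by (intro AE_not_in) (auto simp: null_sets_def emeasure_eq_measure)
  then show ?thesis
    by eventually_elim (auto simp: Y_def extinct_def percolation_set_nonempty_iff)
qed

section \<open>Box counts and dimensions\<close>

lemma dist_dyadic_square_le:
  assumes "x \<in> dyadic_square k q" "y \<in> dyadic_square k q"
  shows "dist x y \<le> 2 / 2 ^ k"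
proof -
  have "\<bar>fst x - fst y\<bar> \<le> 1 / 2 ^ k" "\<bar>snd x - snd y\<bar> \<le> 1 / 2 ^ k"
    using assms by (auto simp: dyadic_square_def add_divide_distrib split: prod.splits)
  moreover have "dist x y \<le> \<bar>fst x - fst y\<bar> + \<bar>snd x - snd y\<bar>"
    using sqrt_sum_squares_le_sum_abs[of "fst x - fst y" "snd x - snd y"]
    by (simp add: dist_prod_def dist_real_def)
  ultimately show ?thesis by simp
qed

lemma mem_dyadic_square:
  "(x, y) \<in> dyadic_square k (i, j) \<longleftrightarrow>
    of_int i \<le> 2 ^ k * x \<and> 2 ^ k * x \<le> of_int i + 1 \<and> of_int j \<le> 2 ^ k * y \<and> 2 ^ k * y \<le> of_int j + 1"
  by (auto simp: dyadic_square_def field_simps)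

text \<open>A point of \<open>V\<close> in an arbitrary dyadic square also lies in a chosen one, and
  closed squares of the same level with a common point differ by at most 1 in each index. Box counts
  include such unchosen neighbours, hence the factor 9 in the next lemma.\<close>

lemma dyadic_squares_meeting_subset:
  assumes V: "V \<subseteq> percolation_set \<omega>"
  shows "{Q \<in> range (dyadic_square k). Q \<inter> V \<noteq> {}}
    \<subseteq> (\<Union>q\<in>{q\<in>chosen \<omega> k. dyadic_square k q \<inter> V \<noteq> {}}.
        dyadic_square k ` ({fst q - 1..fst q + 1} \<times> {snd q - 1..snd q + 1}))"
proof
  fix Q assume "Q \<in> {Q \<in> range (dyadic_square k). Q \<inter> V \<noteq> {}}"
  then obtain i j x y where Q: "Q = dyadic_square k (i, j)" and xy: "(x, y) \<in> V" "(x, y) \<in> dyadic_square k (i, j)"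
    by fast
  obtain i' j' where q: "(i', j') \<in> chosen \<omega> k" "(x, y) \<in> dyadic_square k (i', j')"
    using V xy(1) by (force simp: percolation_set_eq level_set_def)
  have "of_int i \<le> (of_int (i' + 1) :: real)" "of_int i' \<le> (of_int (i + 1) :: real)"
    "of_int j \<le> (of_int (j' + 1) :: real)" "of_int j' \<le> (of_int (j + 1) :: real)"
    using xy(2) q(2) unfolding mem_dyadic_square by simp_all
  then have "i' - 1 \<le> i" "i \<le> i' + 1" "j' - 1 \<le> j" "j \<le> j' + 1"
    unfolding of_int_le_iff by auto
  then have "Q \<in> dyadic_square k ` ({fst (i', j') - 1..fst (i', j') + 1} \<times> {snd (i', j') - 1..snd (i', j') + 1})"
    unfolding Q by (intro imageI) auto
  moreover have "(i', j') \<in> {q\<in>chosen \<omega> k. dyadic_square k q \<inter> V \<noteq> {}}"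
    using q xy(1) by blast
  ultimately show "Q \<in> (\<Union>q\<in>{q\<in>chosen \<omega> k. dyadic_square k q \<inter> V \<noteq> {}}.
      dyadic_square k ` ({fst q - 1..fst q + 1} \<times> {snd q - 1..snd q + 1}))" by blast
qed

lemma box_count_le:
  assumes V: "V \<subseteq> percolation_set \<omega>"
  shows "finite {Q \<in> range (dyadic_square k). Q \<inter> V \<noteq> {}}"
    and "box_count k V \<le> 9 * card {q\<in>chosen \<omega> k. dyadic_square k q \<inter> V \<noteq> {}}"
proof -
  let ?M = "{q\<in>chosen \<omega> k. dyadic_square k q \<inter> V \<noteq> {}}"
  let ?I = "\<lambda>q. dyadic_square k ` ({fst q - 1..fst q + 1} \<times> {snd q - 1..snd q + 1})"
  have fin: "finite ?M" using finite_chosen by simp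
  have fin': "finite (\<Union>q\<in>?M. ?I q)" using fin by auto
  show "finite {Q \<in> range (dyadic_square k). Q \<inter> V \<noteq> {}}"
    by (rule finite_subset[OF dyadic_squares_meeting_subset[OF V] fin'])
  have 9: "card (?I q) \<le> 9" for q
    using card_image_le[of "{fst q - 1..fst q + 1} \<times> {snd q - 1..snd q + 1}" "dyadic_square k"]
    by (simp add: card_cartesian_product)
  have "box_count k V \<le> card (\<Union>q\<in>?M. ?I q)"
    unfolding box_count_def by (rule card_mono[OF fin' dyadic_squares_meeting_subset[OF V]])
  also have "\<dots> \<le> (\<Sum>q\<in>?M. card (?I q))" by (rule card_UN_le[OF fin])
  also have "\<dots> \<le> card ?M * 9" using sum_bounded_above[of ?M "\<lambda>q. card (?I q)" 9] 9 by simp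
  finally show "box_count k V \<le> 9 * card ?M" by simp
qed

text \<open>The finitely many squares that meet \<open>V\<close> are padded with empty sets, because
  Hausdorff covers are sequences.\<close>

lemma box_cover:
  assumes V: "V \<subseteq> percolation_set \<omega>"
  obtains U :: "nat \<Rightarrow> (real \<times> real) set" where
    "V \<subseteq> (\<Union>i. U i)" "\<And>i. bounded (U i)" "\<And>i. diameter (U i) \<le> 2 / 2 ^ k"
    "\<And>i. i \<ge> box_count k V \<Longrightarrow> U i = {}"
proof -
  let ?S = "{Q \<in> range (dyadic_square k). Q \<inter> V \<noteq> {}}"
  obtain f where f: "bij_betw f {0..<card ?S} ?S"
    using ex_bij_betw_nat_finite[OF box_count_le(1)[OF V]] by blast
  define U where "U i = (if i < card ?S then f i else {})" for i
  have U: "\<exists>q. U i = dyadic_square k q" if "i < card ?S" for i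
  proof -
    have "f i \<in> ?S" using bij_betwE[OF f] that by auto
    then show ?thesis using that by (auto simp: U_def image_iff)
  qed
  have b: "bounded (U i) \<and> diameter (U i) \<le> 2 / 2 ^ k" for i
  proof (cases "i < card ?S")
    case True
    then obtain q where "U i = dyadic_square k q" using U by blast
    moreover from this have "norm (x - y) \<le> 2 / 2 ^ k" if "x \<in> U i" "y \<in> U i" for x y
      using that dist_dyadic_square_le[of x k q y] by (simp add: dist_norm)
    ultimately show ?thesis
      using compact_imp_bounded[OF compact_dyadic_square[of k q]] by (auto intro: diameter_le)
  qed (simp add: U_def)
  have "V \<subseteq> (\<Union>i. U i)"
  proof
    fix z assume z: "z \<in> V"
    then obtain q where "z \<in> dyadic_square k q"
      using V by (force simp: percolation_set_eq level_set_def)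
    then have "dyadic_square k q \<in> ?S" using z by blast
    then obtain i where "i < card ?S" "f i = dyadic_square k q"
      using bij_betw_imp_surj_on[OF f] by (metis (no_types, lifting) atLeastLessThan_iff imageE)
    then show "z \<in> (\<Union>i. U i)" using \<open>z \<in> dyadic_square k q\<close> by (auto simp: U_def)
  qed
  moreover have "U i = {}" if "i \<ge> box_count k V" for i
    using that by (simp add: U_def box_count_def)
  ultimately show ?thesis using b by (intro that[of U]) simp_all
qed

text \<open>The functional \<open>\<lambda>v. v \<bullet> w\<close> maps a nonempty
  \<open>U i\<close> into an interval of radius \<open>norm w * diameter (U i)\<close> around the
  value at any of its points, and these intervals have to cover \<open>{c1..c2}\<close>.\<close>

lemma projection_length_le:
  fixes w :: "'a::euclidean_space"
  assumes V: "\<And>c. c \<in> {c1..c2} \<Longrightarrow> \<exists>v\<in>V. v \<bullet> w = c" and c: "c1 \<le> c2"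
    and U: "V \<subseteq> (\<Union>i::nat. U i)" "\<And>i. bounded (U i)"
  shows "ennreal (c2 - c1) \<le> (\<Sum>i. ennreal (2 * norm w * diameter (U i)))"
proof -
  define J where "J i = {(SOME v. v \<in> U i) \<bullet> w - norm w * diameter (U i) .. (SOME v. v \<in> U i) \<bullet> w + norm w * diameter (U i)}" for i
  have "{c1..c2} \<subseteq> (\<Union>i. J i)"
  proof
    fix c assume "c \<in> {c1..c2}"
    then obtain v i where v: "v \<bullet> w = c" "v \<in> U i" using V U(1) by blast
    define u where "u = (SOME v. v \<in> U i)"
    have "u \<in> U i" using v(2) unfolding u_def by (rule someI)
    then have "norm (v - u) \<le> diameter (U i)"
      using diameter_bounded_bound[OF U(2) v(2)] by (simp add: dist_norm)
    then have "\<bar>(v - u) \<bullet> w\<bar> \<le> norm w * diameter (U i)"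
      using Cauchy_Schwarz_ineq2[of "v - u" w] mult_right_mono[of "norm (v - u)" "diameter (U i)" "norm w"]
      by (simp add: mult.commute)
    then have "c \<in> J i" using v(1) by (auto simp: J_def abs_le_iff inner_diff_left simp flip: u_def)
    then show "c \<in> (\<Union>i. J i)" by blast
  qed
  then have "emeasure lborel {c1..c2} \<le> emeasure lborel (\<Union>i. J i)"
    by (intro emeasure_mono) (auto simp: J_def)
  also have "\<dots> \<le> (\<Sum>i. emeasure lborel (J i))"
    by (rule emeasure_subadditive_countably) (auto simp: J_def)
  also have "(\<lambda>i. emeasure lborel (J i)) = (\<lambda>i. ennreal (2 * norm w * diameter (U i)))"
    using diameter_ge_0[OF U(2)] by (auto simp: J_def fun_eq_iff)
  finally show ?thesis using c by simp
qed

text \<open>For \<open>s < 1\<close>, a diameter of at most 1 is bounded by its power with exponent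
  \<open>s\<close>. So every cover at scale 1 costs at least the length of the projection divided by
  \<open>2 * norm w\<close>.\<close>

lemma hausdorff_dim_ge_1:
  fixes V :: "'a::euclidean_space set"
  assumes V: "\<And>c. c \<in> {c1..c2} \<Longrightarrow> \<exists>v\<in>V. v \<bullet> w = c" and c: "c1 < c2"
  shows "1 \<le> hausdorff_dim V"
  unfolding hausdorff_dim_def
proof (rule INF_greatest, rule ccontr)
  fix s assume "s \<in> {s. 0 < s \<and> hausdorff_measure s V = 0}" and "\<not> 1 \<le> ereal s"
  then have s: "0 < s" "s < 1" "hausdorff_measure s V = 0" by (simp_all add: one_ereal_def)
  have "w \<noteq> 0"
  proof
    assume "w = 0"
    then show False using V[of c1] V[of c2] c by auto
  qed
  then have w: "0 < 2 * norm w" by simp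
  have "ennreal ((c2 - c1) / (2 * norm w)) \<le> hausdorff_content s 1 V"
    unfolding hausdorff_content_def
  proof (rule INF_greatest)
    fix U assume "U \<in> {U :: nat \<Rightarrow> 'a set. V \<subseteq> (\<Union>i. U i) \<and> (\<forall>i. bounded (U i) \<and> diameter (U i) \<le> 1)}"
    then have U: "V \<subseteq> (\<Union>i. U i)" "\<forall>i. bounded (U i) \<and> diameter (U i) \<le> 1" by auto
    have le: "diameter (U i) \<le> diameter (U i) powr s" for i
      using diameter_ge_0[of "U i"] U(2) powr_mono'[of s 1 "diameter (U i)"] s by (cases "diameter (U i) = 0") auto
    have "ennreal (2 * norm w) * ennreal ((c2 - c1) / (2 * norm w)) = ennreal (c2 - c1)"
      using w c by (simp flip: ennreal_mult)
    also have "\<dots> \<le> (\<Sum>i. ennreal (2 * norm w * diameter (U i)))"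
      by (rule projection_length_le[OF V _ U(1)]) (use c U(2) in auto)
    also have "\<dots> \<le> (\<Sum>i. ennreal (2 * norm w) * ennreal (diameter (U i) powr s))"
      using le w by (intro suminf_le) (auto simp flip: ennreal_mult intro!: ennreal_leI mult_left_mono)
    also have "\<dots> = ennreal (2 * norm w) * (\<Sum>i. ennreal (diameter (U i) powr s))" by simp
    finally show "ennreal ((c2 - c1) / (2 * norm w)) \<le> (\<Sum>i. ennreal (diameter (U i) powr s))"
      using w by (subst (asm) ennreal_mult_le_mult_iff) auto
  qed
  also have "\<dots> \<le> hausdorff_measure s V"
    unfolding hausdorff_measure_def by (rule SUP_upper) simp
  finally show False using s(3) c w by (simp add: field_simps ennreal_eq_0_iff)
qed

text \<open>For \<open>s > 1\<close> the dyadic cover of level \<open>k\<close> costs at most a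
  constant times \<open>(k + 1) * \<rho> ^ k\<close> with
  \<open>\<rho> = 2 powr (1 - s) < 1\<close>, which tends to 0.\<close>

lemma hausdorff_dim_le_1:
  assumes V: "V \<subseteq> percolation_set \<omega>" and C: "\<And>k. real (box_count k V) \<le> C * real (Suc k) * 2 ^ k"
  shows "hausdorff_dim V \<le> 1"
proof -
  have "hausdorff_dim V \<le> ereal s" if s: "1 < s" for s
  proof -
    define \<rho> where "\<rho> = 2 powr (1 - s)"
    have \<rho>: "0 < \<rho>" "\<rho> < 1" using s powr_less_mono[of "1 - s" 0 2] by (simp_all add: \<rho>_def)
    have "hausdorff_content s \<delta> V = 0" if \<delta>: "0 < \<delta>" for \<delta>
    proof -
      define b where "b k = C * 2 powr s * (real k * \<rho> ^ k + \<rho> ^ k)" for k :: nat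
      have "(\<lambda>k. C * 2 powr s * (real k * \<rho> ^ k + \<rho> ^ k)) \<longlonglongrightarrow> C * 2 powr s * (0 + 0)"
        using \<rho> by (intro tendsto_intros powser_times_n_limit_0 LIMSEQ_realpow_zero) auto
      then have lim: "b \<longlonglongrightarrow> 0" by (simp add: b_def[abs_def])
      have "hausdorff_content s \<delta> V \<le> ennreal (b k)" if k: "2 / 2 ^ k \<le> \<delta>" for k
      proof -
        obtain U where U: "V \<subseteq> (\<Union>i. U i)" "\<And>i. bounded (U i)" "\<And>i. diameter (U i) \<le> 2 / 2 ^ k"
            "\<And>i. i \<ge> box_count k V \<Longrightarrow> U i = {}"
          by (rule box_cover[OF V]) blast
        have "hausdorff_content s \<delta> V \<le> (\<Sum>i. ennreal (diameter (U i) powr s))"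
          unfolding hausdorff_content_def
          by (rule INF_lower) (use U(1-3) k in \<open>auto intro: order_trans\<close>)
        also have "\<dots> = (\<Sum>i<box_count k V. ennreal (diameter (U i) powr s))"
          using U(4) by (intro suminf_finite) auto
        also have "\<dots> \<le> (\<Sum>i<box_count k V. ennreal ((2 / 2 ^ k) powr s))"
          using U(2,3) diameter_ge_0 s by (intro sum_mono ennreal_leI powr_mono2) auto
        also have "\<dots> = ennreal (real (box_count k V) * (2 / 2 ^ k) powr s)"
          by (simp add: ennreal_mult ennreal_of_nat_eq_real_of_nat)
        also have "\<dots> \<le> ennreal (b k)"
        proof (rule ennreal_leI)
          have eq: "(2 / 2 ^ k) powr s = 2 powr s * \<rho> ^ k / 2 ^ k"
          proof -
            have "\<rho> ^ k / 2 ^ k = 2 powr ((1 - s) * k) / 2 powr k"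
              by (simp add: \<rho>_def powr_realpow powr_powr flip: powr_realpow)
            also have "\<dots> = 2 powr (- s * k)" by (simp add: algebra_simps flip: powr_diff)
            finally have "\<rho> ^ k / 2 ^ k = 2 powr (- s * k)" .
            moreover have "(2 ^ k) powr s = 2 powr (s * k)"
              by (simp add: powr_powr mult.commute flip: powr_realpow)
            then have "(2 / 2 ^ k) powr s = 2 powr s * 2 powr (- s * k)"
              using powr_divide[of 2 "2 ^ k" s] by (simp add: powr_minus_divide)
            ultimately show ?thesis by (simp add: mult.assoc flip: times_divide_eq_right)
          qed
          have "real (box_count k V) * (2 / 2 ^ k) powr s \<le> C * real (Suc k) * 2 ^ k * (2 / 2 ^ k) powr s"
            by (intro mult_right_mono C) simp
          also have "\<dots> = b k" unfolding eq b_def by (simp add: algebra_simps)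
          finally show "real (box_count k V) * (2 / 2 ^ k) powr s \<le> b k" .
        qed
        finally show ?thesis .
      qed
      moreover have "eventually (\<lambda>k. 2 / 2 ^ k \<le> \<delta>) sequentially"
      proof -
        have "(\<lambda>k. 2 * (1 / 2 :: real) ^ k) \<longlonglongrightarrow> 2 * 0" by (intro tendsto_intros LIMSEQ_realpow_zero) auto
        then have "eventually (\<lambda>k. 2 * (1 / 2 :: real) ^ k < \<delta>) sequentially"
          using \<delta> by (intro order_tendstoD) auto
        then show ?thesis by eventually_elim (simp add: power_divide)
      qed
      ultimately have "eventually (\<lambda>k. hausdorff_content s \<delta> V \<le> ennreal (b k)) sequentially"
        by (auto elim: eventually_mono)
      moreover have "(\<lambda>k. ennreal (b k)) \<longlonglongrightarrow> ennreal 0" using lim by (rule tendsto_ennrealI)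
      ultimately have "hausdorff_content s \<delta> V \<le> ennreal 0"
        by (intro tendsto_lowerbound) auto
      then show ?thesis by simp
    qed
    then have "hausdorff_measure s V = 0"
      unfolding hausdorff_measure_def by (intro antisym SUP_least) auto
    then show ?thesis unfolding hausdorff_dim_def using s by (intro INF_lower) auto
  qed
  note * = this
  show ?thesis
  proof (rule ccontr)
    assume "\<not> hausdorff_dim V \<le> 1"
    then obtain r where "1 < ereal r" "ereal r < hausdorff_dim V"
      using ereal_dense2[of 1 "hausdorff_dim V"] by (auto simp: not_le)
    then show False using *[of r] by (simp add: one_ereal_def)
  qed
qed

lemma box_count_ge:
  assumes V: "V \<subseteq> percolation_set \<omega>" "\<And>c. c \<in> {c1..c2} \<Longrightarrow> \<exists>v\<in>V. v \<bullet> w = c" and c: "c1 < c2"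
  shows "(c2 - c1) * 2 ^ k \<le> 4 * norm w * real (box_count k V)"
proof -
  obtain U where U: "V \<subseteq> (\<Union>i. U i)" "\<And>i. bounded (U i)" "\<And>i. diameter (U i) \<le> 2 / 2 ^ k"
      "\<And>i. i \<ge> box_count k V \<Longrightarrow> U i = {}"
    by (rule box_cover[OF V(1)]) blast
  have "ennreal (c2 - c1) \<le> (\<Sum>i. ennreal (2 * norm w * diameter (U i)))"
    by (rule projection_length_le[OF V(2) _ U(1,2)]) (use c in auto)
  also have "\<dots> = (\<Sum>i<box_count k V. ennreal (2 * norm w * diameter (U i)))"
    using U(4) by (intro suminf_finite) auto
  also have "\<dots> \<le> (\<Sum>i<box_count k V. ennreal (2 * norm w * (2 / 2 ^ k)))"
    using U(3) by (intro sum_mono ennreal_leI mult_left_mono) auto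
  also have "\<dots> = ennreal (real (box_count k V) * (2 * norm w * (2 / 2 ^ k)))"
    by (subst sum_ennreal) simp_all
  finally have "c2 - c1 \<le> real (box_count k V) * (2 * norm w * (2 / 2 ^ k))"
    by (subst (asm) ennreal_le_iff) auto
  then show ?thesis by (simp add: field_simps)
qed

text \<open>After division by \<open>k * ln 2\<close>, the constants contribute a multiple of
  \<open>1 / k\<close> and the linear factor contributes \<open>ln k / k\<close>; both vanish in the
  limit.\<close>

lemma has_box_dim_1:
  assumes b: "0 < b" "\<And>k. b * 2 ^ k \<le> real (box_count k V)"
    and C: "\<And>k. real (box_count k V) \<le> C * real (Suc k) * 2 ^ k"
  shows "has_box_dim V 1"
proof -
  define f where "f k = ln (real (box_count k V)) / ln (2 ^ k)" for k
  have "0 < C" using b(1) order_trans[OF b(2)[of 0] C[of 0]] by simp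
  have l2: "0 < ln (2 :: real)" by simp
  have "(\<lambda>k. 1 + ln b / ln 2 * (1 / real k)) \<longlonglongrightarrow> 1 + ln b / ln 2 * 0"
    by (intro tendsto_intros)
  then have lo: "(\<lambda>k. 1 + ln b / ln 2 * (1 / real k)) \<longlonglongrightarrow> 1" by simp
  have "(\<lambda>k. 1 + ln (2 * C) / ln 2 * (1 / real k) + ln (real k) / real k / ln 2) \<longlonglongrightarrow> 1 + ln (2 * C) / ln 2 * 0 + 0 / ln 2"
    by (intro tendsto_intros) auto
  then have hi: "(\<lambda>k. 1 + ln (2 * C) / ln 2 * (1 / real k) + ln (real k) / real k / ln 2) \<longlonglongrightarrow> 1" by simp
  have bounds: "1 + ln b / ln 2 * (1 / real k) \<le> f k"
      "f k \<le> 1 + ln (2 * C) / ln 2 * (1 / real k) + ln (real k) / real k / ln 2" if k: "k \<ge> 1" for k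
  proof -
    have den: "0 < real k * ln 2" using k l2 by simp
    have 0: "0 < b * 2 ^ k" using b(1) by simp
    have "ln (b * 2 ^ k) \<le> ln (real (box_count k V))" using 0 b(2)[of k] by (subst ln_le_cancel_iff) auto
    then have "(ln b + real k * ln 2) / (real k * ln 2) \<le> f k"
      using b(1) den unfolding f_def by (simp add: ln_mult ln_realpow divide_right_mono)
    moreover have "(ln b + real k * ln 2) / (real k * ln 2) = 1 + ln b / ln 2 * (1 / real k)"
      using k l2 by (simp add: field_simps)
    ultimately show "1 + ln b / ln 2 * (1 / real k) \<le> f k" by simp
    have "real (box_count k V) \<le> 2 * C * real k * 2 ^ k"
    proof -
      have "C * real (Suc k) * 2 ^ k \<le> C * (2 * real k) * 2 ^ k"
        using k \<open>0 < C\<close> by (intro mult_right_mono mult_left_mono) auto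
      then show ?thesis using C[of k] by simp
    qed
    then have "ln (real (box_count k V)) \<le> ln (2 * C * real k * 2 ^ k)"
      using 0 b(2)[of k] k \<open>0 < C\<close> by (subst ln_le_cancel_iff) auto
    then have "f k \<le> (ln (2 * C) + ln (real k) + real k * ln 2) / (real k * ln 2)"
      using den k \<open>0 < C\<close> unfolding f_def by (simp add: ln_mult ln_realpow divide_right_mono)
    moreover have "(ln (2 * C) + ln (real k) + real k * ln 2) / (real k * ln 2)
        = 1 + ln (2 * C) / ln 2 * (1 / real k) + ln (real k) / real k / ln 2"
      using k l2 by (simp add: field_simps)
    ultimately show "f k \<le> 1 + ln (2 * C) / ln 2 * (1 / real k) + ln (real k) / real k / ln 2" by simp
  qed
  have "f \<longlonglongrightarrow> 1"
    by (rule tendsto_sandwich[OF _ _ lo hi])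
      (use bounds in \<open>auto simp: eventually_sequentially intro!: exI[of _ 1]\<close>)
  then have "(\<lambda>k. ereal (f k)) \<longlonglongrightarrow> 1" by (simp add: one_ereal_def)
  then have "liminf (\<lambda>k. ereal (f k)) = 1" "limsup (\<lambda>k. ereal (f k)) = 1"
    by (auto intro: lim_imp_Liminf lim_imp_Limsup)
  then show ?thesis
    by (simp add: has_box_dim_def lower_box_dim_def upper_box_dim_def f_def)
qed

section \<open>Visible parts\<close>

text \<open>A line \<open>l\<close> of direction \<open>w\<close> has normal \<open>rot w\<close>.
  Projection onto \<open>l\<close> moves points along \<open>rot w\<close>, and the lines orthogonal
  to \<open>l\<close> are the level sets of \<open>\<lambda>z. z \<bullet> w\<close>.\<close>

definition rot :: "real \<times> real \<Rightarrow> real \<times> real" where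
  "rot w = (- snd w, fst w)"

lemma rot_orthogonal: "rot w \<bullet> w = 0" "w \<bullet> rot w = 0"
  by (simp_all add: rot_def inner_prod_def)

lemma rot_nonzero: "w \<noteq> 0 \<Longrightarrow> rot w \<bullet> rot w > 0"
  by (simp add: rot_def inner_prod_def prod_eq_iff sum_squares_gt_zero_iff add.commute)

lemma orthogonal_imp_rot:
  assumes "w \<noteq> 0" "v \<bullet> w = 0"
  shows "v = ((v \<bullet> rot w) / (rot w \<bullet> rot w)) *\<^sub>R rot w"
proof -
  obtain a b x y where w: "w = (a, b)" and v: "v = (x, y)" by fastforce
  have pos: "b * b + a * a \<noteq> 0" using assms(1) by (auto simp: w sum_squares_eq_zero_iff prod_eq_iff)
  have 0: "x * a + y * b = 0" using assms(2) by (simp add: w v)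
  have "x * (b * b + a * a) = (- (x * b) + y * a) * - b" "y * (b * b + a * a) = (- (x * b) + y * a) * a"
    using 0 by algebra+
  then show ?thesis using pos by (simp add: rot_def w v field_simps)
qed

text \<open>A normal vector of \<open>l\<close> is scaled so that the lines orthogonal to
  \<open>l\<close> are either horizontal or of the form x = \<alpha> y + \<beta>.\<close>

lemma is_line_obtain:
  fixes l :: "(real \<times> real) set"
  assumes "is_line l"
  obtains w d where "w = (0, 1) \<or> (\<exists>\<alpha>. w = (1, - \<alpha>))" "l = {z. z \<bullet> rot w = d}"
proof -
  have "aff_dim l = DIM(real \<times> real) - 1" "affine hull l = l"
    using assms by (auto simp: is_line_def)
  then obtain a b where ab: "a \<noteq> 0" "l = {x. a \<bullet> x = b}"
    unfolding aff_dim_eq_hyperplane by metis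
  obtain a1 a2 where a: "a = (a1, a2)" by fastforce
  show ?thesis
  proof (cases "a2 = 0")
    case True
    then have "a1 \<noteq> 0" using ab a by (simp add: prod_eq_iff)
    then have "l = {z. z \<bullet> rot (0, 1) = - (b / a1)}"
      using True by (auto simp: ab a rot_def field_simps)
    then show ?thesis using that[of "(0, 1)"] by blast
  next
    case False
    then have "l = {z. z \<bullet> rot (1, - (a1 / a2)) = b / a2}"
      by (auto simp: ab a rot_def field_simps)
    then show ?thesis using that[of "(1, - (a1 / a2))"] by blast
  qed
qed

lemma orth_proj_hyperplane:
  assumes "w \<noteq> 0"
  shows "orth_proj {z. z \<bullet> rot w = d} a = a + ((d - a \<bullet> rot w) / (rot w \<bullet> rot w)) *\<^sub>R rot w"
proof (rule orth_proj_eqI)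
  have pos: "rot w \<bullet> rot w \<noteq> 0" using rot_nonzero[OF assms] by simp
  show *: "a + ((d - a \<bullet> rot w) / (rot w \<bullet> rot w)) *\<^sub>R rot w \<in> {z. z \<bullet> rot w = d}"
    using pos by (simp add: inner_add_left)
  fix c assume "c \<in> {z. z \<bullet> rot w = d}"
  then show "orthogonal (a - (a + ((d - a \<bullet> rot w) / (rot w \<bullet> rot w)) *\<^sub>R rot w))
      (c - (a + ((d - a \<bullet> rot w) / (rot w \<bullet> rot w)) *\<^sub>R rot w))"
    using * by (simp add: orthogonal_def inner_diff_right inner_commute)
qed

text \<open>The points seen from the side of the line to which \<open>n\<close> points. Points of
  \<open>E\<close> across the line do not block, hence the guard
  \<open>d \<le> b \<bullet> n\<close>; using both \<open>n\<close> and \<open>- n\<close> covers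
  lines that separate parts of \<open>E\<close>.\<close>

definition visible_side :: "real \<times> real \<Rightarrow> real \<times> real \<Rightarrow> real \<Rightarrow> (real \<times> real) set \<Rightarrow> (real \<times> real) set" where
  "visible_side w n d E = {a\<in>E. d < a \<bullet> n \<and> (\<forall>b\<in>E. b \<bullet> w = a \<bullet> w \<longrightarrow> d \<le> b \<bullet> n \<longrightarrow> a \<bullet> n \<le> b \<bullet> n)}"

lemma segment_to_hyperplane:
  assumes w: "w \<noteq> 0" and b: "b \<bullet> w = a \<bullet> w"
    and between: "0 \<le> u" "u \<le> 1" "b \<bullet> rot w = a \<bullet> rot w + u * (d - a \<bullet> rot w)"
  shows "b \<in> closed_segment a (orth_proj {z. z \<bullet> rot w = d} a)"
proof -
  have "b - a = (((b - a) \<bullet> rot w) / (rot w \<bullet> rot w)) *\<^sub>R rot w"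
    by (rule orthogonal_imp_rot[OF w]) (simp add: inner_diff_left b)
  then have "b - a = ((u * (d - a \<bullet> rot w)) / (rot w \<bullet> rot w)) *\<^sub>R rot w"
    by (simp add: inner_diff_left between(3))
  then have "b = a + u *\<^sub>R ((d - a \<bullet> rot w) / (rot w \<bullet> rot w)) *\<^sub>R rot w" by (simp add: algebra_simps)
  then have "b = (1 - u) *\<^sub>R a + u *\<^sub>R orth_proj {z. z \<bullet> rot w = d} a"
    unfolding orth_proj_hyperplane[OF w] by (simp add: algebra_simps)
  then show ?thesis unfolding in_segment using between by blast
qed

lemma visible_part_subset:
  assumes w: "w \<noteq> 0" and disj: "{z. z \<bullet> rot w = d} \<inter> E = {}"
  shows "visible_part {z. z \<bullet> rot w = d} E
    \<subseteq> visible_side w (rot w) d E \<union> visible_side w (- rot w) (- d) E"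
proof
  fix a assume "a \<in> visible_part {z. z \<bullet> rot w = d} E"
  then have a: "a \<in> E" "closed_segment a (orth_proj {z. z \<bullet> rot w = d} a) \<inter> E = {a}"
    by (auto simp: visible_part_def)
  have ne: "a \<bullet> rot w \<noteq> d" using a(1) disj by blast
  have "b \<bullet> rot w = a \<bullet> rot w"
    if b: "b \<in> E" "b \<bullet> w = a \<bullet> w" and u: "0 \<le> u" "u \<le> 1" "b \<bullet> rot w = a \<bullet> rot w + u * (d - a \<bullet> rot w)" for b u
  proof -
    have "b = a" using segment_to_hyperplane[OF w b(2) u] b(1) a(2) by blast
    then show ?thesis by simp
  qed
  note * = this
  show "a \<in> visible_side w (rot w) d E \<union> visible_side w (- rot w) (- d) E"
  proof (cases "d < a \<bullet> rot w")
    case True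
    have "a \<bullet> rot w \<le> b \<bullet> rot w" if b: "b \<in> E" "b \<bullet> w = a \<bullet> w" "d \<le> b \<bullet> rot w" for b
    proof (rule ccontr)
      assume lt: "\<not> a \<bullet> rot w \<le> b \<bullet> rot w"
      have "b \<bullet> rot w = a \<bullet> rot w"
        by (rule *[OF b(1,2), of "(a \<bullet> rot w - b \<bullet> rot w) / (a \<bullet> rot w - d)"])
          (use True lt b(3) in \<open>auto simp: field_simps\<close>)
      then show False using lt by simp
    qed
    then show ?thesis using True a(1) by (simp add: visible_side_def)
  next
    case False
    then have lt: "a \<bullet> rot w < d" using ne by simp
    have "b \<bullet> rot w \<le> a \<bullet> rot w" if b: "b \<in> E" "b \<bullet> w = a \<bullet> w" "b \<bullet> rot w \<le> d" for b
    proof (rule ccontr)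
      assume gt: "\<not> b \<bullet> rot w \<le> a \<bullet> rot w"
      have "b \<bullet> rot w = a \<bullet> rot w"
        by (rule *[OF b(1,2), of "(b \<bullet> rot w - a \<bullet> rot w) / (d - a \<bullet> rot w)"])
          (use lt gt b(3) in \<open>auto simp: field_simps\<close>)
      then show False using gt by simp
    qed
    then show ?thesis using lt a(1) by (simp add: visible_side_def)
  qed
qed

text \<open>By compactness, the line through \<open>z\<close> orthogonal to \<open>l\<close> carries
  a point of \<open>E\<close> nearest to \<open>l\<close>, and no other point of \<open>E\<close>
  can lie between it and \<open>l\<close>.\<close>

lemma visible_part_projection:
  assumes w: "w \<noteq> 0" and E: "compact E" and disj: "{z. z \<bullet> rot w = d} \<inter> E = {}" and z: "z \<in> E"
  shows "\<exists>a\<in>visible_part {z. z \<bullet> rot w = d} E. a \<bullet> w = z \<bullet> w"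
proof -
  define K where "K = E \<inter> {b. b \<bullet> w = z \<bullet> w}"
  have "compact K" unfolding K_def
    by (intro compact_Int_closed E closed_Collect_eq continuous_intros)
  moreover have "K \<noteq> {}" using z by (auto simp: K_def)
  moreover have "continuous_on K (\<lambda>b. \<bar>b \<bullet> rot w - d\<bar>)" by (intro continuous_intros)
  ultimately obtain a where a: "a \<in> K" "\<And>b. b \<in> K \<Longrightarrow> \<bar>a \<bullet> rot w - d\<bar> \<le> \<bar>b \<bullet> rot w - d\<bar>"
    using continuous_attains_inf[of K "\<lambda>b. \<bar>b \<bullet> rot w - d\<bar>"] by metis
  have aE: "a \<in> E" "a \<bullet> w = z \<bullet> w" using a(1) by (auto simp: K_def)
  have ne: "a \<bullet> rot w - d \<noteq> 0" using aE(1) disj by auto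
  have pos: "rot w \<bullet> rot w \<noteq> 0" using rot_nonzero[OF w] by simp
  have "b = a" if b: "b \<in> E" "b \<in> closed_segment a (orth_proj {z. z \<bullet> rot w = d} a)" for b
  proof -
    obtain u where u: "0 \<le> u" "u \<le> 1" "b = (1 - u) *\<^sub>R a + u *\<^sub>R orth_proj {z. z \<bullet> rot w = d} a"
      using b(2) unfolding in_segment by blast
    define \<tau> where "\<tau> = (d - a \<bullet> rot w) / (rot w \<bullet> rot w)"
    have b': "b = a + (u * \<tau>) *\<^sub>R rot w"
      unfolding u(3) orth_proj_hyperplane[OF w] \<tau>_def[symmetric] by (simp add: algebra_simps)
    have "b \<in> K" using b(1) aE(2) by (simp add: K_def b' inner_add_left rot_orthogonal)
    moreover have "\<tau> * (rot w \<bullet> rot w) = d - a \<bullet> rot w" using pos by (simp add: \<tau>_def)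
    then have "b \<bullet> rot w = a \<bullet> rot w + u * (d - a \<bullet> rot w)"
      by (simp add: b' inner_add_left mult.assoc)
    then have "b \<bullet> rot w - d = (1 - u) * (a \<bullet> rot w - d)" by (simp add: algebra_simps)
    ultimately have "\<bar>a \<bullet> rot w - d\<bar> \<le> (1 - u) * \<bar>a \<bullet> rot w - d\<bar>"
      using a(2)[of b] u by (simp add: abs_mult)
    then have "u * \<bar>a \<bullet> rot w - d\<bar> \<le> 0" by (simp add: algebra_simps)
    then have "u = 0" using u(1) ne by (simp add: mult_le_0_iff)
    then show "b = a" by (simp add: b')
  qed
  then have "a \<in> visible_part {z. z \<bullet> rot w = d} E"
    using aE(1) by (auto simp: visible_part_def)
  then show ?thesis using aE(2) by blast
qed

section \<open>Families of lines that are hit simultaneously\<close>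

subsection \<open>Lines parallel to an axis\<close>

definition axis_lines :: "real \<times> real \<Rightarrow> ((real \<times> real) \<times> real) set" where
  "axis_lines w = {w} \<times> {0..1}"

text \<open>\<open>sel\<close> picks the coordinate that is constant along the line. The chord is a
  full side or nothing. A line along a common edge is counted in both adjacent squares, so
  subdivision can only increase the total.\<close>

definition axis_chord :: "(int \<times> int \<Rightarrow> int) \<Rightarrow> real \<Rightarrow> nat \<Rightarrow> int \<times> int \<Rightarrow> real" where
  "axis_chord sel t n q = (if of_int (sel q) \<le> 2 ^ n * t \<and> 2 ^ n * t \<le> of_int (sel q) + 1 then 1 / 2 ^ n else 0)"

lemma axis_chord_children:
  assumes "sel = fst \<or> sel = snd"
  shows "axis_chord sel t n q \<le> sum (axis_chord sel t (Suc n)) (children {q})"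
proof -
  obtain i j where q: "q = (i, j)" by fastforce
  define h x :: real where "h = 1 / 2 ^ Suc n" and "x = 2 ^ n * t"
  have h: "1 / 2 ^ n = 2 * h" "0 \<le> h" and x: "2 ^ Suc n * t = 2 * x" by (simp_all add: h_def x_def)
  have child: "axis_chord sel t (Suc n) r = (if of_int (sel r) \<le> 2 * x \<and> 2 * x \<le> of_int (sel r) + 1 then h else 0)" for r
    unfolding axis_chord_def x h_def ..
  have parent: "axis_chord sel t n q = (if of_int (sel q) \<le> x \<and> x \<le> of_int (sel q) + 1 then 2 * h else 0)"
    unfolding axis_chord_def x_def h(1) ..
  show ?thesis
    unfolding parent unfolding q children_single using assms h(2) by (auto simp: child)
qed

text \<open>A dyadic \<open>t\<close> of level \<open>n\<close> is kept, any other \<open>t\<close>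
  is replaced by the midpoint of its cell of level \<open>n\<close>; neither changes its position
  relative to grid points of level at most \<open>n\<close>. As \<open>axis_chord\<close> is
  discontinuous in \<open>t\<close>, mere closeness of the sample would not do.\<close>

lemma dyadic_sample:
  fixes t :: real
  obtains x :: int where "\<And>m a. m \<le> n \<Longrightarrow> of_int a \<le> 2 ^ m * t \<longleftrightarrow> of_int a \<le> 2 ^ m * (of_int x / 2 ^ Suc n :: real)"
    "\<And>m a. m \<le> n \<Longrightarrow> 2 ^ m * t \<le> of_int a \<longleftrightarrow> 2 ^ m * (of_int x / 2 ^ Suc n :: real) \<le> of_int a"
    "t \<in> {0..1} \<Longrightarrow> x \<in> {0..2 ^ Suc n}"
proof -
  define y where "y = 2 ^ n * t"
  define f where "f = \<lfloor>y\<rfloor>"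
  define x where "x = (if of_int f = y then 2 * f else 2 * f + 1)"
  have f: "of_int f \<le> y" "y < of_int f + 1" by (simp_all add: f_def)
  have x: "of_int b \<le> y \<longleftrightarrow> of_int b \<le> of_int x / (2 :: real)" "y \<le> of_int b \<longleftrightarrow> of_int x / 2 \<le> (of_int b :: real)" for b :: int
  proof -
    have "of_int b \<le> y \<longleftrightarrow> b \<le> f" unfolding f_def by (simp add: le_floor_iff)
    moreover have "b \<le> f \<longleftrightarrow> 2 * b \<le> x" by (auto simp: x_def)
    moreover have "2 * b \<le> x \<longleftrightarrow> of_int b \<le> of_int x / (2 :: real)"
      by (simp add: field_simps flip: of_int_le_iff[where 'a = real])
    ultimately show "of_int b \<le> y \<longleftrightarrow> of_int b \<le> of_int x / (2 :: real)" by simp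
    have "y \<le> of_int b \<longleftrightarrow> x \<le> 2 * b"
    proof (cases "of_int f = y")
      case True
      then show ?thesis by (auto simp: x_def simp flip: True)
    next
      case False
      then have "of_int f < y" using f by simp
      then have "y \<le> of_int b \<longleftrightarrow> f < b" using f by linarith
      then show ?thesis using False by (auto simp: x_def)
    qed
    also have "\<dots> \<longleftrightarrow> of_int x / 2 \<le> (of_int b :: real)"
      by (simp add: field_simps flip: of_int_le_iff[where 'a = real])
    finally show "y \<le> of_int b \<longleftrightarrow> of_int x / 2 \<le> (of_int b :: real)" .
  qed
  have sc: "of_int a \<le> 2 ^ m * s \<longleftrightarrow> of_int (a * 2 ^ (n - m)) \<le> 2 ^ n * s"
      "2 ^ m * s \<le> of_int a \<longleftrightarrow> 2 ^ n * s \<le> of_int (a * 2 ^ (n - m))"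
    if "m \<le> n" for m a and s :: real
  proof -
    have "2 ^ n = 2 ^ m * (2 :: real) ^ (n - m)" using that by (simp flip: power_add)
    then show "of_int a \<le> 2 ^ m * s \<longleftrightarrow> of_int (a * 2 ^ (n - m)) \<le> 2 ^ n * s"
      "2 ^ m * s \<le> of_int a \<longleftrightarrow> 2 ^ n * s \<le> of_int (a * 2 ^ (n - m))"
      using mult_le_cancel_right_pos[of "2 ^ (n - m)" "of_int a" "2 ^ m * s"]
        mult_le_cancel_right_pos[of "2 ^ (n - m)" "2 ^ m * s" "of_int a"] by (simp_all add: mult_ac)
  qed
  have half: "2 ^ n * (of_int x / 2 ^ Suc n) = of_int x / (2 :: real)" by simp
  show ?thesis
  proof (rule that[of x])
    fix m a assume m: "m \<le> n"
    show "of_int a \<le> 2 ^ m * t \<longleftrightarrow> of_int a \<le> 2 ^ m * (of_int x / 2 ^ Suc n :: real)"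
      "2 ^ m * t \<le> of_int a \<longleftrightarrow> 2 ^ m * (of_int x / 2 ^ Suc n :: real) \<le> of_int a"
      unfolding sc[OF m] half using x[of "a * 2 ^ (n - m)"] by (simp_all only: y_def)
  next
    assume "t \<in> {0..1}"
    then have "of_int 0 \<le> y" "y \<le> of_int (2 ^ n)" by (auto simp: y_def mult_le_cancel_left1)
    then have "of_int 0 \<le> of_int x / (2 :: real)" "of_int x / (2 :: real) \<le> of_int (2 ^ n)" using x by blast+
    then have "0 \<le> (of_int x :: real)" "(of_int x :: real) \<le> of_int (2 ^ Suc n)" by simp_all
    then show "x \<in> {0..2 ^ Suc n}" unfolding of_int_le_iff of_int_0_le_iff by simp
  qed
qed

lemma prob_hits_axis_lines:
  assumes p: "1 / 2 < p" "p < 1" and w: "w = (1, 0) \<or> w = (0, 1)"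
  shows "0 < measure (percolation_measure p) (hits (axis_lines w))"
proof -
  interpret prob_space "percolation_measure p" by (rule prob_space_percolation_measure)
  define sel :: "int \<times> int \<Rightarrow> int" where "sel = (if w = (1, 0) then fst else snd)"
  define T where "T n = (\<lambda>x :: int. of_int x / (2 :: real) ^ Suc n) ` {0..2 ^ Suc n}" for n
  have T: "finite (T n)" "card (T n) \<le> 2 ^ Suc n + 1" for n
    using card_image_le[of "{0..2 ^ Suc n :: int}" "\<lambda>x. of_int x / (2 :: real) ^ Suc n"]
    by (simp_all add: T_def nat_add_distrib nat_power_eq nat_mult_distrib)
  interpret chord_family p "{0..1}" "axis_chord sel" T 1 3 2
  proof
    fix t :: real and n q
    show "axis_chord sel t n q \<le> sum (axis_chord sel t (Suc n)) (children {q})"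
      by (rule axis_chord_children) (simp add: sel_def)
    show "1 \<le> axis_chord sel t 0 (0, 0)" if "t \<in> {0..1}"
      using that by (simp add: axis_chord_def sel_def)
    have "real (card (T n)) \<le> real (2 ^ Suc n + 1)" using T(2) by (simp only: of_nat_le_iff)
    also have "\<dots> \<le> 3 * 2 ^ n" by simp
    finally show "real (card (T n)) \<le> 3 * 2 ^ n" .
    show "\<exists>t'\<in>T n. \<forall>m\<le>n. \<forall>q\<in>grid m. \<bar>axis_chord sel t m q - axis_chord sel t' m q\<bar> \<le> 1 / 16 ^ n"
      if t: "t \<in> {0..1}"
    proof -
      obtain x where x: "\<And>m a. m \<le> n \<Longrightarrow> of_int a \<le> 2 ^ m * t \<longleftrightarrow> of_int a \<le> 2 ^ m * (of_int x / 2 ^ Suc n :: real)"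
        "\<And>m a. m \<le> n \<Longrightarrow> 2 ^ m * t \<le> of_int a \<longleftrightarrow> 2 ^ m * (of_int x / 2 ^ Suc n :: real) \<le> of_int a"
        "x \<in> {0..2 ^ Suc n}"
        using dyadic_sample[of n t] t by metis
      have "axis_chord sel t m q = axis_chord sel (of_int x / 2 ^ Suc n) m q" if "m \<le> n" for m q
        unfolding axis_chord_def using x(1)[OF that, of "sel q"] x(2)[OF that, of "sel q + 1"] by simp
      then show ?thesis unfolding T_def using x(3) by (intro bexI[OF _ imageI[OF x(3)]]) auto
    qed
  qed (use p T in \<open>auto simp: axis_chord_def\<close>)
  have "{\<omega>. \<forall>n. \<forall>t\<in>{0..1}. \<exists>q\<in>chosen \<omega> n. 0 < axis_chord sel t n q} \<subseteq> hits (axis_lines w)"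
  proof -
    have "\<exists>z\<in>dyadic_square n q. z \<bullet> w = t" if "0 < axis_chord sel t n q" for n q t
    proof -
      obtain i j where q: "q = (i, j)" by fastforce
      have "of_int (sel q) \<le> 2 ^ n * t \<and> 2 ^ n * t \<le> of_int (sel q) + 1"
        using that by (auto simp: axis_chord_def split: if_splits)
      note t = this
      show ?thesis
      proof (cases "w = (1, 0)")
        case True
        then have "(t, of_int j / 2 ^ n) \<in> dyadic_square n q"
          using t unfolding q mem_dyadic_square by (simp add: sel_def)
        then show ?thesis by (rule bexI[rotated]) (simp add: True)
      next
        case False
        then have w: "w = (0, 1)" using w by simp
        then have "(of_int i / 2 ^ n, t) \<in> dyadic_square n q"
          using t unfolding q mem_dyadic_square by (simp add: sel_def)
        then show ?thesis by (rule bexI[rotated]) (simp add: w)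
      qed
    qed
    then show ?thesis unfolding hits_eq axis_lines_def by fastforce
  qed
  from finite_measure_mono[OF this sets_hits] show ?thesis using prob_hit_pos by linarith
qed

subsection \<open>Slanted lines\<close>

text \<open>The pair \<open>((1, - \<alpha>), \<beta>)\<close> encodes the line \<open>x = \<alpha> y + \<beta>\<close>. For \<open>0 \<le> y \<le> 1\<close> its abscissa ranges
  between \<open>min \<beta> (\<alpha> + \<beta>)\<close> and \<open>max \<beta> (\<alpha> + \<beta>)\<close>.\<close>

definition central :: "real \<Rightarrow> real \<Rightarrow> real \<Rightarrow> bool" where
  "central \<delta> \<alpha> \<beta> \<longleftrightarrow> min \<beta> (\<alpha> + \<beta>) \<le> 1 - \<delta> \<and> \<delta> \<le> max \<beta> (\<alpha> + \<beta>)"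

definition slopes :: "nat \<Rightarrow> real set" where
  "slopes N = {\<alpha>. 1 / real N \<le> \<bar>\<alpha>\<bar> \<and> \<bar>\<alpha>\<bar> \<le> real N}"

definition slanted_lines :: "nat \<Rightarrow> real \<Rightarrow> ((real \<times> real) \<times> real) set" where
  "slanted_lines N \<delta> = {((1, - \<alpha>), \<beta>) | \<alpha> \<beta>. \<alpha> \<in> slopes N \<and> central \<delta> \<alpha> \<beta>}"

text \<open>The length of the intersection of the intervals [a, b] and [c, d].\<close>

definition overlap :: "real \<Rightarrow> real \<Rightarrow> real \<Rightarrow> real \<Rightarrow> real" where
  "overlap a b c d = max 0 (min b d - max a c)"

lemma overlap_split:
  "a \<le> m \<Longrightarrow> m \<le> b \<Longrightarrow> overlap a b c d \<le> overlap a m c d + overlap m b c d"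
  "c \<le> m \<Longrightarrow> m \<le> d \<Longrightarrow> overlap a b c d \<le> overlap a b c m + overlap a b m d"
  unfolding overlap_def by (simp_all add: min_def max_def)

lemma overlap_le: "a \<le> b \<Longrightarrow> overlap a b c d \<le> b - a"
  by (simp add: overlap_def)

lemma overlap_approx:
  assumes "\<bar>c - c'\<bar> \<le> e" "\<bar>d - d'\<bar> \<le> e"
  shows "\<bar>overlap a b c d - overlap a b c' d'\<bar> \<le> 2 * e"
proof -
  have "\<bar>min b d - min b d'\<bar> \<le> e" "\<bar>max a c - max a c'\<bar> \<le> e"
    using assms by (auto simp: min_def max_def)
  moreover have "\<bar>max 0 u - max 0 v\<bar> \<le> \<bar>u - v\<bar>" for u v :: real by (simp add: max_def)
  from this[of "min b d - max a c" "min b d' - max a c'"]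
  have "\<bar>overlap a b c d - overlap a b c' d'\<bar> \<le> \<bar>(min b d - max a c) - (min b d' - max a c')\<bar>"
    unfolding overlap_def .
  ultimately show ?thesis by linarith
qed

text \<open>The chord is measured by its projection to the x-axis: the overlap of the x-range of the
  square with the x-range of the line over the y-range of the square. This is at most the side
  length and Lipschitz in the line parameters. The \<open>min\<close> and \<open>max\<close> account
  for either sign of the slope.\<close>

definition slanted_chord :: "real \<times> real \<Rightarrow> nat \<Rightarrow> int \<times> int \<Rightarrow> real" where
  "slanted_chord = (\<lambda>(\<alpha>, \<beta>) n (i, j). overlap (of_int i / 2 ^ n) (of_int (i + 1) / 2 ^ n)
     (min (\<alpha> * (of_int j / 2 ^ n) + \<beta>) (\<alpha> * (of_int (j + 1) / 2 ^ n) + \<beta>))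
     (max (\<alpha> * (of_int j / 2 ^ n) + \<beta>) (\<alpha> * (of_int (j + 1) / 2 ^ n) + \<beta>)))"

text \<open>Halving the square cuts both of its ranges at their midpoints. The line is monotone in
  y, so its x-range is cut as well, and overlaps are subadditive under either cut.\<close>

lemma slanted_chord_children:
  "slanted_chord l n q \<le> sum (slanted_chord l (Suc n)) (children {q})"
proof -
  obtain \<alpha> \<beta> i j where l: "l = (\<alpha>, \<beta>)" and q: "q = (i, j)" by (cases l, cases q) auto
  define x where "x m = of_int (2 * i + m) / (2 ^ Suc n :: real)" for m :: int
  define y where "y m = \<alpha> * (of_int (2 * j + m) / (2 ^ Suc n :: real)) + \<beta>" for m :: int
  have x: "x 0 \<le> x 1" "x 1 \<le> x 2" by (simp_all add: x_def field_simps)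
  have y: "y 0 \<le> y 1 \<and> y 1 \<le> y 2 \<or> y 2 \<le> y 1 \<and> y 1 \<le> y 0"
  proof -
    have "y 1 = (y 0 + y 2) / 2" by (simp add: y_def field_simps)
    then show ?thesis by (cases "y 0 \<le> y 2") auto
  qed
  have half: "of_int (2 * a) / 2 ^ Suc n = (of_int a / 2 ^ n :: real)" for a by simp
  have "slanted_chord l n q = overlap (x 0) (x 2) (min (y 0) (y 2)) (max (y 0) (y 2))"
    using half[of "i + 1"] half[of "j + 1"]
    by (simp add: slanted_chord_def l q x_def y_def algebra_simps)
  also have "\<dots> \<le> overlap (x 0) (x 1) (min (y 0) (y 2)) (max (y 0) (y 2))
      + overlap (x 1) (x 2) (min (y 0) (y 2)) (max (y 0) (y 2))"
    using x by (rule overlap_split)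
  also have "\<dots> \<le> (overlap (x 0) (x 1) (min (y 0) (y 1)) (max (y 0) (y 1))
        + overlap (x 0) (x 1) (min (y 1) (y 2)) (max (y 1) (y 2)))
      + (overlap (x 1) (x 2) (min (y 0) (y 1)) (max (y 0) (y 1))
        + overlap (x 1) (x 2) (min (y 1) (y 2)) (max (y 1) (y 2)))"
  proof -
    have "overlap a b (min (y 0) (y 2)) (max (y 0) (y 2))
      \<le> overlap a b (min (y 0) (y 1)) (max (y 0) (y 1)) + overlap a b (min (y 1) (y 2)) (max (y 1) (y 2))" for a b
      using y overlap_split(2)[of "y 0" "y 1" "y 2" a b] overlap_split(2)[of "y 2" "y 1" "y 0" a b]
      by (auto simp: min_def max_def)
    then show ?thesis by (intro add_mono)
  qed
  also have "\<dots> = sum (slanted_chord l (Suc n)) (children {q})"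
    by (simp add: q children_single slanted_chord_def l x_def y_def algebra_simps)
  finally show ?thesis .
qed

lemma slanted_chord_pos:
  assumes "0 < slanted_chord (\<alpha>, \<beta>) n q"
  shows "\<exists>z\<in>dyadic_square n q. z \<bullet> (1, - \<alpha>) = \<beta>"
proof -
  obtain i j where q: "q = (i, j)" by fastforce
  define f where "f y = \<alpha> * y + \<beta>" for y
  define y1 y2 x1 x2 :: real where "y1 = of_int j / 2 ^ n" and "y2 = of_int (j + 1) / 2 ^ n"
    and "x1 = of_int i / 2 ^ n" and "x2 = of_int (i + 1) / 2 ^ n"
  have y12: "y1 \<le> y2" by (simp add: y1_def y2_def divide_right_mono)
  have "0 < overlap x1 x2 (min (f y1) (f y2)) (max (f y1) (f y2))"
    using assms by (simp add: slanted_chord_def q f_def y1_def y2_def x1_def x2_def)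
  then have lt: "max x1 (min (f y1) (f y2)) < min x2 (max (f y1) (f y2))"
    by (simp only: overlap_def less_max_iff_disj less_irrefl simp_thms diff_gt_0_iff_gt)
  define x where "x = max x1 (min (f y1) (f y2))"
  have x: "x1 \<le> x" "x \<le> x2" "min (f y1) (f y2) \<le> x" "x \<le> max (f y1) (f y2)"
    using lt by (auto simp: x_def)
  have "\<exists>y. y1 \<le> y \<and> y \<le> y2 \<and> f y = x"
  proof (cases "f y1 \<le> x")
    case True
    show ?thesis
    proof (cases "x \<le> f y2")
      case True': True
      have "\<forall>y. y1 \<le> y \<and> y \<le> y2 \<longrightarrow> isCont f y" unfolding f_def by (intro allI impI continuous_intros)
      then show ?thesis using IVT[of f y1 x y2] True True' y12 by blast
    next
      case False
      then have "f y1 = x" using True x(3,4) by (auto simp: min_def max_def split: if_splits)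
      then show ?thesis using y12 by blast
    qed
  next
    case False
    have "\<forall>y. y1 \<le> y \<and> y \<le> y2 \<longrightarrow> isCont f y" unfolding f_def by (intro allI impI continuous_intros)
    then show ?thesis using IVT2[of f y2 x y1] False x(3,4) y12
      by (auto simp: min_def max_def split: if_splits)
  qed
  then obtain y where "y1 \<le> y" "y \<le> y2" "f y = x" by blast
  then show ?thesis
    using x by (intro bexI[of _ "(x, y)"]) (auto simp: q dyadic_square_def f_def y1_def y2_def x1_def x2_def)
qed

text \<open>At ordinates between 0 and 1 the abscissas of the two lines differ by at most
  \<open>2 * e\<close>, and both ends of the overlap can move by that much.\<close>

lemma slanted_chord_approx:
  assumes q: "q \<in> grid m" and e: "\<bar>\<alpha> - \<alpha>'\<bar> \<le> e" "\<bar>\<beta> - \<beta>'\<bar> \<le> e"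
  shows "\<bar>slanted_chord (\<alpha>, \<beta>) m q - slanted_chord (\<alpha>', \<beta>') m q\<bar> \<le> 4 * e"
proof -
  obtain i j where ij: "q = (i, j)" by fastforce
  have j: "0 \<le> j" "j + 1 \<le> 2 ^ m" using q by (auto simp: ij grid_def)
  then have "(of_int (j + 1) :: real) \<le> of_int (2 ^ m)" by (simp only: of_int_le_iff)
  then have y: "0 \<le> of_int j / (2 ^ m :: real)" "of_int j / (2 ^ m :: real) \<le> 1"
    "0 \<le> of_int (j + 1) / (2 ^ m :: real)" "of_int (j + 1) / (2 ^ m :: real) \<le> 1"
    using j by (auto simp: field_simps)
  have *: "\<bar>(\<alpha> * y + \<beta>) - (\<alpha>' * y + \<beta>')\<bar> \<le> 2 * e" if "0 \<le> y" "y \<le> 1" for y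
  proof -
    have "\<bar>(\<alpha> - \<alpha>') * y\<bar> \<le> e * 1" unfolding abs_mult using that e by (intro mult_mono) auto
    moreover have "(\<alpha> * y + \<beta>) - (\<alpha>' * y + \<beta>') = (\<alpha> - \<alpha>') * y + (\<beta> - \<beta>')" by (simp add: algebra_simps)
    ultimately show ?thesis using e by linarith
  qed
  have mm: "\<bar>min a b - min a' b'\<bar> \<le> h" "\<bar>max a b - max a' b'\<bar> \<le> h"
    if "\<bar>a - a'\<bar> \<le> h" "\<bar>b - b'\<bar> \<le> h" for a b a' b' h :: real
    using that by (auto simp: min_def max_def)
  show ?thesis
    using overlap_approx[OF mm[OF *[OF y(1,2)] *[OF y(3,4)]]]
    by (simp add: slanted_chord_def ij)
qed

lemma prob_hits_slanted_lines:
  assumes p: "1 / 2 < p" "p < 1" and N: "N \<ge> 1" and \<delta>: "0 < \<delta>" "\<delta> \<le> 1"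
  shows "0 < measure (percolation_measure p) (hits (slanted_lines N \<delta>))"
proof -
  interpret prob_space "percolation_measure p" by (rule prob_space_percolation_measure)
  define \<Lambda> where "\<Lambda> = {(\<alpha>, \<beta>). \<alpha> \<in> slopes N \<and> central \<delta> \<alpha> \<beta>}"
  \<comment> \<open>Slope and offset are bounded by \<open>N + 1\<close>, and rounding down stays
    within \<open>N + 2\<close>. The mesh is one power of 16 finer than \<open>approx\<close> asks
    for, to absorb the factor 4 of \<open>slanted_chord_approx\<close>.\<close>
  define J :: "nat \<Rightarrow> int set" where "J n = {- ((int N + 2) * 16 ^ Suc n)..(int N + 2) * 16 ^ Suc n}" for n
  define h where "h n = (\<lambda>(a, b). (of_int a / (16 :: real) ^ Suc n, of_int b / (16 :: real) ^ Suc n))" for n :: nat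
  define T where "T n = h n ` (J n \<times> J n)" for n :: nat
  \<comment> \<open>Inside the unit square a central line has horizontal extent at least
    \<open>\<delta>\<close> if its x-range is cut by a vertical side, and otherwise its full range
    \<open>\<bar>\<alpha>\<bar> \<ge> 1 / real N\<close>.\<close>
  define g0 where "g0 = min \<delta> (1 / real N)"
  interpret chord_family p \<Lambda> slanted_chord T g0 "(256 * (2 * real N + 5)\<^sup>2)" 256
  proof
    fix l n q
    show "0 \<le> slanted_chord l n q" by (auto simp: slanted_chord_def overlap_def split: prod.splits)
    show "slanted_chord l n q \<le> 1 / 2 ^ n"
    proof -
      have "overlap (of_int i / 2 ^ n) (of_int (i + 1) / 2 ^ n) c d \<le> 1 / 2 ^ n" for i c d
        using overlap_le[of "of_int i / 2 ^ n" "of_int (i + 1) / 2 ^ n" c d]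
        by (simp add: divide_right_mono add_divide_distrib)
      then show ?thesis by (auto simp: slanted_chord_def split: prod.splits)
    qed
    show "g0 \<le> slanted_chord l 0 (0, 0)" if lin: "l \<in> \<Lambda>"
    proof -
      obtain \<alpha> \<beta> where l: "l = (\<alpha>, \<beta>)" "1 / real N \<le> \<bar>\<alpha>\<bar>" "central \<delta> \<alpha> \<beta>"
        using lin by (auto simp: \<Lambda>_def slopes_def)
      then show ?thesis
        using \<delta> by (auto simp: slanted_chord_def overlap_def g0_def central_def min_def max_def split: if_splits)
    qed
    show "finite (T n)" by (simp add: T_def J_def)
    show "real (card (T n)) \<le> 256 * (2 * real N + 5)\<^sup>2 * 256 ^ n"
    proof -
      have cJ: "real (card (J n)) \<le> (2 * real N + 5) * 16 ^ Suc n"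
      proof -
        have "card (J n) = nat (2 * ((int N + 2) * 16 ^ Suc n) + 1)" by (simp add: J_def mult_2)
        then have "real (card (J n)) = 2 * ((real N + 2) * 16 ^ Suc n) + 1" by simp
        also have "\<dots> \<le> 2 * ((real N + 2) * 16 ^ Suc n) + 16 ^ Suc n"
          using one_le_power[of "16 :: real" "Suc n"] by simp
        finally show ?thesis by (simp add: algebra_simps)
      qed
      have "card (T n) \<le> card (J n \<times> J n)" unfolding T_def by (rule card_image_le) (simp add: J_def)
      then have "real (card (T n)) \<le> real (card (J n)) * real (card (J n))"
        unfolding card_cartesian_product of_nat_mult[symmetric] by (simp only: of_nat_le_iff)
      also have "\<dots> \<le> ((2 * real N + 5) * 16 ^ Suc n) * ((2 * real N + 5) * 16 ^ Suc n)"
        using cJ by (intro mult_mono) auto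
      also have "\<dots> = 256 * (2 * real N + 5)\<^sup>2 * 256 ^ n"
        using power_mult_distrib[of "16 :: real" 16 n] by (simp add: power2_eq_square mult_ac)
      finally show ?thesis .
    qed
    show "\<exists>l'\<in>T n. \<forall>m\<le>n. \<forall>q\<in>grid m. \<bar>slanted_chord l m q - slanted_chord l' m q\<bar> \<le> 1 / 16 ^ n"
      if lin: "l \<in> \<Lambda>"
    proof -
      obtain \<alpha> \<beta> where l: "l = (\<alpha>, \<beta>)" "\<bar>\<alpha>\<bar> \<le> real N" "central \<delta> \<alpha> \<beta>"
        using lin by (auto simp: \<Lambda>_def slopes_def)
      have \<beta>: "\<bar>\<beta>\<bar> \<le> real N + 1"
        using l(2,3) \<delta> by (auto simp: central_def min_def max_def split: if_splits)
      have fl: "\<lfloor>x * 16 ^ Suc n\<rfloor> \<in> J n" "\<bar>x - of_int \<lfloor>x * 16 ^ Suc n\<rfloor> / 16 ^ Suc n\<bar> \<le> 1 / 16 ^ Suc n"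
        if "\<bar>x\<bar> \<le> real N + 1" for x
      proof -
        define s :: real where "s = 16 ^ Suc n"
        have s: "1 \<le> s" unfolding s_def by (rule one_le_power) simp
        define f where "f = \<lfloor>x * s\<rfloor>"
        have f: "of_int f \<le> x * s" "x * s < of_int f + 1" by (simp_all add: f_def)
        have "x * s \<le> (real N + 1) * s" "- (real N + 1) * s \<le> x * s"
          using that s by (auto intro!: mult_right_mono simp: abs_le_iff)
        then have "of_int f \<le> (real N + 2) * s" "- ((real N + 2) * s) \<le> of_int f"
          using f s by (simp_all add: algebra_simps)
        then have "(of_int f :: real) \<le> of_int ((int N + 2) * 16 ^ Suc n)" "of_int (- ((int N + 2) * 16 ^ Suc n)) \<le> (of_int f :: real)"
          by (simp_all add: s_def)
        then show "\<lfloor>x * 16 ^ Suc n\<rfloor> \<in> J n"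
          unfolding of_int_le_iff by (simp only: J_def f_def s_def atLeastAtMost_iff)
        have "\<bar>x * s - of_int f\<bar> \<le> 1" using f by simp
        then have "\<bar>x * s - of_int f\<bar> / s \<le> 1 / s" using s by (intro divide_right_mono) auto
        moreover have "\<bar>x * s - of_int f\<bar> / s = \<bar>x - of_int f / s\<bar>"
        proof -
          have "\<bar>x * s - of_int f\<bar> / s = \<bar>(x * s - of_int f) / s\<bar>" using s by simp
          also have "(x * s - of_int f) / s = x - of_int f / s" using s by (simp add: diff_divide_distrib)
          finally show ?thesis .
        qed
        ultimately show "\<bar>x - of_int \<lfloor>x * 16 ^ Suc n\<rfloor> / 16 ^ Suc n\<bar> \<le> 1 / 16 ^ Suc n"
          unfolding f_def s_def by linarith
      qed
      define l' where "l' = h n (\<lfloor>\<alpha> * 16 ^ Suc n\<rfloor>, \<lfloor>\<beta> * 16 ^ Suc n\<rfloor>)"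
      have a1: "\<bar>\<alpha>\<bar> \<le> real N + 1" using l(2) by simp
      have "l' \<in> T n" unfolding l'_def T_def using fl(1)[OF a1] fl(1)[OF \<beta>] by (intro imageI) simp
      moreover have "\<bar>slanted_chord l m q - slanted_chord l' m q\<bar> \<le> 1 / 16 ^ n" if "q \<in> grid m" for m q
      proof -
        have "\<bar>slanted_chord l m q - slanted_chord l' m q\<bar> \<le> 4 * (1 / 16 ^ Suc n)"
          unfolding l l'_def h_def case_prod_conv
          by (rule slanted_chord_approx[OF that fl(2)[OF a1] fl(2)[OF \<beta>]])
        also have "\<dots> \<le> 1 / 16 ^ n" by (simp add: field_simps)
        finally show ?thesis .
      qed
      ultimately show ?thesis by blast
    qed
  qed (use p \<delta> N slanted_chord_children in \<open>auto simp: g0_def\<close>)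
  have "{\<omega>. \<forall>n. \<forall>l\<in>\<Lambda>. \<exists>q\<in>chosen \<omega> n. 0 < slanted_chord l n q} \<subseteq> hits (slanted_lines N \<delta>)"
    unfolding hits_eq slanted_lines_def \<Lambda>_def using slanted_chord_pos by fastforce
  from finite_measure_mono[OF this sets_hits] show ?thesis using prob_hit_pos by linarith
qed

section \<open>Counting the visible squares\<close>

text \<open>A line disjoint from a compact set has positive distance from it. Small squares meeting
  the set then lie on one side of the line, so \<open>strip_count\<close> can pass from one point of
  a blocking square to another.\<close>

lemma eventually_dyadic_squares_miss:
  assumes E: "compact E" and disj: "{z. z \<bullet> n = d} \<inter> E = {}"
  shows "\<forall>\<^sub>F k in sequentially. \<forall>q. dyadic_square k q \<inter> E \<noteq> {} \<longrightarrow> dyadic_square k q \<inter> {z. z \<bullet> n = d} = {}"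
proof -
  have "closed {z. z \<bullet> n = d}" by (intro closed_Collect_eq continuous_intros)
  then obtain e where e: "0 < e" "\<And>x y. x \<in> E \<Longrightarrow> y \<in> {z. z \<bullet> n = d} \<Longrightarrow> e \<le> dist x y"
    using separate_compact_closed[OF E] disj by (metis Int_commute)
  have "(\<lambda>k. 2 * (1 / 2 :: real) ^ k) \<longlonglongrightarrow> 2 * 0" by (intro tendsto_intros LIMSEQ_realpow_zero) auto
  then have "\<forall>\<^sub>F k in sequentially. 2 * (1 / 2 :: real) ^ k < e"
    using e by (intro order_tendstoD) auto
  then show ?thesis
  proof eventually_elim
    case (elim k)
    then have k: "2 / 2 ^ k < e" by (simp add: power_divide)
    show ?case
    proof (intro allI impI equals0I)
      fix q y assume "dyadic_square k q \<inter> E \<noteq> {}" and y: "y \<in> dyadic_square k q \<inter> {z. z \<bullet> n = d}"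
      then obtain x where x: "x \<in> dyadic_square k q" "x \<in> E" by blast
      have "e \<le> dist x y" using e(2)[OF x(2)] y by blast
      also have "\<dots> \<le> 2 / 2 ^ k" using x y by (intro dist_dyadic_square_le) auto
      finally show False using k by simp
    qed
  qed
qed

lemma convex_dyadic_square: "convex (dyadic_square k q)"
  by (cases q) (auto simp: dyadic_square_def intro: convex_Times)

lemma dyadic_square_one_side:
  assumes "dyadic_square k q \<inter> {z. z \<bullet> n = d} = {}" "x \<in> dyadic_square k q" "y \<in> dyadic_square k q" "d < x \<bullet> n"
  shows "d < y \<bullet> n"
proof (rule ccontr)
  assume "\<not> d < y \<bullet> n"
  then have "\<exists>z\<in>dyadic_square k q. n \<bullet> z = d"
    using connected_ivt_hyperplane[OF convex_connected[OF convex_dyadic_square] assms(3,2), of n d] assms(4)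
    by (simp add: inner_commute)
  then show False using assms(1) by (auto simp: inner_commute)
qed

text \<open>Let \<open>j0\<close> and \<open>j1\<close> be the first and last positions of visible
  squares in the strip. A blocking square in between lies beyond a visible point, hence on the same
  side of the line, and would hide the visible point of the last square. The margin
  \<open>j0 + 1\<close> gives the weak inequality needed in front, \<open>j1 - 2\<close> the strict
  one needed behind. The remaining positions \<open>j0\<close>, \<open>j1 - 1\<close> and
  \<open>j1\<close> hold at most \<open>\<tau>\<close> squares each.\<close>

lemma strip_count:
  fixes \<omega> k w n d defines "E \<equiv> percolation_set \<omega>"
  defines "A \<equiv> \<lambda>B I. {q\<in>chosen \<omega> k \<inter> B. \<exists>a\<in>visible_side w n d E \<inter> dyadic_square k q. a \<bullet> w \<in> I}"
  assumes order: "\<And>a b. a \<bullet> w = b \<bullet> w \<Longrightarrow> a \<bullet> n \<le> b \<bullet> n \<longleftrightarrow> a \<bullet> u \<le> b \<bullet> u"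
    and pos: "\<And>q z. z \<in> dyadic_square k q \<Longrightarrow> of_int (ord q) \<le> 2 ^ k * (z \<bullet> u) \<and> 2 ^ k * (z \<bullet> u) \<le> of_int (ord q) + 1"
    and miss: "\<And>q. dyadic_square k q \<inter> E \<noteq> {} \<Longrightarrow> dyadic_square k q \<inter> {z. z \<bullet> n = d} = {}"
    and fam: "\<And>q c. q \<in> B \<Longrightarrow> c \<in> I \<Longrightarrow> (w, rescale k q w c) \<in> \<Lambda>"
    and hit: "\<And>j0 j1. j0 \<in> ord ` B \<Longrightarrow> j1 \<in> ord ` B \<Longrightarrow> m \<le> card (chosen \<omega> k \<inter> {q\<in>B. j0 + 1 \<le> ord q \<and> ord q \<le> j1 - 2})
      \<Longrightarrow> \<exists>q\<in>chosen \<omega> k \<inter> {q\<in>B. j0 + 1 \<le> ord q \<and> ord q \<le> j1 - 2}. shift k q \<omega> \<in> hits \<Lambda>"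
    and ties: "\<And>i. card {q\<in>B. ord q = i} \<le> \<tau>" and fin: "finite B"
  shows "card (A B I) \<le> m + 3 * \<tau>"
proof (cases "A B I = {}")
  case False
  define S where "S = A B I"
  have S: "finite S" "S \<noteq> {}" "S \<subseteq> chosen \<omega> k \<inter> B" using False fin by (auto simp: S_def A_def)
  define j0 j1 where "j0 = Min (ord ` S)" and "j1 = Max (ord ` S)"
  have j: "j0 \<in> ord ` S" "j1 \<in> ord ` S" unfolding j0_def j1_def using S by (auto intro: Min_in Max_in)
  define B' where "B' = {q\<in>B. j0 + 1 \<le> ord q \<and> ord q \<le> j1 - 2}"
  have "\<not> m \<le> card (chosen \<omega> k \<inter> B')"
  proof
    assume "m \<le> card (chosen \<omega> k \<inter> B')"
    then obtain q where q: "q \<in> chosen \<omega> k" "q \<in> B" "j0 + 1 \<le> ord q" "ord q \<le> j1 - 2" "shift k q \<omega> \<in> hits \<Lambda>"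
      using hit[of j0 j1] j S(3) unfolding B'_def by blast
    obtain q0 q1 where q01: "q0 \<in> S" "ord q0 = j0" "q1 \<in> S" "ord q1 = j1" using j by auto
    obtain a0 where a0: "a0 \<in> visible_side w n d E" "a0 \<in> dyadic_square k q0" "a0 \<bullet> w \<in> I"
      using q01(1) by (auto simp: S_def A_def)
    obtain a1 where a1: "a1 \<in> visible_side w n d E" "a1 \<in> dyadic_square k q1" "a1 \<bullet> w \<in> I"
      using q01(3) by (auto simp: S_def A_def)
    obtain b0 where b0: "b0 \<in> E" "b0 \<in> dyadic_square k q" "b0 \<bullet> w = a0 \<bullet> w"
      using hits_shiftD[OF q(1,5) fam[OF q(2) a0(3)]] by (auto simp: E_def)
    obtain b1 where b1: "b1 \<in> E" "b1 \<in> dyadic_square k q" "b1 \<bullet> w = a1 \<bullet> w"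
      using hits_shiftD[OF q(1,5) fam[OF q(2) a1(3)]] by (auto simp: E_def)
    have "2 ^ k * (a0 \<bullet> u) \<le> 2 ^ k * (b0 \<bullet> u)"
    proof -
      have "2 ^ k * (a0 \<bullet> u) \<le> of_int (ord q0 + 1)" using pos[OF a0(2)] by simp
      also have "(of_int (ord q0 + 1) :: real) \<le> of_int (ord q)" using q(3) q01(2) by (simp only: of_int_le_iff)
      also have "\<dots> \<le> 2 ^ k * (b0 \<bullet> u)" using pos[OF b0(2)] by simp
      finally show ?thesis .
    qed
    then have "a0 \<bullet> n \<le> b0 \<bullet> n" using order[of a0 b0] b0(3) by simp
    then have "d < b0 \<bullet> n" using a0(1) by (auto simp: visible_side_def)
    then have "d < b1 \<bullet> n"
      using dyadic_square_one_side[OF miss[of q] b0(2) b1(2)] b0 by blast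
    then have "a1 \<bullet> n \<le> b1 \<bullet> n" using a1(1) b1 by (auto simp: visible_side_def)
    then have "a1 \<bullet> u \<le> b1 \<bullet> u" using order[of a1 b1] b1(3) by simp
    then have "2 ^ k * (a1 \<bullet> u) \<le> 2 ^ k * (b1 \<bullet> u)" by simp
    also have "\<dots> \<le> of_int (ord q + 1)" using pos[OF b1(2)] by simp
    also have "of_int (ord q + 1) < (of_int (ord q1) :: real)" using q(4) q01(4) by (simp only: of_int_less_iff)
    also have "of_int (ord q1) \<le> 2 ^ k * (a1 \<bullet> u)" using pos[OF a1(2)] by simp
    finally show False by simp
  qed
  then have less: "card (chosen \<omega> k \<inter> B') \<le> m" by simp
  have "S \<subseteq> (chosen \<omega> k \<inter> B') \<union> {q\<in>B. ord q = j0} \<union> {q\<in>B. ord q = j1 - 1} \<union> {q\<in>B. ord q = j1}"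
  proof
    fix q assume "q \<in> S"
    moreover then have "j0 \<le> ord q" "ord q \<le> j1" using S by (auto simp: j0_def j1_def)
    then have "ord q = j0 \<or> ord q = j1 \<or> ord q = j1 - 1 \<or> j0 + 1 \<le> ord q \<and> ord q \<le> j1 - 2" by linarith
    ultimately show "q \<in> (chosen \<omega> k \<inter> B') \<union> {q\<in>B. ord q = j0} \<union> {q\<in>B. ord q = j1 - 1} \<union> {q\<in>B. ord q = j1}"
      using S(3) by (auto simp: B'_def)
  qed
  then have "card S \<le> card ((chosen \<omega> k \<inter> B') \<union> {q\<in>B. ord q = j0} \<union> {q\<in>B. ord q = j1 - 1} \<union> {q\<in>B. ord q = j1})"
    by (rule card_mono[rotated]) (use fin in \<open>auto simp: B'_def\<close>)
  also have "\<dots> \<le> card (chosen \<omega> k \<inter> B') + card {q\<in>B. ord q = j0} + card {q\<in>B. ord q = j1 - 1} + card {q\<in>B. ord q = j1}"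
    by (meson add_le_mono1 card_Un_le le_trans)
  also have "\<dots> \<le> m + 3 * \<tau>" using less ties[of j0] ties[of "j1 - 1"] ties[of j1] by simp
  finally show ?thesis by (simp add: S_def)
qed simp

text \<open>
  For a direction \<open>w\<close> in \<open>\<W>\<close>, the lines \<open>z \<bullet> w = c\<close> are grouped into strips \<open>x \<in> Xw k w\<close> with
  offsets \<open>c \<in> I k x w\<close>. Every square of \<open>B k x\<close> is crossed by all lines of the strip in such a
  way that the rescaled lines belong to \<open>\<Lambda>\<close>. The squares are ordered along the strip by \<open>ord\<close>.
\<close>

locale line_class =
  fixes p :: real and \<Lambda> :: "((real \<times> real) \<times> real) set" and \<W> :: "(real \<times> real) set"
    and s :: real and u :: "real \<times> real" and ord :: "int \<times> int \<Rightarrow> int"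
    and X :: "nat \<Rightarrow> 'x set" and Xw :: "nat \<Rightarrow> real \<times> real \<Rightarrow> 'x set"
    and B :: "nat \<Rightarrow> 'x \<Rightarrow> (int \<times> int) set" and I :: "nat \<Rightarrow> 'x \<Rightarrow> real \<times> real \<Rightarrow> real set"
    and C R C1 :: real and \<tau> :: nat
  assumes hits_pos: "0 < measure (percolation_measure p) (hits \<Lambda>)"
    and order: "w \<in> \<W> \<Longrightarrow> a \<bullet> w = b \<bullet> w \<Longrightarrow> a \<bullet> (s *\<^sub>R rot w) \<le> b \<bullet> (s *\<^sub>R rot w) \<longleftrightarrow> a \<bullet> u \<le> b \<bullet> u"
    and ord: "z \<in> dyadic_square k q \<Longrightarrow> of_int (ord q) \<le> 2 ^ k * (z \<bullet> u) \<and> 2 ^ k * (z \<bullet> u) \<le> of_int (ord q) + 1"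
    and ord_range: "q \<in> grid k \<Longrightarrow> ord q \<in> {- (2 ^ k)..2 ^ k}"
    and X: "finite (X k)" "real (card (X k)) \<le> C * R ^ k" "0 < R"
    and Xw: "w \<in> \<W> \<Longrightarrow> Xw k w \<subseteq> X k" "w \<in> \<W> \<Longrightarrow> real (card (Xw k w)) \<le> C1 * 2 ^ k"
    and B_grid: "B k x \<subseteq> grid k"
    and fam: "w \<in> \<W> \<Longrightarrow> x \<in> Xw k w \<Longrightarrow> q \<in> B k x \<Longrightarrow> c \<in> I k x w \<Longrightarrow> (w, rescale k q w c) \<in> \<Lambda>"
    and ties: "card {q\<in>B k x. ord q = i} \<le> \<tau>"
begin

definition strip_visible :: "construction \<Rightarrow> nat \<Rightarrow> real \<times> real \<Rightarrow> real \<Rightarrow> (int \<times> int) set" where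
  "strip_visible \<omega> k w d = {q\<in>chosen \<omega> k. \<exists>x\<in>Xw k w. q \<in> B k x \<and>
     (\<exists>a\<in>visible_side w (s *\<^sub>R rot w) d (percolation_set \<omega>) \<inter> dyadic_square k q. a \<bullet> w \<in> I k x w)}"

lemma AE_card_strip_visible:
  "\<exists>C'. AE \<omega> in percolation_measure p. \<forall>w\<in>\<W>. \<forall>d.
     {z. z \<bullet> (s *\<^sub>R rot w) = d} \<inter> percolation_set \<omega> = {} \<longrightarrow>
     (\<forall>\<^sub>F k in sequentially. real (card (strip_visible \<omega> k w d)) \<le> C' * real (Suc k) * 2 ^ k)"
proof -
  define J :: "nat \<Rightarrow> int set" where "J k = {- (2 ^ k)..2 ^ k}" for k
  \<comment> \<open>\<open>strip_count\<close> asks for a blocking square only between two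
    positions. The at most \<open>9 * 4 ^ k\<close> windows of a strip therefore serve all values of
    \<open>d\<close> at once, although \<open>d\<close> ranges over an uncountable set.\<close>
  define h where "h k = (\<lambda>(x, j0, j1). {q\<in>B k x. j0 + 1 \<le> ord q \<and> ord q \<le> j1 - 2})" for k
  define \<B> where "\<B> k = h k ` (X k \<times> J k \<times> J k)" for k
  have finB: "finite (\<B> k)" for k using X(1) by (simp add: \<B>_def J_def)
  have cB: "real (card (\<B> k)) \<le> (9 * C) * (4 * R) ^ k" for k
  proof -
    have cJ: "real (card (J k)) \<le> 3 * 2 ^ k"
    proof -
      have "int (card (J k)) = 2 * 2 ^ k + 1" by (simp add: J_def)
      then have "real_of_int (int (card (J k))) = real_of_int (2 * 2 ^ k + 1)" by (simp only:)
      then have "real (card (J k)) = 2 * 2 ^ k + 1" by simp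
      also have "\<dots> \<le> 3 * 2 ^ k" using one_le_power[of "2 :: real" k] by simp
      finally show ?thesis .
    qed
    have "card (\<B> k) \<le> card (X k \<times> J k \<times> J k)"
      unfolding \<B>_def using X(1) by (intro card_image_le) (simp add: J_def)
    then have "real (card (\<B> k)) \<le> real (card (X k)) * (real (card (J k)) * real (card (J k)))"
      unfolding card_cartesian_product of_nat_mult[symmetric] by (simp only: of_nat_le_iff)
    also have "\<dots> \<le> (C * R ^ k) * ((3 * 2 ^ k) * (3 * 2 ^ k))"
      using X(2)[of k] cJ order_trans[OF of_nat_0_le_iff X(2)[of k]] by (intro mult_mono) auto
    also have "\<dots> = (9 * C) * (4 * R) ^ k"
      using power_mult_distrib[of "2 :: real" 2 k] by (simp add: power_mult_distrib mult_ac)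
    finally show ?thesis .
  qed
  have R4: "0 < 4 * R" using X(3) by simp
  obtain D where D: "AE \<omega> in percolation_measure p. \<forall>\<^sub>F k in sequentially. \<forall>A\<in>\<B> k.
    D * k \<le> card (chosen \<omega> k \<inter> A) \<longrightarrow> (\<exists>q\<in>chosen \<omega> k \<inter> A. shift k q \<omega> \<in> hits \<Lambda>)"
    using AE_eventually_hits[OF hits_pos finB cB R4] by blast
  have "AE \<omega> in percolation_measure p. \<forall>w\<in>\<W>. \<forall>d.
     {z. z \<bullet> (s *\<^sub>R rot w) = d} \<inter> percolation_set \<omega> = {} \<longrightarrow>
     (\<forall>\<^sub>F k in sequentially. real (card (strip_visible \<omega> k w d)) \<le> (C1 * real (D + 3 * \<tau>)) * real (Suc k) * 2 ^ k)"
    using D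
  proof eventually_elim
    case (elim \<omega>)
    show ?case
    proof (intro ballI allI impI)
      fix w d assume w: "w \<in> \<W>" and disj: "{z. z \<bullet> (s *\<^sub>R rot w) = d} \<inter> percolation_set \<omega> = {}"
      show "\<forall>\<^sub>F k in sequentially. real (card (strip_visible \<omega> k w d)) \<le> (C1 * real (D + 3 * \<tau>)) * real (Suc k) * 2 ^ k"
        using elim eventually_dyadic_squares_miss[OF compact_percolation_set disj]
      proof eventually_elim
        case (elim k)
        define A where "A x = {q\<in>chosen \<omega> k \<inter> B k x.
          \<exists>a\<in>visible_side w (s *\<^sub>R rot w) d (percolation_set \<omega>) \<inter> dyadic_square k q. a \<bullet> w \<in> I k x w}" for x
        have finX: "finite (Xw k w)" using Xw(1)[OF w] X(1) finite_subset by blast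
        have A: "card (A x) \<le> D * k + 3 * \<tau>" if x: "x \<in> Xw k w" for x
          unfolding A_def
        proof (rule strip_count[where u = u and ord = ord and \<Lambda> = \<Lambda>])
          fix j0 j1 assume j: "j0 \<in> ord ` B k x" "j1 \<in> ord ` B k x"
            and le: "D * k \<le> card (chosen \<omega> k \<inter> {q\<in>B k x. j0 + 1 \<le> ord q \<and> ord q \<le> j1 - 2})"
          have "j0 \<in> J k" "j1 \<in> J k" using j subsetD[OF B_grid] ord_range unfolding J_def by blast+
          then have "{q\<in>B k x. j0 + 1 \<le> ord q \<and> ord q \<le> j1 - 2} \<in> \<B> k"
            unfolding \<B>_def using x Xw(1)[OF w] by (intro image_eqI[of _ _ "(x, j0, j1)"]) (auto simp: h_def)
          then show "\<exists>q\<in>chosen \<omega> k \<inter> {q\<in>B k x. j0 + 1 \<le> ord q \<and> ord q \<le> j1 - 2}. shift k q \<omega> \<in> hits \<Lambda>"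
            using elim(1) le by blast
        next
          show "finite (B k x)" by (rule finite_subset[OF B_grid finite_grid])
          show "dyadic_square k q \<inter> {z. z \<bullet> (s *\<^sub>R rot w) = d} = {}"
            if "dyadic_square k q \<inter> percolation_set \<omega> \<noteq> {}" for q
            using elim(2) that by blast
        qed (rule order[OF w] ord fam[OF w x] ties; assumption)+
        have "strip_visible \<omega> k w d \<subseteq> (\<Union>x\<in>Xw k w. A x)"
          by (auto simp: strip_visible_def A_def)
        then have "card (strip_visible \<omega> k w d) \<le> card (\<Union>x\<in>Xw k w. A x)"
          by (rule card_mono[rotated]) (use finX finite_chosen in \<open>auto simp: A_def\<close>)
        also have "\<dots> \<le> (\<Sum>x\<in>Xw k w. card (A x))" by (rule card_UN_le[OF finX])
        also have "\<dots> \<le> card (Xw k w) * (D * k + 3 * \<tau>)"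
          using sum_bounded_above[of "Xw k w" "\<lambda>x. card (A x)"] A by simp
        finally have "real (card (strip_visible \<omega> k w d)) \<le> real (card (Xw k w)) * real (D * k + 3 * \<tau>)"
          by (simp only: of_nat_mult[symmetric] of_nat_le_iff)
        also have "\<dots> \<le> (C1 * 2 ^ k) * real ((D + 3 * \<tau>) * Suc k)"
        proof (intro mult_mono)
          show "real (D * k + 3 * \<tau>) \<le> real ((D + 3 * \<tau>) * Suc k)"
            by (simp only: of_nat_le_iff) (simp add: algebra_simps)
          show "0 \<le> C1 * 2 ^ k" using Xw(2)[OF w, of k] of_nat_0_le_iff order_trans by blast
        qed (use Xw(2)[OF w] in auto)
        also have "\<dots> = (C1 * real (D + 3 * \<tau>)) * real (Suc k) * 2 ^ k"
          by (simp only: of_nat_mult mult_ac)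
        finally show ?case .
      qed
    qed
  qed
  then show ?thesis by blast
qed

end

section \<open>Regular directions, and the axis-parallel case\<close>

lemma eventually_le_imp_bounded:
  fixes x :: "nat \<Rightarrow> real"
  assumes "\<forall>\<^sub>F k in sequentially. x k \<le> C * real (Suc k) * 2 ^ k"
  shows "\<exists>C\<ge>0. \<forall>k. x k \<le> C * real (Suc k) * 2 ^ k"
proof -
  obtain N where N: "\<And>k. k \<ge> N \<Longrightarrow> x k \<le> C * real (Suc k) * 2 ^ k"
    using assms unfolding eventually_sequentially by blast
  define C' where "C' = \<bar>C\<bar> + (\<Sum>k<N. \<bar>x k\<bar>)"
  have S: "0 \<le> (\<Sum>k<N. \<bar>x k\<bar>)" by (intro sum_nonneg) auto
  have "x k \<le> C' * real (Suc k) * 2 ^ k" for k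
  proof (cases "k < N")
    case True
    have "\<bar>x k\<bar> \<le> (\<Sum>k<N. \<bar>x k\<bar>)" using True by (intro member_le_sum) auto
    then have "x k \<le> C'" by (simp add: C'_def)
    moreover have "0 \<le> C'" using S by (simp add: C'_def)
    moreover have "1 \<le> real (Suc k) * 2 ^ k"
      using mult_mono[of 1 "real (Suc k)" 1 "2 ^ k"] by (simp add: one_le_power)
    ultimately have "C' * 1 \<le> C' * (real (Suc k) * 2 ^ k)" by (intro mult_left_mono)
    then show ?thesis using \<open>x k \<le> C'\<close> by (simp add: mult.assoc)
  next
    case False
    have "C \<le> C'" using S abs_ge_self[of C] unfolding C'_def by linarith
    then have "C * real (Suc k) * 2 ^ k \<le> C' * real (Suc k) * 2 ^ k" by (intro mult_right_mono) auto
    moreover have "N \<le> k" using False by simp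
    ultimately show ?thesis using N order_trans by blast
  qed
  moreover have "0 \<le> C'" using S by (simp add: C'_def)
  ultimately show ?thesis by blast
qed

definition side_squares :: "construction \<Rightarrow> nat \<Rightarrow> real \<times> real \<Rightarrow> real \<times> real \<Rightarrow> real \<Rightarrow> (int \<times> int) set" where
  "side_squares \<omega> k w n d = {q\<in>chosen \<omega> k. dyadic_square k q \<inter> visible_side w n d (percolation_set \<omega>) \<noteq> {}}"

text \<open>Both orientations of the normal occur because the visible part splits into two sides.
  The constant may depend on the construction and on the line.\<close>

definition regular :: "construction \<Rightarrow> real \<times> real \<Rightarrow> bool" where
  "regular \<omega> w \<longleftrightarrow> (\<forall>s\<in>{1, - 1}. \<forall>d. {z. z \<bullet> (s *\<^sub>R rot w) = d} \<inter> percolation_set \<omega> = {} \<longrightarrow>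
     (\<exists>C. \<forall>k. real (card (side_squares \<omega> k w (s *\<^sub>R rot w) d)) \<le> C * real (Suc k) * 2 ^ k))"

lemma regular_box_count_le:
  assumes reg: "regular \<omega> w" and w: "w \<noteq> 0" and disj: "{z. z \<bullet> rot w = d} \<inter> percolation_set \<omega> = {}"
  shows "\<exists>C. \<forall>k. real (box_count k (visible_part {z. z \<bullet> rot w = d} (percolation_set \<omega>))) \<le> C * real (Suc k) * 2 ^ k"
proof -
  let ?V = "visible_part {z. z \<bullet> rot w = d} (percolation_set \<omega>)"
  have disj': "{z. z \<bullet> (- 1 *\<^sub>R rot w) = - d} \<inter> percolation_set \<omega> = {}" using disj by simp
  obtain C1 where C1: "\<And>k. real (card (side_squares \<omega> k w (rot w) d)) \<le> C1 * real (Suc k) * 2 ^ k"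
    using reg disj unfolding regular_def by force
  obtain C2 where C2: "\<And>k. real (card (side_squares \<omega> k w (- rot w) (- d))) \<le> C2 * real (Suc k) * 2 ^ k"
    using reg disj' unfolding regular_def by force
  have "real (box_count k ?V) \<le> (9 * (C1 + C2)) * real (Suc k) * 2 ^ k" for k
  proof -
    have "?V \<subseteq> percolation_set \<omega>" by (auto simp: visible_part_def)
    then have "box_count k ?V \<le> 9 * card {q\<in>chosen \<omega> k. dyadic_square k q \<inter> ?V \<noteq> {}}" by (rule box_count_le)
    also have "card {q\<in>chosen \<omega> k. dyadic_square k q \<inter> ?V \<noteq> {}}
      \<le> card (side_squares \<omega> k w (rot w) d \<union> side_squares \<omega> k w (- rot w) (- d))"
      using visible_part_subset[OF w disj] by (intro card_mono) (auto simp: side_squares_def finite_chosen)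
    also have "\<dots> \<le> card (side_squares \<omega> k w (rot w) d) + card (side_squares \<omega> k w (- rot w) (- d))"
      by (rule card_Un_le)
    finally have "real (box_count k ?V) \<le> 9 * (real (card (side_squares \<omega> k w (rot w) d)) + real (card (side_squares \<omega> k w (- rot w) (- d))))"
      by simp
    then show ?thesis using C1[of k] C2[of k] by (simp add: algebra_simps)
  qed
  then show ?thesis by blast
qed

text \<open>Reflection maps the interval [i, i + 1] to [- i - 1, - i], hence the index
  \<open>- i - 1\<close> for the reversed orientation.\<close>

definition index_along :: "real \<Rightarrow> int \<Rightarrow> int" where
  "index_along s i = (if s = 1 then i else - i - 1)"

lemma index_along:
  assumes "s \<in> {1, - 1}" "of_int i \<le> 2 ^ k * x" "2 ^ k * x \<le> of_int i + 1"
  shows "of_int (index_along s i) \<le> 2 ^ k * (s * x) \<and> 2 ^ k * (s * x) \<le> of_int (index_along s i) + (1 :: real)"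
  using assms by (auto simp: index_along_def)

lemma index_along_eq: "index_along s i = j \<longleftrightarrow> i = index_along s j"
  by (auto simp: index_along_def)

lemma index_along_range: "i \<in> {0..<2 ^ k} \<Longrightarrow> index_along s i \<in> {- (2 ^ k)..2 ^ k}"
  by (auto simp: index_along_def)

text \<open>The strips are the columns or rows of the grid. Each line of a strip crosses every
  square of it along a full side, so all squares are within reach of \<open>axis_lines\<close> and
  no corners have to be treated.\<close>

lemma AE_regular_axis:
  assumes p: "1 / 2 < p" "p < 1" and w: "w = (1, 0) \<or> w = (0, 1)"
  shows "AE \<omega> in percolation_measure p. regular \<omega> w"
proof -
  define sel sel' :: "int \<times> int \<Rightarrow> int" where "sel = (if w = (1, 0) then fst else snd)"
    and "sel' = (if w = (1, 0) then snd else fst)"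
  define pr pr' :: "real \<times> real \<Rightarrow> real" where "pr = (if w = (1, 0) then fst else snd)"
    and "pr' = (if w = (1, 0) then snd else fst)"
  \<comment> \<open>The sign comes from \<open>rot (0, 1) = (- 1, 0)\<close>, which reverses the
    orientation of the first axis.\<close>
  define \<sigma> :: real where "\<sigma> = (if w = (1, 0) then 1 else - 1)"
  have prw: "z \<bullet> w = pr z" "z \<bullet> rot w = \<sigma> * pr' z" for z
    using w by (auto simp: pr_def pr'_def \<sigma>_def rot_def inner_prod_def)
  have sq: "of_int (sel q) \<le> 2 ^ k * pr z \<and> 2 ^ k * pr z \<le> of_int (sel q) + 1"
    "of_int (sel' q) \<le> 2 ^ k * pr' z \<and> 2 ^ k * pr' z \<le> of_int (sel' q) + 1" if "z \<in> dyadic_square k q" for k z q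
    using that by (cases z; cases q; simp add: sel_def sel'_def pr_def pr'_def mem_dyadic_square)+
  have resc: "rescale k q w c = 2 ^ k * c - of_int (sel q)" for k q c
    using w by (auto simp: rescale_def sel_def)
  have gr: "sel q \<in> {0..<2 ^ k}" "sel' q \<in> {0..<2 ^ k}" if "q \<in> grid k" for q k
    using that by (auto simp: grid_def sel_def sel'_def)
  have eqI: "q = q'" if "sel q = sel q'" "sel' q = sel' q'" for q q'
    using that by (auto simp: sel_def sel'_def prod_eq_iff split: if_splits)
  define I where "I k x w' = {c. of_int x \<le> 2 ^ k * c \<and> 2 ^ k * c \<le> of_int x + (1 :: real)}" for k and x :: int and w' :: "real \<times> real"
  define B where "B k x = {q\<in>grid k. sel q = x}" for k x
  define X :: "nat \<Rightarrow> int set" where "X k = {0..<2 ^ k}" for k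
  have "AE \<omega> in percolation_measure p. \<forall>d. {z. z \<bullet> (s *\<^sub>R rot w) = d} \<inter> percolation_set \<omega> = {} \<longrightarrow>
     (\<exists>C. \<forall>k. real (card (side_squares \<omega> k w (s *\<^sub>R rot w) d)) \<le> C * real (Suc k) * 2 ^ k)"
    if s: "s \<in> {1, - 1}" for s
  proof -
    have s\<sigma>: "s * \<sigma> \<in> {1, - 1}" using s by (auto simp: \<sigma>_def)
    interpret line_class p "axis_lines w" "{w}" s "s *\<^sub>R rot w" "\<lambda>q. index_along (s * \<sigma>) (sel' q)"
      X "\<lambda>k w'. X k" B I 1 2 1 1
    proof
      show "0 < measure (percolation_measure p) (hits (axis_lines w))" by (rule prob_hits_axis_lines[OF p w])
      fix k :: nat and q :: "int \<times> int"
      show "of_int (index_along (s * \<sigma>) (sel' q)) \<le> 2 ^ k * (z \<bullet> (s *\<^sub>R rot w)) \<and>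
          2 ^ k * (z \<bullet> (s *\<^sub>R rot w)) \<le> of_int (index_along (s * \<sigma>) (sel' q)) + 1"
        if "z \<in> dyadic_square k q" for z
        using index_along[OF s\<sigma>, of "sel' q" k "pr' z"] sq(2)[OF that] by (simp add: prw mult.assoc)
      show "index_along (s * \<sigma>) (sel' q) \<in> {- (2 ^ k)..2 ^ k}" if "q \<in> grid k"
        using index_along_range gr(2)[OF that] by blast
      fix x :: int and c :: real
      show "(w', rescale k q w' c) \<in> axis_lines w" if "w' \<in> {w}" "x \<in> X k" "q \<in> B k x" "c \<in> I k x w'" for w'
        using that by (auto simp: axis_lines_def resc B_def I_def)
      show "card {q \<in> B k x. index_along (s * \<sigma>) (sel' q) = i} \<le> 1" for i
      proof -
        have "finite {q \<in> B k x. index_along (s * \<sigma>) (sel' q) = i}" by (simp add: B_def)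
        then show ?thesis
          unfolding card_le_Suc0_iff_eq[OF \<open>finite _\<close>] One_nat_def
          using eqI by (auto simp: B_def index_along_eq)
      qed
    qed (auto simp: X_def B_def)
    obtain C' where C': "AE \<omega> in percolation_measure p. \<forall>w'\<in>{w}. \<forall>d.
      {z. z \<bullet> (s *\<^sub>R rot w') = d} \<inter> percolation_set \<omega> = {} \<longrightarrow>
      (\<forall>\<^sub>F k in sequentially. real (card (strip_visible \<omega> k w' d)) \<le> C' * real (Suc k) * 2 ^ k)"
      using AE_card_strip_visible by blast
    have sub: "side_squares \<omega> k w (s *\<^sub>R rot w) d \<subseteq> strip_visible \<omega> k w d" for \<omega> k d
    proof
      fix q assume "q \<in> side_squares \<omega> k w (s *\<^sub>R rot w) d"
      then obtain a where q: "q \<in> chosen \<omega> k" and a: "a \<in> visible_side w (s *\<^sub>R rot w) d (percolation_set \<omega>) \<inter> dyadic_square k q"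
        by (auto simp: side_squares_def)
      have g: "q \<in> grid k" using q chosen_subset_grid by blast
      have "a \<bullet> w \<in> I k (sel q) w" using sq(1) a by (auto simp: I_def prw)
      moreover have "sel q \<in> X k" "q \<in> B k (sel q)" using gr(1)[OF g] g by (auto simp: X_def B_def)
      ultimately show "q \<in> strip_visible \<omega> k w d" unfolding strip_visible_def using q a by blast
    qed
    have card: "card (side_squares \<omega> k w (s *\<^sub>R rot w) d) \<le> card (strip_visible \<omega> k w d)" for \<omega> k d
      using sub finite_chosen by (intro card_mono) (auto simp: strip_visible_def)
    show ?thesis
      using C'
    proof eventually_elim
      case (elim \<omega>)
      show ?case
      proof (intro allI impI)
        fix d assume "{z. z \<bullet> (s *\<^sub>R rot w) = d} \<inter> percolation_set \<omega> = {}"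
        then have "\<forall>\<^sub>F k in sequentially. real (card (strip_visible \<omega> k w d)) \<le> C' * real (Suc k) * 2 ^ k"
          using elim by blast
        then obtain C where C: "\<And>k. real (card (strip_visible \<omega> k w d)) \<le> C * real (Suc k) * 2 ^ k"
          using eventually_le_imp_bounded by meson
        have "real (card (side_squares \<omega> k w (s *\<^sub>R rot w) d)) \<le> C * real (Suc k) * 2 ^ k" for k
          using C[of k] card[of \<omega> k d] by (meson of_nat_mono order_trans)
        then show "\<exists>C. \<forall>k. real (card (side_squares \<omega> k w (s *\<^sub>R rot w) d)) \<le> C * real (Suc k) * 2 ^ k" by blast
      qed
    qed
  qed
  from this[of 1] this[of "- 1"] show ?thesis
    by (simp add: regular_def)
qed

subsection \<open>Squares crossed centrally by slanted lines\<close>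

lemma rescale_slanted:
  "rescale k q (1, - \<alpha>) c = 2 ^ k * c - of_int (fst q) + \<alpha> * of_int (snd q)"
  by (simp add: rescale_def)

lemma central_approx:
  assumes "central \<delta> \<alpha> \<beta>" "\<bar>\<alpha> - \<alpha>'\<bar> \<le> e" "\<bar>\<beta> - \<beta>'\<bar> \<le> e'" "e + e' \<le> \<delta> - \<delta>'"
  shows "central \<delta>' \<alpha>' \<beta>'"
  using assms unfolding central_def by (auto simp: min_def max_def split: if_splits)

definition central_squares :: "real \<Rightarrow> construction \<Rightarrow> nat \<Rightarrow> real \<Rightarrow> (real \<times> real) set \<Rightarrow> (int \<times> int) set" where
  "central_squares \<delta> \<omega> k \<alpha> V = {q\<in>chosen \<omega> k. \<exists>a\<in>V \<inter> dyadic_square k q.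
     central \<delta> \<alpha> (rescale k q (1, - \<alpha>) (a \<bullet> (1, - \<alpha>)))}"

lemma dyadic_square_unit:
  assumes "(x, y) \<in> dyadic_square k q" "q \<in> grid k"
  shows "x \<in> {0..1}" "y \<in> {0..1}"
proof -
  have *: "t \<in> {0..1}" if "of_int i \<le> 2 ^ k * t" "2 ^ k * t \<le> of_int i + 1" "i \<in> {0..<2 ^ k}" for i :: int and t :: real
  proof -
    have "(of_int 0 :: real) \<le> of_int i" "(of_int (i + 1) :: real) \<le> of_int (2 ^ k)"
      using that(3) unfolding of_int_le_iff by auto
    then have "0 \<le> (of_int i :: real)" "of_int i + 1 \<le> (2 :: real) ^ k" by simp_all
    then have "2 ^ k * 0 \<le> 2 ^ k * t" "2 ^ k * t \<le> 2 ^ k * 1" using that(1,2) by linarith+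
    then show ?thesis unfolding atLeastAtMost_iff by (subst (asm) (1 2) mult_le_cancel_left_pos) simp_all
  qed
  obtain i j where "q = (i, j)" by fastforce
  then show "x \<in> {0..1}" "y \<in> {0..1}"
    using assms *[of i x] *[of j y] by (auto simp: mem_dyadic_square grid_def)
qed

text \<open>Strips are cells of mesh \<open>1 / M k\<close> in the plane of slopes and offsets.
  Within a cell the slope and the rescaled offset together change by at most
  \<open>3 / (32 * real N)\<close>, which is below \<open>\<delta> / 2\<close>. So a square crossed
  centrally by one line of a strip is crossed by all of them with half the margin.\<close>

lemma AE_card_central_squares:
  assumes p: "1 / 2 < p" "p < 1" and N: "N \<ge> 1" and s: "s \<in> {1, - 1}"
  shows "AE \<omega> in percolation_measure p. \<forall>\<alpha>\<in>slopes N. \<forall>d.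
    {z. z \<bullet> (s *\<^sub>R rot (1, - \<alpha>)) = d} \<inter> percolation_set \<omega> = {} \<longrightarrow>
    (\<exists>C\<ge>0. \<forall>k. real (card (central_squares (1 / (4 * real N)) \<omega> k \<alpha>
      (visible_side (1, - \<alpha>) (s *\<^sub>R rot (1, - \<alpha>)) d (percolation_set \<omega>)))) \<le> C * real (Suc k) * 2 ^ k)"
proof -
  define \<delta> where "\<delta> = 1 / (4 * real N)"
  have \<delta>: "0 < \<delta>" "\<delta> \<le> 1" using N by (simp_all add: \<delta>_def field_simps)
  define M where "M k = 32 * real N * 2 ^ k" for k :: nat
  have M: "0 < M k" for k using N by (simp add: M_def)
  define L where "L k = (int N + 1) * 32 * int N * 2 ^ k" for k :: nat
  have L: "of_int (L k) = (real N + 1) * M k" for k by (simp add: L_def M_def)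
  define K where "K = 2 * (real N + 1) * 32 * real N + 1"
  define J where "J k = {- L k..L k}" for k
  have finJ: "finite (J k)" for k by (simp add: J_def)
  have cJ: "real (card (J k)) \<le> K * 2 ^ k" for k
  proof -
    have "0 \<le> L k" by (simp add: L_def)
    then have "int (card (J k)) = 2 * L k + 1" by (simp add: J_def)
    then have "real_of_int (int (card (J k))) = real_of_int (2 * L k + 1)" by (simp only:)
    then have "real (card (J k)) = 2 * ((real N + 1) * M k) + 1" by (simp add: L)
    also have "\<dots> \<le> 2 * ((real N + 1) * M k) + 2 ^ k" by (simp add: one_le_power)
    also have "\<dots> = K * 2 ^ k" by (simp add: K_def M_def algebra_simps)
    finally show ?thesis .
  qed
  define \<W> where "\<W> = (\<lambda>\<alpha>. (1 :: real, - \<alpha>)) ` slopes N"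
  define X where "X k = J k \<times> J k" for k
  define Xw where "Xw k w = {\<lfloor>- snd w * M k\<rfloor>} \<times> J k" for k and w :: "real \<times> real"
  define I where "I k x w = {c. \<lfloor>c * M k\<rfloor> = snd x}" for k and x :: "int \<times> int" and w :: "real \<times> real"
  define box where "box k x = {(\<alpha>, c). \<alpha> \<in> slopes N \<and> \<lfloor>\<alpha> * M k\<rfloor> = fst x \<and> \<lfloor>c * M k\<rfloor> = snd x}" for k and x :: "int \<times> int"
  \<comment> \<open>For an empty box the universal condition would be vacuous and
    \<open>B k x\<close> the whole grid; requiring a nonempty box keeps the number of ties
    bounded.\<close>
  define B where "B k x = {q\<in>grid k. box k x \<noteq> {} \<and> (\<forall>(\<alpha>, c)\<in>box k x. central (\<delta> / 2) \<alpha> (rescale k q (1, - \<alpha>) c))}" for k x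
  define ord where "ord q = index_along s (snd q)" for q :: "int \<times> int"
  have floor_J: "\<lfloor>t * M k\<rfloor> \<in> J k" if "\<bar>t\<bar> \<le> real N + 1" for t k
  proof -
    have "t \<le> real N + 1" "- (real N + 1) \<le> t" using that by linarith+
    then have "t * M k \<le> (real N + 1) * M k" "- (real N + 1) * M k \<le> t * M k"
      using M[of k] by (intro mult_right_mono; simp)+
    then have "t * M k \<le> of_int (L k)" "of_int (- L k) \<le> t * M k"
      unfolding of_int_minus L by linarith+
    then show ?thesis unfolding J_def by (simp add: le_floor_iff) linarith
  qed
  interpret line_class p "slanted_lines N (\<delta> / 2)" \<W> s "s *\<^sub>R (0, 1)" ord X Xw B I "K\<^sup>2" 4 K "2 * N + 3"
  proof
    show "0 < measure (percolation_measure p) (hits (slanted_lines N (\<delta> / 2)))"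
      using p N \<delta> by (intro prob_hits_slanted_lines) auto
    show "a \<bullet> (s *\<^sub>R rot w) \<le> b \<bullet> (s *\<^sub>R rot w) \<longleftrightarrow> a \<bullet> (s *\<^sub>R (0, 1)) \<le> b \<bullet> (s *\<^sub>R (0, 1))"
      if w: "w \<in> \<W>" and eq: "a \<bullet> w = b \<bullet> w" for w a b
    proof -
      obtain \<alpha> where \<alpha>: "w = (1, - \<alpha>)" using w by (auto simp: \<W>_def)
      \<comment> \<open>Along x = \<alpha> y + \<beta> the normal coordinate \<alpha> x + y grows
        with y at rate \<open>\<alpha>\<^sup>2 + 1\<close>, so rows order the squares of a
        strip.\<close>
      have "fst a - fst b = \<alpha> * (snd a - snd b)" using eq by (simp add: \<alpha> inner_prod_def algebra_simps)
      then have "b \<bullet> (s *\<^sub>R rot w) - a \<bullet> (s *\<^sub>R rot w) = (\<alpha>\<^sup>2 + 1) * (s * snd b - s * snd a)"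
        by (simp add: \<alpha> rot_def inner_prod_def) algebra
      moreover have "0 < \<alpha>\<^sup>2 + 1" by (simp add: add_nonneg_pos)
      ultimately have "0 \<le> b \<bullet> (s *\<^sub>R rot w) - a \<bullet> (s *\<^sub>R rot w) \<longleftrightarrow> 0 \<le> s * snd b - s * snd a"
        by (simp add: zero_le_mult_iff)
      then show ?thesis by (simp add: inner_prod_def mult.commute[of s])
    qed
    fix k :: nat
    show "of_int (ord q) \<le> 2 ^ k * (z \<bullet> (s *\<^sub>R (0, 1))) \<and> 2 ^ k * (z \<bullet> (s *\<^sub>R (0, 1))) \<le> of_int (ord q) + 1"
      if "z \<in> dyadic_square k q" for z q
      using that index_along[OF s, of "snd q" k "snd z"]
      by (cases z; cases q) (simp add: mem_dyadic_square ord_def inner_prod_def mult.commute[of s])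
    show "ord q \<in> {- (2 ^ k)..2 ^ k}" if "q \<in> grid k" for q
      using that index_along_range[of "snd q" k s] by (auto simp: ord_def grid_def)
    show "finite (X k)" by (simp add: X_def finJ)
    show "real (card (X k)) \<le> K\<^sup>2 * 4 ^ k"
    proof -
      have "real (card (X k)) = real (card (J k)) * real (card (J k))" by (simp add: X_def card_cartesian_product)
      also have "\<dots> \<le> (K * 2 ^ k) * (K * 2 ^ k)"
        using cJ[of k] order_trans[OF of_nat_0_le_iff cJ[of k]] by (intro mult_mono) auto
      also have "\<dots> = K\<^sup>2 * 4 ^ k"
        using power_mult_distrib[of "2 :: real" 2 k] by (simp add: power2_eq_square mult_ac)
      finally show ?thesis .
    qed
    show "Xw k w \<subseteq> X k" if "w \<in> \<W>" for w
      using that floor_J by (auto simp: Xw_def X_def \<W>_def slopes_def)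
    show "real (card (Xw k w)) \<le> K * 2 ^ k" for w
      using cJ by (simp add: Xw_def card_cartesian_product)
    fix x :: "int \<times> int"
    show "B k x \<subseteq> grid k" by (auto simp: B_def)
    show "(w, rescale k q w c) \<in> slanted_lines N (\<delta> / 2)"
      if w: "w \<in> \<W>" and x: "x \<in> Xw k w" and q: "q \<in> B k x" and c: "c \<in> I k x w" for w q c
    proof -
      obtain \<alpha> where \<alpha>: "w = (1, - \<alpha>)" "\<alpha> \<in> slopes N" using w by (auto simp: \<W>_def)
      have "(\<alpha>, c) \<in> box k x" using \<alpha> x c by (auto simp: box_def Xw_def I_def)
      then have "central (\<delta> / 2) \<alpha> (rescale k q w c)" using q \<alpha> by (auto simp: B_def)
      then show ?thesis using \<alpha> by (auto simp: slanted_lines_def)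
    qed
    show "card {q \<in> B k x. ord q = i} \<le> 2 * N + 3" for i
    proof (cases "box k x = {}")
      case False
      then obtain \<alpha> c where box: "(\<alpha>, c) \<in> box k x" by auto
      have \<alpha>: "\<bar>\<alpha>\<bar> \<le> real N" using box by (simp add: box_def slopes_def)
      \<comment> \<open>In a fixed row the rescaled offset is \<open>y - of_int (fst q)\<close>.
        Centrality with slope at most \<open>N\<close> confines it to the interval from - N to N +
        1, leaving at most \<open>2 * N + 3\<close> columns.\<close>
      define y where "y = 2 ^ k * c + \<alpha> * of_int (index_along s i)"
      have "{q \<in> B k x. ord q = i} \<subseteq> {\<lfloor>y\<rfloor> - 1 - int N..\<lfloor>y\<rfloor> + 1 + int N} \<times> {index_along s i}"
      proof
        fix q assume q: "q \<in> {q \<in> B k x. ord q = i}"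
        then have j: "snd q = index_along s i" by (simp add: ord_def index_along_eq)
        have "central (\<delta> / 2) \<alpha> (y - of_int (fst q))"
          using q box by (auto simp: B_def rescale_slanted y_def j algebra_simps)
        then have "y - of_int (fst q) \<le> 1 + real N" "- real N \<le> y - of_int (fst q)"
          using \<alpha> \<delta> by (auto simp: central_def min_def max_def split: if_splits)
        then have "\<lfloor>y\<rfloor> - 1 - int N \<le> fst q" "fst q \<le> \<lfloor>y\<rfloor> + 1 + int N" by linarith+
        then show "q \<in> {\<lfloor>y\<rfloor> - 1 - int N..\<lfloor>y\<rfloor> + 1 + int N} \<times> {index_along s i}"
          using j by (cases q) simp
      qed
      then have "card {q \<in> B k x. ord q = i} \<le> card ({\<lfloor>y\<rfloor> - 1 - int N..\<lfloor>y\<rfloor> + 1 + int N} \<times> {index_along s i})"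
        by (rule card_mono[rotated]) simp
      also have "\<dots> = 2 * N + 3" by (simp add: card_cartesian_product)
      finally show ?thesis .
    qed (simp add: B_def)
  qed simp
  obtain C' where C': "AE \<omega> in percolation_measure p. \<forall>w\<in>\<W>. \<forall>d.
      {z. z \<bullet> (s *\<^sub>R rot w) = d} \<inter> percolation_set \<omega> = {} \<longrightarrow>
      (\<forall>\<^sub>F k in sequentially. real (card (strip_visible \<omega> k w d)) \<le> C' * real (Suc k) * 2 ^ k)"
    using AE_card_strip_visible by blast
  have sub: "central_squares \<delta> \<omega> k \<alpha> (visible_side (1, - \<alpha>) (s *\<^sub>R rot (1, - \<alpha>)) d (percolation_set \<omega>))
      \<subseteq> strip_visible \<omega> k (1, - \<alpha>) d" if \<alpha>: "\<alpha> \<in> slopes N" for \<omega> k d \<alpha>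
  proof
    fix q assume "q \<in> central_squares \<delta> \<omega> k \<alpha> (visible_side (1, - \<alpha>) (s *\<^sub>R rot (1, - \<alpha>)) d (percolation_set \<omega>))"
    then obtain a where q: "q \<in> chosen \<omega> k"
      and a: "a \<in> visible_side (1, - \<alpha>) (s *\<^sub>R rot (1, - \<alpha>)) d (percolation_set \<omega>) \<inter> dyadic_square k q"
      and cen: "central \<delta> \<alpha> (rescale k q (1, - \<alpha>) (a \<bullet> (1, - \<alpha>)))"
      by (auto simp: central_squares_def)
    have g: "q \<in> grid k" using q chosen_subset_grid by blast
    define c where "c = a \<bullet> (1, - \<alpha>)"
    have unit: "fst a \<in> {0..1}" "snd a \<in> {0..1}"
      using a g dyadic_square_unit[of "fst a" "snd a" k q] by auto
    have \<alpha>N: "\<bar>\<alpha>\<bar> \<le> real N" using \<alpha> by (simp add: slopes_def)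
    have "\<bar>\<alpha> * snd a\<bar> \<le> real N * 1" unfolding abs_mult using \<alpha>N unit by (intro mult_mono) auto
    moreover have "c = fst a - \<alpha> * snd a" by (simp add: c_def inner_prod_def)
    ultimately have c: "\<bar>c\<bar> \<le> real N + 1" using unit unfolding atLeastAtMost_iff by linarith
    define x where "x = (\<lfloor>\<alpha> * M k\<rfloor>, \<lfloor>c * M k\<rfloor>)"
    have x: "x \<in> Xw k (1, - \<alpha>)" using floor_J[OF c] by (simp add: x_def Xw_def)
    have "central (\<delta> / 2) \<alpha>' (rescale k q (1, - \<alpha>') c')" if "(\<alpha>', c') \<in> box k x" for \<alpha>' c'
    proof -
      have fl: "\<bar>t - t'\<bar> \<le> 1 / M k" if "\<lfloor>t * M k\<rfloor> = \<lfloor>t' * M k\<rfloor>" for t t'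
      proof -
        have "\<bar>t * M k - t' * M k\<bar> \<le> 1" using that by linarith
        then have "\<bar>t - t'\<bar> * M k \<le> 1" using M[of k] by (simp add: abs_mult flip: left_diff_distrib)
        then show ?thesis using M[of k] by (simp add: field_simps)
      qed
      have d: "\<bar>\<alpha> - \<alpha>'\<bar> \<le> 1 / M k" "\<bar>c - c'\<bar> \<le> 1 / M k"
        using that by (auto simp: box_def x_def intro!: fl)
      have MN: "2 ^ k / M k = 1 / (32 * real N)" using N by (simp add: M_def)
      have "1 / M k \<le> 2 ^ k / M k" using M[of k] by (intro divide_right_mono one_le_power) auto
      then have d1: "\<bar>\<alpha> - \<alpha>'\<bar> \<le> 1 / (32 * real N)" using d MN by simp
      have j: "\<bar>of_int (snd q)\<bar> \<le> (2 :: real) ^ k"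
      proof -
        have "(of_int (snd q) :: real) \<le> of_int (2 ^ k)" "(of_int 0 :: real) \<le> of_int (snd q)"
          using g unfolding of_int_le_iff by (auto simp: grid_def)
        then show ?thesis by simp
      qed
      have "\<bar>(\<alpha> - \<alpha>') * of_int (snd q)\<bar> \<le> 1 / M k * 2 ^ k"
        unfolding abs_mult using d j M[of k] by (intro mult_mono) auto
      moreover have "\<bar>2 ^ k * (c - c')\<bar> \<le> 2 ^ k * (1 / M k)"
        unfolding abs_mult using d M[of k] by (intro mult_mono) auto
      moreover have "rescale k q (1, - \<alpha>) c - rescale k q (1, - \<alpha>') c' = 2 ^ k * (c - c') + (\<alpha> - \<alpha>') * of_int (snd q)"
        by (simp add: rescale_slanted algebra_simps)
      ultimately have d2: "\<bar>rescale k q (1, - \<alpha>) c - rescale k q (1, - \<alpha>') c'\<bar> \<le> 2 / (32 * real N)"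
        using MN by simp
      show ?thesis
        by (rule central_approx[OF cen[folded c_def] d1 d2]) (use N in \<open>simp_all add: \<delta>_def field_simps\<close>)
    qed
    moreover have "(\<alpha>, c) \<in> box k x" using \<alpha> by (simp add: box_def x_def)
    ultimately have "q \<in> B k x" using g by (auto simp: B_def)
    moreover have "a \<bullet> (1, - \<alpha>) \<in> I k x (1, - \<alpha>)" by (simp add: I_def x_def c_def)
    ultimately show "q \<in> strip_visible \<omega> k (1, - \<alpha>) d"
      unfolding strip_visible_def using q a x by blast
  qed
  have card: "card (central_squares \<delta> \<omega> k \<alpha> (visible_side (1, - \<alpha>) (s *\<^sub>R rot (1, - \<alpha>)) d (percolation_set \<omega>)))
      \<le> card (strip_visible \<omega> k (1, - \<alpha>) d)" if "\<alpha> \<in> slopes N" for \<omega> k d \<alpha>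
    using sub[OF that] finite_chosen by (intro card_mono) (auto simp: strip_visible_def)
  show ?thesis
    using C'
  proof eventually_elim
    case (elim \<omega>)
    show ?case
    proof (intro ballI allI impI)
      fix \<alpha> d assume \<alpha>: "\<alpha> \<in> slopes N" and disj: "{z. z \<bullet> (s *\<^sub>R rot (1, - \<alpha>)) = d} \<inter> percolation_set \<omega> = {}"
      have "(1, - \<alpha>) \<in> \<W>" using \<alpha> by (simp add: \<W>_def)
      then have "\<forall>\<^sub>F k in sequentially. real (card (strip_visible \<omega> k (1, - \<alpha>) d)) \<le> C' * real (Suc k) * 2 ^ k"
        using elim disj by blast
      then obtain C where C: "C \<ge> 0" "\<And>k. real (card (strip_visible \<omega> k (1, - \<alpha>) d)) \<le> C * real (Suc k) * 2 ^ k"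
        using eventually_le_imp_bounded by meson
      have "real (card (central_squares \<delta> \<omega> k \<alpha> (visible_side (1, - \<alpha>) (s *\<^sub>R rot (1, - \<alpha>)) d (percolation_set \<omega>))))
          \<le> C * real (Suc k) * 2 ^ k" for k
        using C(2)[of k] card[OF \<alpha>, of \<omega> k d] by (meson of_nat_mono order_trans)
      then show "\<exists>C\<ge>0. \<forall>k. real (card (central_squares (1 / (4 * real N)) \<omega> k \<alpha>
          (visible_side (1, - \<alpha>) (s *\<^sub>R rot (1, - \<alpha>)) d (percolation_set \<omega>)))) \<le> C * real (Suc k) * 2 ^ k"
        using C(1) unfolding \<delta>_def by blast
    qed
  qed
qed

subsection \<open>Squares whose corner is cut off by a slanted line\<close>

text \<open>
  A line that meets a square and its child non-centrally runs past the same corner of both. Hence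
  a square crossed non-centrally is the iterated corner descendant of a child of its last
  ancestor that is crossed centrally, and this ancestor leaves only 16 possibilities for it.
\<close>

definition corner :: "real \<Rightarrow> real \<Rightarrow> real \<Rightarrow> int \<times> int \<Rightarrow> bool" where
  "corner \<delta> \<alpha> \<beta> e \<longleftrightarrow>
     e = (1, if 0 < \<alpha> then 0 else 1) \<and> 1 - \<delta> < min \<beta> (\<alpha> + \<beta>) \<or>
     e = (0, if 0 < \<alpha> then 1 else 0) \<and> max \<beta> (\<alpha> + \<beta>) < \<delta>"

definition bits :: "(int \<times> int) set" where
  "bits = {0, 1} \<times> {0, 1}"

lemma not_central_imp_corner: "\<not> central \<delta> \<alpha> \<beta> \<Longrightarrow> \<exists>e\<in>bits. corner \<delta> \<alpha> \<beta> e"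
  unfolding central_def corner_def bits_def by (auto simp: not_le)

text \<open>Inside the parent the line stays within horizontal distance \<open>\<delta>\<close> of
  the side at the corner \<open>e\<close>. As
  \<open>4 * \<delta> \<le> \<bar>\<alpha>\<bar>\<close>, it also stays within vertical distance 1 /
  4 of the corner, so the child it meets is the corner child. There it still comes within
  \<open>2 * \<delta> \<le> 1 / 2\<close> of that side, which rules out the opposite corner.\<close>

lemma corner_step:
  fixes b1 b2 :: int
  assumes \<alpha>: "4 * \<delta> \<le> \<bar>\<alpha>\<bar>" and \<delta>: "0 < \<delta>" "\<delta> \<le> 1 / 4"
    and b: "b1 \<in> {0, 1}" "b2 \<in> {0, 1}" and \<beta>': "\<beta>' = 2 * \<beta> - of_int b1 + \<alpha> * of_int b2"
    and XY: "X \<in> {0..1}" "Y \<in> {0..1}" "X = \<alpha> * Y + \<beta>'"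
    and c: "corner \<delta> \<alpha> \<beta> e" and nc: "\<not> central \<delta> \<alpha> \<beta>'"
  shows "e = (b1, b2) \<and> corner \<delta> \<alpha> \<beta>' e"
proof -
  \<comment> \<open>The crossing point in the coordinates of the parent square; \<open>X\<close> and
    \<open>Y\<close> are its coordinates in the child.\<close>
  define x y where "x = (X + of_int b1) / 2" and "y = (Y + of_int b2) / 2"
  have xy: "x = \<alpha> * y + \<beta>" using XY(3) by (simp add: x_def y_def \<beta>' field_simps)
  have xb: "0 \<le> x" "x \<le> 1" "0 \<le> y" "y \<le> 1" using XY b by (auto simp: x_def y_def)
  have b1: "b1 = 1" if "1 / 2 < x" using that b XY by (auto simp: x_def)
  have b1': "b1 = 0" if "x < 1 / 2" using that b XY by (auto simp: x_def)
  have b2: "b2 = 1" if "1 / 2 < y" using that b XY by (auto simp: y_def)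
  have b2': "b2 = 0" if "y < 1 / 2" using that b XY by (auto simp: y_def)
  have small: "t < 1 / 2" if "\<bar>\<alpha>\<bar> * t < \<delta>" for t
  proof (rule ccontr)
    assume "\<not> t < 1 / 2"
    then have "\<bar>\<alpha>\<bar> * (1 / 2) \<le> \<bar>\<alpha>\<bar> * t" by (intro mult_left_mono) auto
    then show False using that \<alpha> \<delta> by linarith
  qed
  show ?thesis
  proof (cases "0 < \<alpha>")
    case True
    have m: "min \<gamma> (\<alpha> + \<gamma>) = \<gamma>" "max \<gamma> (\<alpha> + \<gamma>) = \<alpha> + \<gamma>" for \<gamma> using True by (auto simp: min_def max_def)
    have ay: "0 \<le> \<alpha> * y" "0 \<le> \<alpha> * (1 - y)" using True xb by auto
    consider "e = (1, 0)" "1 - \<delta> < \<beta>" | "e = (0, 1)" "\<alpha> + \<beta> < \<delta>"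
      using c True unfolding corner_def m by auto
    then show ?thesis
    proof cases
      case 1
      have "b1 = 1" by (rule b1) (use 1 xy ay \<delta> in linarith)
      moreover have "b2 = 0"
        by (rule b2', rule small) (use 1 xy xb True in simp)
      ultimately show ?thesis
        using 1 nc \<delta> True unfolding corner_def central_def m by (auto simp: \<beta>')
    next
      case 2
      have h: "\<alpha> + \<beta> - x = \<alpha> * (1 - y)" using xy by (simp add: algebra_simps)
      have "b1 = 0" by (rule b1') (use 2 h ay \<delta> in linarith)
      moreover have "1 - y < 1 / 2" by (rule small) (use 2 h xb True in simp)
      then have "b2 = 1" by (intro b2) simp
      ultimately show ?thesis
        using 2 nc \<delta> True unfolding corner_def central_def m by (auto simp: \<beta>')
    qed
  next
    case False
    then have neg: "\<alpha> < 0" using \<alpha> \<delta> by (cases "\<alpha> = 0") auto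
    have m: "min \<gamma> (\<alpha> + \<gamma>) = \<alpha> + \<gamma>" "max \<gamma> (\<alpha> + \<gamma>) = \<gamma>" for \<gamma> using neg by (auto simp: min_def max_def)
    have ay: "\<alpha> * y \<le> 0" "\<alpha> * (1 - y) \<le> 0" using neg xb by (auto simp: mult_le_0_iff)
    have h: "\<alpha> + \<beta> - x = \<alpha> * (1 - y)" using xy by (simp add: algebra_simps)
    consider "e = (1, 1)" "1 - \<delta> < \<alpha> + \<beta>" | "e = (0, 0)" "\<beta> < \<delta>"
      using c False unfolding corner_def m by auto
    then show ?thesis
    proof cases
      case 1
      have "b1 = 1" by (rule b1) (use 1 h ay \<delta> in linarith)
      moreover have "1 - y < 1 / 2" by (rule small) (use 1 h xb neg in simp)
      then have "b2 = 1" by (intro b2) simp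
      ultimately show ?thesis
        using 1 nc \<delta> False unfolding corner_def central_def m by (auto simp: \<beta>')
    next
      case 2
      have "b1 = 0" by (rule b1') (use 2 xy ay \<delta> in linarith)
      moreover have "b2 = 0"
        by (rule b2', rule small) (use 2 xy xb neg in simp)
      ultimately show ?thesis
        using 2 nc \<delta> False unfolding corner_def central_def m by (auto simp: \<beta>')
    qed
  qed
qed

text \<open>\<open>2 ^ m - 1\<close> consists of \<open>m\<close> binary ones: the child in corner
  \<open>e\<close> is taken \<open>m\<close> times.\<close>

definition corner_descendant :: "int \<times> int \<Rightarrow> nat \<Rightarrow> int \<times> int \<Rightarrow> int \<times> int" where
  "corner_descendant q m e = (2 ^ m * fst q + fst e * (2 ^ m - 1), 2 ^ m * snd q + snd e * (2 ^ m - 1))"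

lemma corner_descendant_0 [simp]: "corner_descendant q 0 e = q"
  by (simp add: corner_descendant_def)

lemma corner_descendant_Suc:
  "corner_descendant q (Suc m) e = (2 * fst (corner_descendant q m e) + fst e, 2 * snd (corner_descendant q m e) + snd e)"
  by (simp add: corner_descendant_def algebra_simps)

definition child :: "int \<times> int \<Rightarrow> int \<times> int \<Rightarrow> int \<times> int" where
  "child q b = (2 * fst q + fst b, 2 * snd q + snd b)"

text \<open>Induction along the ancestors that contain \<open>a\<close>. The corner is part of the
  statement because it is the invariant: it is inherited as long as the ancestors stay noncentral.
  Without any central ancestor the chain reaches back to the root, which is the first
  alternative.\<close>

lemma noncentral_chain:
  assumes \<alpha>: "4 * \<delta> \<le> \<bar>\<alpha>\<bar>" and \<delta>: "0 < \<delta>" "\<delta> \<le> 1 / 4"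
    and q: "q \<in> chosen \<omega> k" and a: "a \<in> V" "a \<in> dyadic_square k q"
    and nc: "\<not> central \<delta> \<alpha> (rescale k q (1, - \<alpha>) (a \<bullet> (1, - \<alpha>)))"
  shows "\<exists>e\<in>bits. corner \<delta> \<alpha> (rescale k q (1, - \<alpha>) (a \<bullet> (1, - \<alpha>))) e \<and>
    (q = corner_descendant (0, 0) k e \<or>
     (\<exists>j<k. \<exists>r\<in>central_squares \<delta> \<omega> j \<alpha> V. \<exists>b\<in>bits. q = corner_descendant (child r b) (k - Suc j) e))"
  using q a(2) nc
proof (induction k arbitrary: q)
  case 0
  then show ?case using not_central_imp_corner by auto
next
  case (Suc k)
  define r where "r = (fst q div 2, snd q div 2)"
  define b where "b = (fst q mod 2, snd q mod 2)"
  have qrb: "q = child r b" by (simp add: child_def r_def b_def)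
  have b: "b \<in> bits" "fst b \<in> {0, 1}" "snd b \<in> {0, 1}" by (auto simp: b_def bits_def)
  have r: "r \<in> chosen \<omega> k" using Suc.prems(1) by (cases q) (simp add: r_def)
  have ar: "a \<in> dyadic_square k r"
    using Suc.prems(2) dyadic_square_Suc_subset[of k "fst q" "snd q"] by (auto simp: r_def)
  define \<beta> where "\<beta> = rescale k r (1, - \<alpha>) (a \<bullet> (1, - \<alpha>))"
  define \<beta>' where "\<beta>' = rescale (Suc k) q (1, - \<alpha>) (a \<bullet> (1, - \<alpha>))"
  have nc': "\<not> central \<delta> \<alpha> \<beta>'" using Suc.prems(3) by (simp add: \<beta>'_def)
  show ?case
  proof (cases "central \<delta> \<alpha> \<beta>")
    case True
    obtain e where e: "e \<in> bits" "corner \<delta> \<alpha> \<beta>' e" using not_central_imp_corner[OF nc'] by blast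
    have "r \<in> central_squares \<delta> \<omega> k \<alpha> V"
      using r a(1) ar True by (auto simp: central_squares_def \<beta>_def)
    then have "\<exists>j<Suc k. \<exists>r\<in>central_squares \<delta> \<omega> j \<alpha> V. \<exists>b\<in>bits. q = corner_descendant (child r b) (Suc k - Suc j) e"
      using b(1) qrb by (intro exI[of _ k] conjI bexI[of _ r] bexI[of _ b]) auto
    then show ?thesis using e unfolding \<beta>'_def by blast
  next
    case False
    obtain e where e: "e \<in> bits" "corner \<delta> \<alpha> \<beta> e" and
      alt: "r = corner_descendant (0, 0) k e \<or>
       (\<exists>j<k. \<exists>r'\<in>central_squares \<delta> \<omega> j \<alpha> V. \<exists>b\<in>bits. r = corner_descendant (child r' b) (k - Suc j) e)"
      using Suc.IH[OF r ar] False unfolding \<beta>_def by blast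
    define X Y where "X = 2 ^ Suc k * fst a - of_int (fst q)" and "Y = 2 ^ Suc k * snd a - of_int (snd q)"
    have step: "e = (fst b, snd b) \<and> corner \<delta> \<alpha> \<beta>' e"
    proof (rule corner_step[OF \<alpha> \<delta> b(2,3) _ _ _ _ e(2) nc'])
      show "\<beta>' = 2 * \<beta> - of_int (fst b) + \<alpha> * of_int (snd b)"
        by (simp add: \<beta>'_def \<beta>_def rescale_slanted qrb child_def algebra_simps)
      show "X \<in> {0..1}" "Y \<in> {0..1}"
        using Suc.prems(2) mem_dyadic_square[of "fst a" "snd a" "Suc k" "fst q" "snd q"] by (auto simp: X_def Y_def)
      show "X = \<alpha> * Y + \<beta>'"
        by (simp add: X_def Y_def \<beta>'_def rescale_slanted inner_prod_def algebra_simps)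
    qed
    have q: "q = (2 * fst r + fst e, 2 * snd r + snd e)" using step by (simp add: qrb child_def)
    from alt have "q = corner_descendant (0, 0) (Suc k) e \<or>
      (\<exists>j<Suc k. \<exists>r'\<in>central_squares \<delta> \<omega> j \<alpha> V. \<exists>b\<in>bits. q = corner_descendant (child r' b) (Suc k - Suc j) e)"
    proof
      assume "r = corner_descendant (0, 0) k e"
      then show ?thesis using q by (simp add: corner_descendant_Suc)
    next
      assume "\<exists>j<k. \<exists>r'\<in>central_squares \<delta> \<omega> j \<alpha> V. \<exists>b\<in>bits. r = corner_descendant (child r' b) (k - Suc j) e"
      then obtain j r' b' where j: "j < k" "r' \<in> central_squares \<delta> \<omega> j \<alpha> V" "b' \<in> bits"
        "r = corner_descendant (child r' b') (k - Suc j) e" by blast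
      have "Suc k - Suc j = Suc (k - Suc j)" using j(1) by simp
      then have "q = corner_descendant (child r' b') (Suc k - Suc j) e"
        using q j(4) by (simp only: corner_descendant_Suc)
      then show ?thesis using j(1-3) less_SucI by blast
    qed
    then show ?thesis using step e(1) unfolding \<beta>'_def by blast
  qed
qed

text \<open>The factor 16 counts a child and a corner for every central ancestor, and 4 counts the
  chains from the root. Since the sum of \<open>2 ^ j\<close> over \<open>j < k\<close> is below
  \<open>2 ^ k\<close>, charging to all earlier levels costs only a constant factor and no further
  power of \<open>k\<close>.\<close>

lemma card_le_central_squares:
  assumes \<alpha>: "4 * \<delta> \<le> \<bar>\<alpha>\<bar>" and \<delta>: "0 < \<delta>" "\<delta> \<le> 1 / 4"
    and C: "0 \<le> C" "\<And>k. real (card (central_squares \<delta> \<omega> k \<alpha> V)) \<le> C * real (Suc k) * 2 ^ k"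
  shows "real (card {q\<in>chosen \<omega> k. dyadic_square k q \<inter> V \<noteq> {}}) \<le> (17 * C + 4) * real (Suc k) * 2 ^ k"
proof -
  let ?M = "\<lambda>j. central_squares \<delta> \<omega> j \<alpha> V"
  have fin: "finite (?M j)" for j using finite_chosen by (simp add: central_squares_def)
  have bits: "finite bits" "card bits = 4" by (simp_all add: bits_def card_cartesian_product)
  define P where "P j = (\<lambda>(r, b, e). corner_descendant (child r b) (k - Suc j) e) ` (?M j \<times> bits \<times> bits)" for j
  define Z where "Z = corner_descendant (0, 0) k ` bits"
  have finP: "finite (P j)" for j using fin bits by (simp add: P_def)
  have cardP: "card (P j) \<le> 16 * card (?M j)" for j
    using card_image_le[of "?M j \<times> bits \<times> bits" "\<lambda>(r, b, e). corner_descendant (child r b) (k - Suc j) e"] fin bits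
    by (simp add: P_def card_cartesian_product)
  have Z: "finite Z" "card Z \<le> 4" using bits card_image_le[of bits "corner_descendant (0, 0) k"] by (simp_all add: Z_def)
  have "{q\<in>chosen \<omega> k. dyadic_square k q \<inter> V \<noteq> {}} \<subseteq> ?M k \<union> (\<Union>j<k. P j) \<union> Z"
  proof
    fix q assume "q \<in> {q\<in>chosen \<omega> k. dyadic_square k q \<inter> V \<noteq> {}}"
    then obtain a where q: "q \<in> chosen \<omega> k" and a: "a \<in> V" "a \<in> dyadic_square k q" by blast
    show "q \<in> ?M k \<union> (\<Union>j<k. P j) \<union> Z"
    proof (cases "central \<delta> \<alpha> (rescale k q (1, - \<alpha>) (a \<bullet> (1, - \<alpha>)))")
      case True
      then show ?thesis using q a by (auto simp: central_squares_def)
    next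
      case False
      obtain e where e: "e \<in> bits" and
        alt: "q = corner_descendant (0, 0) k e \<or>
          (\<exists>j<k. \<exists>r\<in>?M j. \<exists>b\<in>bits. q = corner_descendant (child r b) (k - Suc j) e)"
        using noncentral_chain[OF \<alpha> \<delta> q a False] by blast
      from alt show ?thesis
      proof
        assume "q = corner_descendant (0, 0) k e"
        then show ?thesis using e by (simp add: Z_def)
      next
        assume "\<exists>j<k. \<exists>r\<in>?M j. \<exists>b\<in>bits. q = corner_descendant (child r b) (k - Suc j) e"
        then obtain j r b where j: "j < k" "r \<in> ?M j" "b \<in> bits" "q = corner_descendant (child r b) (k - Suc j) e" by blast
        have "q \<in> P j" unfolding P_def by (rule image_eqI[of _ _ "(r, b, e)"]) (use j e in auto)
        then show ?thesis using j(1) by blast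
      qed
    qed
  qed
  then have "card {q\<in>chosen \<omega> k. dyadic_square k q \<inter> V \<noteq> {}} \<le> card (?M k \<union> (\<Union>j<k. P j) \<union> Z)"
    by (rule card_mono[rotated]) (use fin finP Z in auto)
  also have "\<dots> \<le> card (?M k) + card (\<Union>j<k. P j) + card Z"
    by (meson add_le_mono1 card_Un_le le_trans)
  also have "\<dots> \<le> card (?M k) + (\<Sum>j<k. 16 * card (?M j)) + 4"
    using card_UN_le[of "{..<k}" P] sum_mono[of "{..<k}" "\<lambda>j. card (P j)" "\<lambda>j. 16 * card (?M j)"] cardP Z(2)
    by (intro add_mono) (auto intro: order_trans)
  finally have "real (card {q\<in>chosen \<omega> k. dyadic_square k q \<inter> V \<noteq> {}})
      \<le> real (card (?M k) + (\<Sum>j<k. 16 * card (?M j)) + 4)" by (simp only: of_nat_le_iff)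
  also have "\<dots> = real (card (?M k)) + (\<Sum>j<k. 16 * real (card (?M j))) + 4" by simp
  also have "\<dots> \<le> C * real (Suc k) * 2 ^ k + 16 * C * real (Suc k) * 2 ^ k + 4 * (real (Suc k) * 2 ^ k)"
  proof (intro add_mono C(2))
    have "(\<Sum>j<k. 16 * real (card (?M j))) \<le> (\<Sum>j<k. 16 * C * real (Suc k) * 2 ^ j)"
    proof (rule sum_mono)
      fix j assume "j \<in> {..<k}"
      then have "C * real (Suc j) * 2 ^ j \<le> C * real (Suc k) * 2 ^ j"
        using C(1) by (intro mult_right_mono mult_left_mono) auto
      then show "16 * real (card (?M j)) \<le> 16 * C * real (Suc k) * 2 ^ j" using C(2)[of j] by linarith
    qed
    also have "\<dots> = 16 * C * real (Suc k) * (\<Sum>j<k. 2 ^ j)" by (simp add: sum_distrib_left)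
    also have "(\<Sum>j<k. 2 ^ j) = (2 :: real) ^ k - 1" by (induction k) auto
    also have "16 * C * real (Suc k) * (2 ^ k - 1) \<le> 16 * C * real (Suc k) * 2 ^ k"
      using C(1) by (intro mult_left_mono) auto
    finally show "(\<Sum>j<k. 16 * real (card (?M j))) \<le> 16 * C * real (Suc k) * 2 ^ k" .
    have "1 \<le> real (Suc k) * 2 ^ k"
      using mult_mono[of 1 "real (Suc k)" 1 "2 ^ k"] by (simp add: one_le_power)
    then show "4 \<le> 4 * (real (Suc k) * 2 ^ k)" by simp
  qed
  also have "\<dots> = (17 * C + 4) * real (Suc k) * 2 ^ k" by (simp add: algebra_simps)
  finally show ?thesis .
qed

lemma AE_regular_slanted:
  assumes p: "1 / 2 < p" "p < 1" and N: "N \<ge> 1"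
  shows "AE \<omega> in percolation_measure p. \<forall>\<alpha>\<in>slopes N. regular \<omega> (1, - \<alpha>)"
proof -
  define \<delta> where "\<delta> = 1 / (4 * real N)"
  have \<delta>: "0 < \<delta>" "\<delta> \<le> 1 / 4" using N by (simp_all add: \<delta>_def field_simps)
  have \<alpha>\<delta>: "4 * \<delta> \<le> \<bar>\<alpha>\<bar>" if "\<alpha> \<in> slopes N" for \<alpha>
    using that by (simp add: slopes_def \<delta>_def)
  have "AE \<omega> in percolation_measure p. \<forall>\<alpha>\<in>slopes N. \<forall>d.
    {z. z \<bullet> (s *\<^sub>R rot (1, - \<alpha>)) = d} \<inter> percolation_set \<omega> = {} \<longrightarrow>
    (\<exists>C. \<forall>k. real (card (side_squares \<omega> k (1, - \<alpha>) (s *\<^sub>R rot (1, - \<alpha>)) d)) \<le> C * real (Suc k) * 2 ^ k)"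
    if s: "s \<in> {1, - 1}" for s
    using AE_card_central_squares[OF p N s]
  proof eventually_elim
    case (elim \<omega>)
    show ?case
    proof (intro ballI allI impI)
      fix \<alpha> d assume \<alpha>: "\<alpha> \<in> slopes N" and disj: "{z. z \<bullet> (s *\<^sub>R rot (1, - \<alpha>)) = d} \<inter> percolation_set \<omega> = {}"
      obtain C where C: "C \<ge> 0" "\<And>k. real (card (central_squares \<delta> \<omega> k \<alpha>
          (visible_side (1, - \<alpha>) (s *\<^sub>R rot (1, - \<alpha>)) d (percolation_set \<omega>)))) \<le> C * real (Suc k) * 2 ^ k"
        using elim \<alpha> disj unfolding \<delta>_def by blast
      show "\<exists>C. \<forall>k. real (card (side_squares \<omega> k (1, - \<alpha>) (s *\<^sub>R rot (1, - \<alpha>)) d)) \<le> C * real (Suc k) * 2 ^ k"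
        unfolding side_squares_def using card_le_central_squares[OF \<alpha>\<delta>[OF \<alpha>] \<delta> C] by blast
    qed
  qed
  from this[of 1, simplified] this[of "- 1", simplified] show ?thesis
    by eventually_elim (simp add: regular_def)
qed

section \<open>All directions simultaneously\<close>

definition fat_projection :: "construction \<Rightarrow> real \<times> real \<Rightarrow> bool" where
  "fat_projection \<omega> w \<longleftrightarrow> (\<exists>c1 c2. c1 < c2 \<and> (\<forall>c\<in>{c1..c2}. \<exists>z\<in>percolation_set \<omega>. z \<bullet> w = c))"

text \<open>Undoing the zoom into \<open>q\<close> turns the interval of hit offsets into an
  interval of length \<open>(b2 - b1) / 2 ^ k\<close> in the projection of the whole set.\<close>

lemma fat_projectionI:
  assumes q: "q \<in> chosen \<omega> k" "shift k q \<omega> \<in> hits \<Lambda>"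
    and b: "b1 < b2" "\<And>\<beta>. \<beta> \<in> {b1..b2} \<Longrightarrow> (w, \<beta>) \<in> \<Lambda>"
  shows "fat_projection \<omega> w"
proof -
  define t where "t = of_int (fst q) * fst w + of_int (snd q) * snd w"
  have "\<exists>z\<in>percolation_set \<omega>. z \<bullet> w = c" if c: "c \<in> {(b1 + t) / 2 ^ k..(b2 + t) / 2 ^ k}" for c
  proof -
    have "rescale k q w c \<in> {b1..b2}" using c by (auto simp: rescale_def t_def field_simps)
    then show ?thesis using hits_shiftD[OF q, of w c] b(2) by blast
  qed
  moreover have "(b1 + t) / 2 ^ k < (b2 + t) / 2 ^ k" using b(1) by (simp add: divide_strict_right_mono)
  ultimately show ?thesis unfolding fat_projection_def by blast
qed

lemma AE_fat_projection_axis: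
  assumes p: "1 / 2 < p" "p < 1" and w: "w = (1, 0) \<or> w = (0, 1)"
  shows "AE \<omega> in percolation_measure p. percolation_set \<omega> \<noteq> {} \<longrightarrow> fat_projection \<omega> w"
proof -
  have "axis_lines w \<noteq> {}" by (simp add: axis_lines_def)
  from AE_hits_or_extinct[OF _ _ prob_hits_axis_lines[OF p w] this] p
  have "AE \<omega> in percolation_measure p. percolation_set \<omega> \<noteq> {} \<longrightarrow>
      (\<exists>k. \<exists>q\<in>chosen \<omega> k. shift k q \<omega> \<in> hits (axis_lines w))" by simp
  then show ?thesis
  proof eventually_elim
    case (elim \<omega>)
    show ?case
    proof
      assume "percolation_set \<omega> \<noteq> {}"
      then obtain k q where q: "q \<in> chosen \<omega> k" "shift k q \<omega> \<in> hits (axis_lines w)" using elim by blast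
      show "fat_projection \<omega> w"
        by (rule fat_projectionI[OF q, of 0 1]) (auto simp: axis_lines_def)
    qed
  qed
qed

lemma AE_fat_projection_slanted:
  assumes p: "1 / 2 < p" "p < 1" and N: "N \<ge> 1"
  shows "AE \<omega> in percolation_measure p. percolation_set \<omega> \<noteq> {} \<longrightarrow> (\<forall>\<alpha>\<in>slopes N. fat_projection \<omega> (1, - \<alpha>))"
proof -
  let ?\<Lambda> = "slanted_lines N (1 / 4)"
  \<comment> \<open>The line with offset \<open>1 / 2 - \<alpha> / 2\<close> runs through the centre
    of the unit square, so offsets within 1 / 4 of it are central for every slope.\<close>
  have cen: "((1, - \<alpha>), \<beta>) \<in> ?\<Lambda>" if "\<alpha> \<in> slopes N" "\<beta> \<in> {1 / 2 - \<alpha> / 2 - 1 / 4..1 / 2 - \<alpha> / 2 + 1 / 4}" for \<alpha> \<beta>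
    using that by (auto simp: slanted_lines_def central_def min_def max_def)
  have "1 \<in> slopes N" using N by (simp add: slopes_def)
  then have ne: "?\<Lambda> \<noteq> {}" using cen[of 1 0] by auto
  have "0 < measure (percolation_measure p) (hits ?\<Lambda>)"
    using p N by (intro prob_hits_slanted_lines) auto
  from AE_hits_or_extinct[OF _ _ this ne] p
  have "AE \<omega> in percolation_measure p. percolation_set \<omega> \<noteq> {} \<longrightarrow>
      (\<exists>k. \<exists>q\<in>chosen \<omega> k. shift k q \<omega> \<in> hits ?\<Lambda>)" by simp
  then show ?thesis
  proof eventually_elim
    case (elim \<omega>)
    show ?case
    proof (intro impI ballI)
      fix \<alpha> assume "percolation_set \<omega> \<noteq> {}" and \<alpha>: "\<alpha> \<in> slopes N"
      then obtain k q where q: "q \<in> chosen \<omega> k" "shift k q \<omega> \<in> hits ?\<Lambda>" using elim by blast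
      show "fat_projection \<omega> (1, - \<alpha>)"
        by (rule fat_projectionI[OF q _ cen[OF \<alpha>]]) auto
    qed
  qed
qed

lemma slopes_cover:
  assumes "\<alpha> \<noteq> 0"
  shows "\<exists>N\<ge>1. \<alpha> \<in> slopes N"
proof -
  obtain n where n: "\<bar>\<alpha>\<bar> + 1 / \<bar>\<alpha>\<bar> \<le> real n" using real_arch_simple by blast
  have pos: "0 < \<bar>\<alpha>\<bar>" "0 < 1 / \<bar>\<alpha>\<bar>" using assms by auto
  have n0: "0 < real n" using n pos by linarith
  have "1 / \<bar>\<alpha>\<bar> \<le> real n" "\<bar>\<alpha>\<bar> \<le> real n" using n pos by linarith+
  then have "1 / real n \<le> \<bar>\<alpha>\<bar>" using n0 pos by (simp add: field_simps)
  then show ?thesis using n0 \<open>\<bar>\<alpha>\<bar> \<le> real n\<close> by (intro exI[of _ n]) (auto simp: slopes_def)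
qed

text \<open>Each earlier statement holds outside a null set for a whole range of slopes. Countably
  many ranges \<open>slopes N\<close> and the two axis directions therefore leave a single null set
  for all directions.\<close>

lemma AE_all_directions:
  assumes p: "1 / 2 < p" "p < 1"
  shows "AE \<omega> in percolation_measure p. \<forall>w. w = (0, 1) \<or> (\<exists>\<alpha>. w = (1, - \<alpha>)) \<longrightarrow>
    regular \<omega> w \<and> (percolation_set \<omega> \<noteq> {} \<longrightarrow> fat_projection \<omega> w)"
proof -
  have "AE \<omega> in percolation_measure p. \<forall>N\<in>{1..}. (\<forall>\<alpha>\<in>slopes N. regular \<omega> (1, - \<alpha>)) \<and>
      (percolation_set \<omega> \<noteq> {} \<longrightarrow> (\<forall>\<alpha>\<in>slopes N. fat_projection \<omega> (1, - \<alpha>)))"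
    using AE_regular_slanted[OF p] AE_fat_projection_slanted[OF p]
    by (subst AE_ball_countable) auto
  moreover have "AE \<omega> in percolation_measure p. regular \<omega> w" if "w = (1, 0) \<or> w = (0, 1)" for w
    by (rule AE_regular_axis[OF p that])
  from this[of "(1, 0)"] this[of "(0, 1)"]
  have "AE \<omega> in percolation_measure p. regular \<omega> (1, 0)" "AE \<omega> in percolation_measure p. regular \<omega> (0, 1)"
    by simp_all
  moreover have "AE \<omega> in percolation_measure p. percolation_set \<omega> \<noteq> {} \<longrightarrow> fat_projection \<omega> (1, 0)"
    "AE \<omega> in percolation_measure p. percolation_set \<omega> \<noteq> {} \<longrightarrow> fat_projection \<omega> (0, 1)"
    by (rule AE_fat_projection_axis[OF p]; simp)+
  ultimately show ?thesis
  proof eventually_elim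
    case (elim \<omega>)
    show ?case
    proof (intro allI impI)
      fix w :: "real \<times> real" assume "w = (0, 1) \<or> (\<exists>\<alpha>. w = (1, - \<alpha>))"
      then consider "w = (0, 1)" | "w = (1, 0)" | \<alpha> where "w = (1, - \<alpha>)" "\<alpha> \<noteq> 0" by fastforce
      then show "regular \<omega> w \<and> (percolation_set \<omega> \<noteq> {} \<longrightarrow> fat_projection \<omega> w)"
      proof cases
        case (3 \<alpha>)
        then obtain N where "N \<in> {1..}" "\<alpha> \<in> slopes N" using slopes_cover by auto
        then show ?thesis using elim(1) 3(1) by blast
      qed (use elim in auto)
    qed
  qed
qed

lemma visible_part_dimensions:
  assumes l: "l = {z. z \<bullet> rot w = d}" "w \<noteq> 0" "l \<inter> percolation_set \<omega> = {}"
    and reg: "regular \<omega> w" and fat: "fat_projection \<omega> w"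
  shows "hausdorff_dim (visible_part l (percolation_set \<omega>)) = 1" "has_box_dim (visible_part l (percolation_set \<omega>)) 1"
proof -
  let ?V = "visible_part l (percolation_set \<omega>)"
  have V: "?V \<subseteq> percolation_set \<omega>" by (auto simp: visible_part_def)
  obtain C where C: "\<And>k. real (box_count k ?V) \<le> C * real (Suc k) * 2 ^ k"
    using regular_box_count_le[OF reg l(2) l(3)[unfolded l(1)]] unfolding l(1) by blast
  obtain c1 c2 where c: "c1 < c2" "\<And>c. c \<in> {c1..c2} \<Longrightarrow> \<exists>z\<in>percolation_set \<omega>. z \<bullet> w = c"
    using fat unfolding fat_projection_def by blast
  have proj: "\<exists>v\<in>?V. v \<bullet> w = x" if "x \<in> {c1..c2}" for x
    using c(2)[OF that] visible_part_projection[OF l(2) compact_percolation_set l(3)[unfolded l(1)]]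
    unfolding l(1) by metis
  show "hausdorff_dim ?V = 1"
    using hausdorff_dim_le_1[OF V C] hausdorff_dim_ge_1[OF proj c(1)] by (rule antisym)
  show "has_box_dim ?V 1"
  proof (rule has_box_dim_1[OF _ _ C])
    have w: "0 < norm w" using l(2) by simp
    show "0 < (c2 - c1) / (4 * norm w)" using c(1) w by simp
    show "(c2 - c1) / (4 * norm w) * 2 ^ k \<le> real (box_count k ?V)" for k
      using box_count_ge[OF V proj c(1), of k] w by (simp add: field_simps)
  qed
qed

theorem theorem1p3:
  fixes p :: real
  assumes "1 / 2 < p" and "p < 1"
  shows "(AE \<omega> in uniform_measure (percolation_measure p) {\<omega>. percolation_set \<omega> \<noteq> {}}.
            \<forall>l. is_line l \<and> l \<inter> percolation_set \<omega> = {} \<longrightarrow>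
              hausdorff_dim (visible_part l (percolation_set \<omega>)) = 1 \<and>
              has_box_dim (visible_part l (percolation_set \<omega>)) 1)
       \<and> (\<forall>a :: nat \<Rightarrow> real. filterlim (\<lambda>k. a k / real k) at_top sequentially \<longrightarrow>
            (AE \<omega> in percolation_measure p.
               \<forall>l. is_line l \<and> l \<inter> percolation_set \<omega> = {} \<longrightarrow>
                 (\<exists>K. \<forall>k\<ge>K. real (box_count k (visible_part l (percolation_set \<omega>))) \<le> a k * 2 ^ k)))"
proof (intro conjI allI impI)
  have dir: "\<exists>w d. w \<noteq> 0 \<and> (w = (0, 1) \<or> (\<exists>\<alpha>. w = (1, - \<alpha>))) \<and> l = {z. z \<bullet> rot w = d}"
    if "is_line l" for l :: "(real \<times> real) set"
    using is_line_obtain[OF that] by (metis Pair_inject one_neq_zero zero_prod_def)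
  note AE = AE_all_directions[OF assms]
  show "AE \<omega> in uniform_measure (percolation_measure p) {\<omega>. percolation_set \<omega> \<noteq> {}}.
      \<forall>l. is_line l \<and> l \<inter> percolation_set \<omega> = {} \<longrightarrow>
        hausdorff_dim (visible_part l (percolation_set \<omega>)) = 1 \<and>
        has_box_dim (visible_part l (percolation_set \<omega>)) 1"
  proof (rule AE_uniform_measureI[OF sets_nonextinction])
    show "AE \<omega> in percolation_measure p. \<omega> \<in> {\<omega>. percolation_set \<omega> \<noteq> {}} \<longrightarrow>
      (\<forall>l. is_line l \<and> l \<inter> percolation_set \<omega> = {} \<longrightarrow>
        hausdorff_dim (visible_part l (percolation_set \<omega>)) = 1 \<and>
        has_box_dim (visible_part l (percolation_set \<omega>)) 1)"
      using AE
    proof eventually_elim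
      case (elim \<omega>)
      show ?case
      proof (intro impI allI, elim conjE)
        fix l assume "\<omega> \<in> {\<omega>. percolation_set \<omega> \<noteq> {}}" and l: "is_line l" "l \<inter> percolation_set \<omega> = {}"
        then have ne: "percolation_set \<omega> \<noteq> {}" by simp
        obtain w d where w: "w \<noteq> 0" "w = (0, 1) \<or> (\<exists>\<alpha>. w = (1, - \<alpha>))" "l = {z. z \<bullet> rot w = d}"
          using dir[OF l(1)] by blast
        have "regular \<omega> w" "fat_projection \<omega> w" using elim w(2) ne by blast+
        from visible_part_dimensions[OF w(3,1) l(2) this]
        show "hausdorff_dim (visible_part l (percolation_set \<omega>)) = 1 \<and>
          has_box_dim (visible_part l (percolation_set \<omega>)) 1" by blast
      qed
    qed
  qed
  fix a :: "nat \<Rightarrow> real" assume a: "filterlim (\<lambda>k. a k / real k) at_top sequentially"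
  show "AE \<omega> in percolation_measure p.
      \<forall>l. is_line l \<and> l \<inter> percolation_set \<omega> = {} \<longrightarrow>
        (\<exists>K. \<forall>k\<ge>K. real (box_count k (visible_part l (percolation_set \<omega>))) \<le> a k * 2 ^ k)"
    using AE
  proof eventually_elim
    case (elim \<omega>)
    show ?case
    proof (intro impI allI, elim conjE)
      fix l assume l: "is_line l" "l \<inter> percolation_set \<omega> = {}"
      obtain w d where w: "w \<noteq> 0" "w = (0, 1) \<or> (\<exists>\<alpha>. w = (1, - \<alpha>))" "l = {z. z \<bullet> rot w = d}"
        using dir[OF l(1)] by blast
      have "regular \<omega> w" using elim w(2) by blast
      then obtain C where C: "\<And>k. real (box_count k (visible_part l (percolation_set \<omega>))) \<le> C * real (Suc k) * 2 ^ k"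
        using regular_box_count_le[OF _ w(1)] l(2) w(3) by blast
      \<comment> \<open>The constant 2 comes from \<open>Suc k \<le> 2 * k\<close> for
        \<open>k \<ge> 1\<close>. The constant \<open>C\<close> depends on the construction and the
        line, but the exceptional null set is the same for all sequences \<open>a\<close>.\<close>
      have "\<forall>\<^sub>F k in sequentially. 2 * \<bar>C\<bar> \<le> a k / real k \<and> 1 \<le> k"
        using a by (intro eventually_conj eventually_ge_at_top) (simp add: filterlim_at_top)
      then have "\<forall>\<^sub>F k in sequentially. real (box_count k (visible_part l (percolation_set \<omega>))) \<le> a k * 2 ^ k"
      proof eventually_elim
        case (elim k)
        have "C * real (Suc k) \<le> \<bar>C\<bar> * (2 * real k)"
          using elim by (intro mult_mono) auto
        also have "\<dots> \<le> a k"
          using elim mult_right_mono[of "2 * \<bar>C\<bar>" "a k / real k" "real k"] by simp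
        finally have "C * real (Suc k) * 2 ^ k \<le> a k * 2 ^ k" by (intro mult_right_mono) auto
        then show ?case using C[of k] by linarith
      qed
      then show "\<exists>K. \<forall>k\<ge>K. real (box_count k (visible_part l (percolation_set \<omega>))) \<le> a k * 2 ^ k"
        unfolding eventually_sequentially .
    qed
  qed
qed

end
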